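(* Let $(X,d,\mu)$ be a complete metric measure space that satisfies the volume doubling property and a $(1,p)$-Poincaré inequality for some $p\in(1,\infty)$. Then for any chart $(U,\phi)$ of dimension $n$ we have $\phi_*(\mathbf{1}_U\mu)\ll\mathcal{L}_n$, where $\mathcal{L}_n$ is the Lebesgue measure on $\mathbb{R}^n$. In particular, $\mathcal{H}^n(\phi(U))>0$, where $\mathcal{H}^n$ is the $n$-dimensional Hausdorff measure.
   Context: $\mu$ is a Radon measure on $(X,d)$ for which balls have positive finite measure. Volume doubling: there is $C\in(1,\infty)$ with $\mu(B(x,2r))\le C\mu(B(x,r))$ for all $x\in X,r>0$. Upper gradient: a Borel function $g:X\to[0,\infty]$ is an upper gradient of $f:X\to\mathbb{R}$ if $|f(\gamma(a))-f(\gamma(b))|\le\int_\gamma g\,ds$ for all rectifiable curves $\gamma:[a,b]\to X$. $(1,p)$-Poincaré inequality: there exist $C\in(0,\infty)$ and $\Lambda\in[1,\infty)$ such that for any $f\in L^p(X,\mu)$, any upper gradient $g$ of $f$, and any $x\in X$, $r>0$, $$\frac{1}{\mu(B(x,r))}\int_{B(x,r)}|f-f_{B(x,r)}|\,d\mu\le Cr\Big(\frac{1}{\mu(B(x,\Lambda r))}\int_{B(x,\Lambda r)}g^p\,d\mu\Big)^{1/p},\qquad f_{B}:=\frac1{\mu(B)}\int_Bf\,d\mu.$$ Differentiability: for Lipschitz $f:X\to\mathbb{R}$ and $\phi=(\phi_1,\dots,\phi_n):X\to\mathbb{R}^n$, $f$ is differentiable with respect to $\phi$ at $x_0\in X$ if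 there is a unique $\mathbf{a}\in\mathbb{R}^n$ with $$\limsup_{x\to x_0}\frac{|f(x)-f(x_0)-\langle\mathbf{a},\phi(x)-\phi(x_0)\rangle|}{d(x,x_0)}=0;$$ this $\mathbf{a}$ is the derivative, denoted $\partial_\phi f(x_0)$. Chart: a chart of dimension $n$ on $(X,d,\mu)$ is a pair $(U,\phi)$ where (i) $U\subset X$ is measurable, $\mu(U)>0$, and $\phi:X\to\mathbb{R}^n$ is Lipschitz; (ii) for every Lipschitz $f:X\to\mathbb{R}$ there is a measurable $\partial_\phi f:U\to\mathbb{R}^n$ such that $f$ is differentiable with respect to $\phi$ at $\mu$-a.e. $x_0\in U$ with derivative $\partial_\phi f(x_0)$. $\phi_*$ denotes pushforward of measures. *)

theory Defs
  imports "HOL-Analysis.Analysis"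
begin

section \<open>Metric measure spaces\<close>

text \<open>
  The underlying metric space is a type. The sigma-algebra of a Radon measure may be strictly
  larger than the Borel sigma-algebra, so that both Borel measures and their completions
  (where ``measurable'' means \<open>\<mu>\<close>-measurable) are covered.
\<close>

definition radon_measure :: "'a::topological_space measure \<Rightarrow> bool" where
  "radon_measure M \<longleftrightarrow>
     space M = UNIV \<and> sets borel \<subseteq> sets M \<and>
     (\<forall>K. compact K \<longrightarrow> emeasure M K < \<infinity>) \<and>
     (\<forall>A\<in>sets M. emeasure M A = (INF V\<in>{V. open V \<and> A \<subseteq> V}. emeasure M V)) \<and>
     (\<forall>V. open V \<longrightarrow> emeasure M V = (SUP K\<in>{K. compact K \<and> K \<subseteq> V}. emeasure M K))"

definition metric_measure_space :: "'a::metric_space measure \<Rightarrow> bool" where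
  "metric_measure_space M \<longleftrightarrow>
     radon_measure M \<and>
     (\<forall>x r. r > 0 \<longrightarrow> 0 < emeasure M (ball x r) \<and> emeasure M (ball x r) < \<infinity>)"

definition volume_doubling :: "'a::metric_space measure \<Rightarrow> bool" where
  "volume_doubling M \<longleftrightarrow>
     (\<exists>C::real. C > 1 \<and>
        (\<forall>x r. r > 0 \<longrightarrow> emeasure M (ball x (2 * r)) \<le> ennreal C * emeasure M (ball x r)))"


section \<open>Rectifiable curves and upper gradients\<close>

definition curve_length :: "(real \<Rightarrow> 'a::metric_space) \<Rightarrow> real \<Rightarrow> real \<Rightarrow> ennreal" where
  "curve_length \<gamma> a b =
     (SUP ts\<in>{ts. sorted ts \<and> set ts \<subseteq> {a..b}}.
        \<Sum>i<length ts - 1. ennreal (dist (\<gamma> (ts ! i)) (\<gamma> (ts ! Suc i))))"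

definition rectifiable_curve :: "(real \<Rightarrow> 'a::metric_space) \<Rightarrow> real \<Rightarrow> real \<Rightarrow> bool" where
  "rectifiable_curve \<gamma> a b \<longleftrightarrow>
     a \<le> b \<and> continuous_on {a..b} \<gamma> \<and> curve_length \<gamma> a b < \<infinity>"

text \<open>
  The arc-length parametrization at \<open>t\<close> between \<open>0\<close> and the length of \<open>\<gamma>\<close>. The choice of \<open>s\<close> is
  immaterial, as \<open>\<gamma>\<close> is constant on \<open>{s \<in> {a..b}. curve_length \<gamma> a s = t}\<close>.
\<close>

definition arclength_param ::
    "(real \<Rightarrow> 'a::metric_space) \<Rightarrow> real \<Rightarrow> real \<Rightarrow> real \<Rightarrow> 'a" where
  "arclength_param \<gamma> a b t = \<gamma> (SOME s. s \<in> {a..b} \<and> curve_length \<gamma> a s = ennreal t)"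

definition curve_integral ::
    "('a::metric_space \<Rightarrow> ennreal) \<Rightarrow> (real \<Rightarrow> 'a) \<Rightarrow> real \<Rightarrow> real \<Rightarrow> ennreal" where
  "curve_integral g \<gamma> a b =
     (\<integral>\<^sup>+t\<in>{0..enn2real (curve_length \<gamma> a b)}. g (arclength_param \<gamma> a b t) \<partial>lborel)"

definition upper_gradient :: "('a::metric_space \<Rightarrow> real) \<Rightarrow> ('a \<Rightarrow> ennreal) \<Rightarrow> bool" where
  "upper_gradient f g \<longleftrightarrow>
     g \<in> borel_measurable borel \<and>
     (\<forall>\<gamma> a b. rectifiable_curve \<gamma> a b \<longrightarrow>
        ennreal \<bar>f (\<gamma> a) - f (\<gamma> b)\<bar> \<le> curve_integral g \<gamma> a b)"


section \<open>The Poincare inequality\<close>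

definition ennreal_powr :: "ennreal \<Rightarrow> real \<Rightarrow> ennreal" where
  "ennreal_powr x p = (if x = \<infinity> then \<infinity> else ennreal (enn2real x powr p))"

definition in_Lp :: "real \<Rightarrow> 'a measure \<Rightarrow> ('a \<Rightarrow> real) \<Rightarrow> bool" where
  "in_Lp p M f \<longleftrightarrow> f \<in> borel_measurable M \<and> integrable M (\<lambda>x. \<bar>f x\<bar> powr p)"

definition set_average :: "'a measure \<Rightarrow> 'a set \<Rightarrow> ('a \<Rightarrow> real) \<Rightarrow> real" where
  "set_average M B f = (LINT x:B|M. f x) / measure M B"

definition poincare_inequality :: "real \<Rightarrow> 'a::metric_space measure \<Rightarrow> bool" where
  "poincare_inequality p M \<longleftrightarrow>
     (\<exists>C \<Lambda>::real. C > 0 \<and> \<Lambda> \<ge> 1 \<and>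
        (\<forall>f g x r. in_Lp p M f \<longrightarrow> upper_gradient f g \<longrightarrow> r > 0 \<longrightarrow>
           (\<integral>\<^sup>+y\<in>ball x r. ennreal \<bar>f y - set_average M (ball x r) f\<bar> \<partial>M) / emeasure M (ball x r)
           \<le> ennreal (C * r) *
             ennreal_powr
               ((\<integral>\<^sup>+y\<in>ball x (\<Lambda> * r). ennreal_powr (g y) p \<partial>M) / emeasure M (ball x (\<Lambda> * r)))
               (1 / p)))"


section \<open>Differentiability with respect to charts\<close>

definition lipschitz_map :: "('a::metric_space \<Rightarrow> 'b::metric_space) \<Rightarrow> bool" where
  "lipschitz_map f \<longleftrightarrow> (\<exists>L. L-lipschitz_on UNIV f)"

definition first_order_approx ::
    "('a::metric_space \<Rightarrow> real) \<Rightarrow> ('a \<Rightarrow> real ^ 'n) \<Rightarrow> 'a \<Rightarrow> real ^ 'n \<Rightarrow> bool" where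
  "first_order_approx f \<phi> x0 a \<longleftrightarrow>
     Limsup (at x0) (\<lambda>x. ennreal (\<bar>f x - f x0 - a \<bullet> (\<phi> x - \<phi> x0)\<bar> / dist x x0)) = 0"

definition differentiable_wrt ::
    "('a::metric_space \<Rightarrow> real) \<Rightarrow> ('a \<Rightarrow> real ^ 'n) \<Rightarrow> 'a \<Rightarrow> bool" where
  "differentiable_wrt f \<phi> x0 \<longleftrightarrow> (\<exists>!a. first_order_approx f \<phi> x0 a)"

definition derivative_wrt ::
    "('a::metric_space \<Rightarrow> real) \<Rightarrow> ('a \<Rightarrow> real ^ 'n) \<Rightarrow> 'a \<Rightarrow> real ^ 'n" where
  "derivative_wrt f \<phi> x0 = (THE a. first_order_approx f \<phi> x0 a)"

definition chart :: "'a::metric_space measure \<Rightarrow> 'a set \<Rightarrow> ('a \<Rightarrow> real ^ 'n) \<Rightarrow> bool" where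
  "chart M U \<phi> \<longleftrightarrow>
     U \<in> sets M \<and> emeasure M U > 0 \<and> lipschitz_map \<phi> \<and>
     (\<forall>f::'a \<Rightarrow> real. lipschitz_map f \<longrightarrow>
        (\<exists>D \<in> borel_measurable (restrict_space M U).
           AE x in M. x \<in> U \<longrightarrow> differentiable_wrt f \<phi> x \<and> derivative_wrt f \<phi> x = D x))"


section \<open>Hausdorff measure\<close>

text \<open>
  The Hausdorff outer measure, normalized to agree with Lebesgue measure on n-dimensional
  Euclidean space. Boundedness is required because \<^const>\<open>diameter\<close> is unspecified on unbounded
  sets; empty covering sets contribute \<open>0\<close> also for \<open>n = 0\<close>.
\<close>

definition hausdorff_premeasure :: "nat \<Rightarrow> real \<Rightarrow> 'b::metric_space set \<Rightarrow> ennreal" where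
  "hausdorff_premeasure n \<delta> A =
     (INF E\<in>{E :: nat \<Rightarrow> 'b set. A \<subseteq> (\<Union>i. E i) \<and> (\<forall>i. bounded (E i) \<and> diameter (E i) \<le> \<delta>)}.
        \<Sum>i. if E i = {} then 0 else ennreal (unit_ball_vol (real n) * (diameter (E i) / 2) ^ n))"

definition hausdorff_measure :: "nat \<Rightarrow> 'b::metric_space set \<Rightarrow> ennreal" where
  "hausdorff_measure n A = (SUP \<delta>\<in>{0<..}. hausdorff_premeasure n \<delta> A)"

end

theory Submission
  imports Defs
begin

text \<open>
  Suppose \<open>\<phi>\<close> maps a subset of \<open>U\<close> of positive measure into a compact Lebesgue null set \<open>K\<close>.
  Cover \<open>K\<close> by \<open>M\<close> balls of radius \<open>t\<close> with \<open>M t\<^sup>n\<close> small. There is room in a small ball for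
  \<open>M + 1\<close> well separated slopes, and for nearly optimal heights the maximum of affine functions with
  these slopes has a crease at every centre, up to a small error. Smoothing it produces a small gradient field
  with positive semidefinite derivative and trace at least 1 on \<open>K\<close>. Composing many small steps
  against such fields, each chosen for the current image of \<open>K\<close>, yields \<open>C\<^sup>1\<close> nonexpansive maps \<open>Q\<close>
  uniformly close to the identity whose derivative on \<open>K\<close> has Hilbert-Schmidt norm at most
  \<open>sqrt (n - c)\<close> with \<open>c > 0\<close> depending only on \<open>n\<close>.

  By convexity, a sequence of such maps can be chosen whose derivatives along \<open>\<phi>\<close> converge
  uniformly on a set of positive measure. At a density point of this set, the Poincare inequality for
  the components of \<open>Q\<^sub>k \<circ> \<phi> - Q\<^sub>j \<circ> \<phi>\<close> shows that the limit derivative \<open>l\<close> satisfies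
  \<open>(l - 1) (\<phi> y - \<phi> x) = o(dist y x)\<close>. The uniqueness of the derivative of the zero function in the
  chart forces \<open>l = 1\<close>, whose norm is \<open>sqrt n\<close>: a contradiction.
\<close>

section \<open>Separated sets and convex potentials\<close>

text \<open>A null set can be squeezed by maps of Euclidean space that hardly move any point; a
  Poincare space leaves no such freedom along \<open>\<phi>\<close>. The count \<open>M + 1\<close>
  against \<open>M\<close> is what produces the squeezing: if a centre had only one nearly active
  slope, raising the height of that slope would pay, because each slope has weight
  \<open>M / (M + 1) < 1\<close>. So each centre lies near a crease, where the convex function
  carries a definite amount of Laplacian although all its slopes are small. Nonexpansiveness is kept
  for two reasons. Images of balls of radius \<open>t\<close> stay in balls of radius
  \<open>t\<close>, so one construction with one step size can be iterated; and derivatives are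
  bounded uniformly, which the L^2 selection and the estimates off the good set require. The
  decrease of the norm stops at \<open>1 / (2 n^2)\<close> because the trace of the field is felt by
  the current derivative only while that derivative is nearly an isometry. In the final estimate the
  indices are chosen in the order k, r, j: the j-th map has to be close to the identity relative to
  the scale r, while r depends on how well the k-th map is linearised.\<close>

lemma separated_net:
  fixes A :: "'a::metric_space set"
  assumes "compact A" "r > 0"
  obtains Z where "finite Z" "Z \<subseteq> A" "\<And>x y. x \<in> Z \<Longrightarrow> y \<in> Z \<Longrightarrow> x \<noteq> y \<Longrightarrow> r \<le> dist x y"
    "A \<subseteq> (\<Union>z\<in>Z. ball z r)"
proof -
  define sep where "sep Z \<longleftrightarrow> Z \<subseteq> A \<and> (\<forall>x\<in>Z. \<forall>y\<in>Z. x \<noteq> y \<longrightarrow> r \<le> dist x y)" for Z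
  obtain F where F: "finite F" "A \<subseteq> (\<Union>x\<in>F. ball x (r/2))"
  proof -
    have "A \<subseteq> (\<Union>x\<in>A. ball x (r/2))" using assms(2) by force
    then show ?thesis using compactE_image[OF assms(1), of A "\<lambda>x. ball x (r/2)"] that
      by (metis open_ball)
  qed
  \<comment> \<open>Two separated points cannot share a ball of radius \<open>r/2\<close>, so a
    finite cover by such balls bounds cardinalities. A separated set of largest cardinality then
    exists, and it must be a net.\<close>
  have bnd: "finite Z \<and> card Z \<le> card F" if Z: "sep Z" for Z
  proof -
    have "\<forall>z\<in>Z. \<exists>x\<in>F. dist x z < r/2"
      using Z F(2) unfolding sep_def by (fastforce simp: subset_iff)
    then obtain h where h: "\<And>z. z \<in> Z \<Longrightarrow> h z \<in> F \<and> dist (h z) z < r/2"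
      by metis
    have "inj_on h Z"
    proof (rule inj_onI, rule ccontr)
      fix x y assume xy: "x \<in> Z" "y \<in> Z" "h x = h y" "x \<noteq> y"
      have "dist x y \<le> dist (h x) x + dist (h x) y"
        by (metis dist_commute dist_triangle)
      also have "\<dots> < r" using h[OF xy(1)] h[OF xy(2)] xy(3) by simp
      finally show False using Z xy unfolding sep_def by force
    qed
    moreover have "h ` Z \<subseteq> F" using h by blast
    ultimately show ?thesis
      using F(1) by (meson card_inj_on_le inj_on_finite)
  qed
  have "sep {}" by (simp add: sep_def)
  then obtain Z where Z: "sep Z" "\<And>Z'. sep Z' \<Longrightarrow> card Z' \<le> card Z"
    using ex_has_greatest_nat[of sep "{}" card "Suc (card F)"] bnd by (auto simp: less_Suc_eq_le)
  have "A \<subseteq> (\<Union>z\<in>Z. ball z r)"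
  proof (rule ccontr)
    assume "\<not> ?thesis"
    then obtain a where a: "a \<in> A" "\<And>z. z \<in> Z \<Longrightarrow> r \<le> dist z a"
      by (fastforce simp: subset_iff not_less)
    then have "a \<notin> Z" using assms(2) by force
    moreover have "sep (insert a Z)"
      using Z(1) a unfolding sep_def by (auto simp: dist_commute)
    ultimately show False
      using Z(2)[of "insert a Z"] bnd[OF Z(1)] by simp
  qed
  then show ?thesis
    using that[of Z] Z(1) bnd[OF Z(1)] unfolding sep_def by simp
qed

text \<open>The \<open>h\<close>-balls around a maximal separated subset cover the ball, so
  comparing volumes bounds its size from below. The points will serve as slopes, one more than there
  are covering balls.\<close>

lemma separated_card_ge:
  fixes \<epsilon> h :: real
  assumes "0 < h" "0 < \<epsilon>" "real M * h ^ CARD('n) < \<epsilon> ^ CARD('n)"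
  obtains Y :: "(real ^ 'n) set" where "finite Y" "card Y = Suc M" "Y \<subseteq> cball 0 \<epsilon>"
    "\<And>x y. x \<in> Y \<Longrightarrow> y \<in> Y \<Longrightarrow> x \<noteq> y \<Longrightarrow> h \<le> dist x y"
proof -
  let ?n = "CARD('n)"
  let ?v = "unit_ball_vol (real ?n)"
  obtain Z :: "(real ^ 'n) set" where Z: "finite Z" "Z \<subseteq> cball 0 \<epsilon>"
    "\<And>x y. x \<in> Z \<Longrightarrow> y \<in> Z \<Longrightarrow> x \<noteq> y \<Longrightarrow> h \<le> dist x y"
    "cball 0 \<epsilon> \<subseteq> (\<Union>z\<in>Z. ball z h)"
    using separated_net[OF compact_cball assms(1)] by metis
  have "measure lebesgue (cball (0::real^'n) \<epsilon>) \<le> measure lebesgue (\<Union>z\<in>Z. ball z h)"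
    using Z by (intro measure_mono_fmeasurable fmeasurable.finite_UN) auto
  also have "\<dots> \<le> (\<Sum>z\<in>Z. measure lebesgue (ball z h))"
    using Z(1) by (intro measure_UNION_le) auto
  finally have "?v * \<epsilon> ^ ?n \<le> real (card Z) * (?v * h ^ ?n)"
    using assms by (simp add: content_cball content_ball)
  then have "?v * \<epsilon> ^ ?n \<le> ?v * (real (card Z) * h ^ ?n)"
    by (simp add: algebra_simps)
  then have "\<epsilon> ^ ?n \<le> real (card Z) * h ^ ?n"
    by (subst (asm) mult_le_cancel_left_pos) simp_all
  then have "real M * h ^ ?n < real (card Z) * h ^ ?n"
    using assms(3) by linarith
  then have "M < card Z" using assms(1) by simp
  then obtain Y where "Y \<subseteq> Z" "card Y = Suc M" 
    by (meson Suc_leI obtain_subset_with_card_n)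
  then show ?thesis using that Z by (meson finite_subset subset_iff)
qed

lemma null_compact_cover:
  fixes K :: "(real ^ 'n) set"
  assumes K: "compact K" "negligible K" and d: "\<delta> > 0"
  obtains t and c :: "nat \<Rightarrow> real ^ 'n" and M where "t > 0" "K \<subseteq> (\<Union>i<M. cball (c i) t)" "real M * t ^ CARD('n) < \<delta>"
proof (cases "K = {}")
  case True
  then show ?thesis using that[of 1 "\<lambda>_. 0" 0] d by simp
next
  case False
  let ?n = "CARD('n)"
  let ?v = "unit_ball_vol (real ?n)"
  have v: "?v > 0" by simp
  \<comment> \<open>The factor \<open>2 ^ ?n\<close> pays for passing from the disjoint balls of
    radius \<open>r/2\<close>, whose volumes add up inside \<open>V\<close>, to the covering balls
    of radius \<open>r\<close>.\<close>
  define e where "e = ?v * \<delta> / 2 ^ ?n"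
  have e: "e > 0" using v d by (simp add: e_def)
  obtain V where V: "open V" "K \<subseteq> V" "V \<in> lmeasurable" "measure lebesgue V < e"
  proof -
    have "K \<in> lmeasurable" using K(1) by (rule lmeasurable_compact)
    then obtain T where T: "open T" "K \<subseteq> T" "T - K \<in> lmeasurable" "emeasure lebesgue (T - K) < ennreal e"
      using sets_lebesgue_outer_open[OF _ e, of K] by (metis fmeasurableD)
    have 1: "T = (T - K) \<union> K" using T by blast
    then have "T \<in> lmeasurable" using T(3) \<open>K \<in> lmeasurable\<close> by (metis fmeasurable.Un)
    moreover have "measure lebesgue T = measure lebesgue (T - K)"
      using measure_Un_le[of "T - K" lebesgue K] 1 K T \<open>K \<in> lmeasurable\<close> \<open>T \<in> lmeasurable\<close>
      by (simp add: measure_Diff_null_set negligible_iff_null_sets fmeasurableD)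
    ultimately show ?thesis using T that[of T] e
      by (simp add: emeasure_eq_measure2 ennreal_less_iff)
  qed
  obtain r where r: "r > 0" "\<And>x. x \<in> K \<Longrightarrow> ball x r \<subseteq> V"
  proof -
    obtain r where "r > 0" "(\<Union>x\<in>K. ball x r) \<subseteq> V"
      using compact_subset_open_imp_ball_epsilon_subset[OF K(1) V(1,2)] by blast
    then show ?thesis using that by blast
  qed
  obtain Z where Z: "finite Z" "Z \<subseteq> K" "\<And>x y. x \<in> Z \<Longrightarrow> y \<in> Z \<Longrightarrow> x \<noteq> y \<Longrightarrow> r \<le> dist x y"
    "K \<subseteq> (\<Union>z\<in>Z. ball z r)"
    using separated_net[OF K(1) r(1)] by metis
  have dis: "disjoint_family_on (\<lambda>z. ball z (r/2)) Z"
    unfolding disjoint_family_on_def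
  proof (intro ballI impI)
    fix x y assume "x \<in> Z" "y \<in> Z" "x \<noteq> y"
    then have "r/2 + r/2 \<le> dist x y" using Z(3) by simp
    then show "ball x (r/2) \<inter> ball y (r/2) = {}" by (rule disjoint_ballI)
  qed
  have "(\<Sum>z\<in>Z. measure lebesgue (ball z (r/2))) = measure lebesgue (\<Union>z\<in>Z. ball z (r/2))"
    using dis Z(1) by (intro measure_UNION'[symmetric]) 
      (auto simp: disjoint_family_on_def disjnt_def pairwise_def)
  also have "\<dots> \<le> measure lebesgue V"
  proof (rule measure_mono_fmeasurable)
    have "ball z (r/2) \<subseteq> V" if "z \<in> Z" for z
      using r(2)[of z] Z(2) that r(1) subset_ball[of "r/2" r z] by auto
    then show "(\<Union>z\<in>Z. ball z (r/2)) \<subseteq> V" by blast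
  qed (use V Z in \<open>auto intro!: sets.finite_UN\<close>)
  finally have "real (card Z) * (?v * (r/2) ^ ?n) < e"
    using V r(1) by (simp add: content_ball)
  then have "?v * (real (card Z) * r ^ ?n) < ?v * \<delta>"
    by (simp add: e_def power_divide field_simps)
  then have less: "real (card Z) * r ^ ?n < \<delta>"
    using v by simp
  obtain c where c: "bij_betw c {..<card Z} Z"
    using ex_bij_betw_nat_finite[OF Z(1)] by (auto simp: atLeast0LessThan)
  have "K \<subseteq> (\<Union>i<card Z. cball (c i) r)"
  proof
    fix x assume "x \<in> K"
    then obtain z where "z \<in> Z" "x \<in> ball z r" using Z(4) by blast
    moreover then have "z \<in> c ` {..<card Z}" using c unfolding bij_betw_def by simp
    then obtain i where "i < card Z" "c i = z" by auto
    ultimately show "x \<in> (\<Union>i<card Z. cball (c i) r)" by force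
  qed
  then show ?thesis using that r(1) less by blast
qed

text \<open>Duality of optimal transport: unit masses at the centres are sent to slopes of capacity
  \<open>\<theta>\<close>, and \<open>d\<close> is the dual price. As \<open>\<theta> < 1\<close>,
  no slope can absorb the whole mass of a centre, so optimal prices leave two slopes active there.
  The slack \<open>\<eta>\<close> allows a nearly minimal \<open>d\<close> in place of a
  minimiser.\<close>

lemma near_optimal_potential:
  fixes c :: "'i \<Rightarrow> 'a::real_inner"
  assumes I: "finite I" and Y: "finite Y" and IY: "card I < card Y" and \<eta>: "\<eta> > 0"
  obtains d :: "'a \<Rightarrow> real" where "\<And>i. i \<in> I \<Longrightarrow> \<exists>y\<in>Y. \<exists>y'\<in>Y. y \<noteq> y' \<and>
     (\<forall>z\<in>Y. c i \<bullet> z - d z \<le> c i \<bullet> y - d y + \<eta>) \<and> (\<forall>z\<in>Y. c i \<bullet> z - d z \<le> c i \<bullet> y' - d y' + \<eta>)"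
proof -
  define \<psi> where "\<psi> d i = Max ((\<lambda>y. c i \<bullet> y - d y) ` Y)" for d i
  define \<theta> where "\<theta> = real (card I) / real (card Y)"
  define G where "G d = (\<Sum>i\<in>I. \<psi> d i) + \<theta> * (\<Sum>y\<in>Y. d y)" for d
  have Y0: "Y \<noteq> {}" "card Y > 0" using IY by auto
  have \<theta>: "\<theta> < 1" using IY by (simp add: \<theta>_def)
  have \<psi>ge: "c i \<bullet> y - d y \<le> \<psi> d i" if "y \<in> Y" for i d y
    using that Y by (simp add: \<psi>_def)
  have \<psi>le: "\<psi> d i \<le> b" if "\<And>y. y \<in> Y \<Longrightarrow> c i \<bullet> y - d y \<le> b" for i d b
    using that Y Y0 by (simp add: \<psi>_def)
  \<comment> \<open>A maximum dominates the average over \<open>Y\<close>; since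
    \<open>\<theta>\<close> balances the total masses, the heights \<open>d\<close> cancel from the
    resulting bound.\<close>
  have lower: "(\<Sum>i\<in>I. (\<Sum>y\<in>Y. c i \<bullet> y) / card Y) \<le> G d" for d
  proof -
    have "(\<Sum>i\<in>I. (\<Sum>y\<in>Y. c i \<bullet> y - d y) / card Y) \<le> (\<Sum>i\<in>I. \<psi> d i)"
    proof (rule sum_mono)
      fix i
      have "(\<Sum>y\<in>Y. c i \<bullet> y - d y) \<le> (\<Sum>y\<in>Y. \<psi> d i)"
        by (intro sum_mono \<psi>ge)
      then show "(\<Sum>y\<in>Y. c i \<bullet> y - d y) / card Y \<le> \<psi> d i"
        using Y0 by (simp add: field_simps)
    qed
    then show ?thesis
      by (simp add: G_def \<theta>_def sum_subtractf diff_divide_distrib)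
  qed
  define m where "m = Inf (range G)"
  have bdd: "bdd_below (range G)" using lower unfolding bdd_below_def by blast
  have "m < m + \<eta> * (1 - \<theta>)" using \<eta> \<theta> by simp
  then obtain d where d: "G d < m + \<eta> * (1 - \<theta>)"
    unfolding m_def using cInf_lessD[of "range G"] by blast
  have mle: "m \<le> G d'" for d' unfolding m_def using bdd by (simp add: cInf_lower)
  (* If only one slope y were nearly active at c i, raising d y by \<eta> would lower G below its infimum. *)
  show ?thesis
  proof (rule that[of d], rule ccontr)
    fix i assume i: "i \<in> I"
    assume neg: "\<not> (\<exists>y\<in>Y. \<exists>y'\<in>Y. y \<noteq> y' \<and>
     (\<forall>z\<in>Y. c i \<bullet> z - d z \<le> c i \<bullet> y - d y + \<eta>) \<and> (\<forall>z\<in>Y. c i \<bullet> z - d z \<le> c i \<bullet> y' - d y' + \<eta>))"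
    have "\<psi> d i \<in> (\<lambda>y. c i \<bullet> y - d y) ` Y" unfolding \<psi>_def using Y Y0 by (intro Max_in) auto
    then obtain y where y: "y \<in> Y" "\<psi> d i = c i \<bullet> y - d y" by auto
    have gap: "c i \<bullet> y' - d y' \<le> \<psi> d i - \<eta>" if "y' \<in> Y" "y' \<noteq> y" for y'
    proof (rule ccontr)
      assume "\<not> ?thesis"
      then have "\<forall>z\<in>Y. c i \<bullet> z - d z \<le> c i \<bullet> y' - d y' + \<eta>"
        using \<psi>ge[of _ i d] by (smt (verit))
      moreover have "\<forall>z\<in>Y. c i \<bullet> z - d z \<le> c i \<bullet> y - d y + \<eta>"
        using \<psi>ge[of _ i d] y \<eta> by (smt (verit))
      ultimately show False using neg that y by metis
    qed
    define d' where "d' = d(y := d y + \<eta>)"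
    have "\<psi> d' i \<le> \<psi> d i - \<eta>"
      by (rule \<psi>le) (use gap y in \<open>auto simp: d'_def\<close>)
    moreover have "\<psi> d' j \<le> \<psi> d j" for j
    proof (rule \<psi>le)
      fix z assume "z \<in> Y"
      then show "c j \<bullet> z - d' z \<le> \<psi> d j"
        using \<psi>ge[of z j d] \<eta> by (auto simp: d'_def)
    qed
    ultimately have "(\<Sum>j\<in>I. \<psi> d' j) \<le> (\<Sum>j\<in>I. \<psi> d j) - \<eta>"
      using I i sum_mono[of "I - {i}" "\<psi> d'" "\<psi> d"] by (simp add: sum.remove)
    moreover have "(\<Sum>z\<in>Y. d' z) = (\<Sum>z\<in>Y. d z) + \<eta>"
      using Y y(1) by (simp add: d'_def sum.remove[of Y y])
    ultimately have "G d' \<le> G d - \<eta> * (1 - \<theta>)"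
      unfolding G_def by (simp add: algebra_simps)
    then show False using d mle[of d'] by linarith
  qed
qed

section \<open>Smooth maxima of affine functions\<close>

lemma norm_matrix_vector_le:
  fixes A :: "real ^ 'n ^ 'm"
  shows "norm (A *v x) \<le> norm A * norm x"
proof -
  have "(norm (A *v x))\<^sup>2 = (\<Sum>i\<in>UNIV. (A $ i \<bullet> x)\<^sup>2)"
    by (simp add: norm_vec_def L2_set_def sum_nonneg matrix_vector_mul_component power2_eq_square)
  also have "\<dots> \<le> (\<Sum>i\<in>UNIV. (norm (A $ i))\<^sup>2 * (norm x)\<^sup>2)"
  proof (rule sum_mono)
    fix i
    have "\<bar>A $ i \<bullet> x\<bar> \<le> norm (A $ i) * norm x" by (rule Cauchy_Schwarz_ineq2)
    then have "\<bar>A $ i \<bullet> x\<bar>\<^sup>2 \<le> (norm (A $ i) * norm x)\<^sup>2" by (intro power_mono) auto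
    then show "(A $ i \<bullet> x)\<^sup>2 \<le> (norm (A $ i))\<^sup>2 * (norm x)\<^sup>2" by (simp add: power_mult_distrib)
  qed
  also have "\<dots> = (norm A * norm x)\<^sup>2"
    by (simp add: norm_vec_def[of A] L2_set_def sum_nonneg power_mult_distrib sum_distrib_right)
  finally show ?thesis by (rule power2_le_imp_le) simp
qed

text \<open>\<open>L\<close> is the log-sum-exp smoothing, at inverse temperature \<open>l\<close>,
  of the maximum of the affine functions \<open>x \<bullet> y - d y\<close>. The
  \<open>p y x\<close> are its Gibbs weights, \<open>g\<close> is its gradient (the mean slope) and
  \<open>cov\<close> its Hessian, \<open>l\<close> times the covariance of the slopes.\<close>

locale soft_maximum =
  fixes Y :: "(real ^ 'n) set" and d :: "real ^ 'n \<Rightarrow> real" and l \<epsilon> :: real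
  assumes finY: "finite Y" and Yne: "Y \<noteq> {}" and l: "l > 0" and Yball: "Y \<subseteq> cball 0 \<epsilon>"
begin

definition e :: "real ^ 'n \<Rightarrow> real ^ 'n \<Rightarrow> real" where "e y x = exp (l * (x \<bullet> y - d y))"
definition Z :: "real ^ 'n \<Rightarrow> real" where "Z x = (\<Sum>y\<in>Y. e y x)"
definition p :: "real ^ 'n \<Rightarrow> real ^ 'n \<Rightarrow> real" where "p y x = e y x / Z x"
definition L :: "real ^ 'n \<Rightarrow> real" where "L x = ln (Z x) / l"
definition g :: "real ^ 'n \<Rightarrow> real ^ 'n" where "g x = (\<Sum>y\<in>Y. p y x *\<^sub>R y)"
definition cov :: "real ^ 'n \<Rightarrow> real ^ 'n ^ 'n" where
  "cov x = (\<chi> i j. l * (\<Sum>y\<in>Y. p y x * ((y - g x) $ i * (y - g x) $ j)))"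

lemma e_pos: "e y x > 0" by (simp add: e_def)

lemma Z_pos: "Z x > 0" unfolding Z_def using finY Yne e_pos by (simp add: sum_pos)

lemma p_pos: "p y x > 0" using e_pos Z_pos by (simp add: p_def)

lemma sum_p: "(\<Sum>y\<in>Y. p y x) = 1"
  using Z_pos[of x] by (simp add: p_def Z_def flip: sum_divide_distrib)

lemma norm_g: "norm (g x) \<le> \<epsilon>"
proof -
  have "norm (g x) \<le> (\<Sum>y\<in>Y. norm (p y x *\<^sub>R y))" unfolding g_def by (rule norm_sum)
  also have "\<dots> \<le> (\<Sum>y\<in>Y. p y x * \<epsilon>)"
    using Yball less_imp_le[OF p_pos] by (intro sum_mono) (auto simp: abs_of_pos intro!: mult_left_mono)
  finally show ?thesis using sum_p by (simp flip: sum_distrib_right)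
qed

lemma inner_g: "g x \<bullet> v = (\<Sum>y\<in>Y. p y x * (y \<bullet> v))"
  by (simp add: g_def inner_sum_left)

lemma sum_p_centered: "(\<Sum>y\<in>Y. p y x * ((y - g x) \<bullet> v)) = 0"
  using sum_p[of x] by (simp add: inner_diff_left inner_g[of x v] right_diff_distrib sum_subtractf flip: sum_distrib_right)

text \<open>Jensen's inequality: \<open>Z x' / Z x\<close> is the mean of \<open>exp (u y)\<close>
  under the Gibbs weights at \<open>x\<close>, and \<open>exp\<close> lies above its tangent at the
  mean \<open>m\<close>.\<close>

lemma subgradient: "L x + (x' - x) \<bullet> g x \<le> L x'"
proof -
  define u where "u y = l * ((x' - x) \<bullet> y)" for y
  define m where "m = l * ((x' - x) \<bullet> g x)"
  have mu: "(\<Sum>y\<in>Y. p y x * u y) = m"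
    using inner_g[of x "x' - x"] by (simp add: u_def m_def sum_distrib_left inner_commute mult_ac)
  have ratio: "e y x' = e y x * exp (u y)" for y
    by (simp add: e_def u_def inner_diff_left algebra_simps flip: exp_add)
  have "exp m = (\<Sum>y\<in>Y. p y x * (exp m * (1 + (u y - m))))"
  proof -
    have "(\<Sum>y\<in>Y. p y x * (exp m * (1 + (u y - m)))) = exp m * ((\<Sum>y\<in>Y. p y x) * (1 - m) + (\<Sum>y\<in>Y. p y x * u y))"
      by (simp add: sum_distrib_left sum_distrib_right algebra_simps sum.distrib sum_subtractf)
    then show ?thesis by (simp add: mu sum_p)
  qed
  also have "\<dots> \<le> (\<Sum>y\<in>Y. p y x * exp (u y))"
  proof (intro sum_mono mult_left_mono)
    fix y
    have "1 + (u y - m) \<le> exp (u y - m)" by (rule exp_ge_add_one_self)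
    then have "exp m * (1 + (u y - m)) \<le> exp m * exp (u y - m)" by (intro mult_left_mono) auto
    also have "\<dots> = exp (u y)" by (simp flip: exp_add)
    finally show "exp m * (1 + (u y - m)) \<le> exp (u y)" .
  qed (use p_pos in \<open>simp add: less_imp_le\<close>)
  also have "\<dots> = Z x' / Z x"
    by (simp add: p_def Z_def[of x'] ratio sum_divide_distrib)
  finally have "m \<le> ln (Z x' / Z x)" using Z_pos[of x] Z_pos[of x'] by (simp add: ln_ge_iff)
  then have "m \<le> ln (Z x') - ln (Z x)" using Z_pos[of x] Z_pos[of x'] by (simp add: ln_div)
  then have "m / l \<le> (ln (Z x') - ln (Z x)) / l" using l by (simp add: divide_right_mono)
  then show ?thesis using l by (simp add: L_def m_def diff_divide_distrib)
qed

lemma L_ge: "y \<in> Y \<Longrightarrow> x \<bullet> y - d y \<le> L x"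
proof -
  assume y: "y \<in> Y"
  have "e y x \<le> Z x" unfolding Z_def using y finY e_pos by (intro member_le_sum) (auto intro: less_imp_le)
  then have "l * (x \<bullet> y - d y) \<le> ln (Z x)" using Z_pos by (simp add: ln_ge_iff e_def)
  then show ?thesis using l by (simp add: L_def field_simps)
qed

lemma L_le:
  assumes "\<And>y. y \<in> Y \<Longrightarrow> x \<bullet> y - d y \<le> b"
  shows "L x \<le> b + card Y / l"
proof -
  have "Z x \<le> (\<Sum>y\<in>Y. exp (l * b))"
    unfolding Z_def e_def using assms l by (intro sum_mono) simp
  also have "\<dots> = real (card Y) * exp (l * b)" by simp
  \<comment> \<open>The logarithm of \<open>card Y\<close> is replaced by \<open>card Y\<close>
    itself. The crude error is harmless because \<open>l\<close> will be taken proportional to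
    \<open>card Y\<close>.\<close>
  also have "\<dots> \<le> exp (real (card Y)) * exp (l * b)"
  proof (rule mult_right_mono)
    show "real (card Y) \<le> exp (real (card Y))" using exp_ge_add_one_self[of "real (card Y)"] by linarith
  qed simp
  finally have "Z x \<le> exp (real (card Y)) * exp (l * b)" .
  then have "ln (Z x) \<le> card Y + l * b"
    using Z_pos[of x] by (metis exp_add exp_gt_zero ln_exp ln_le_cancel_iff)
  then show ?thesis using l by (simp add: L_def field_simps)
qed

lemma has_derivative_e: "(e y has_derivative (\<lambda>v. e y x * (l * (v \<bullet> y)))) (at x)"
  unfolding e_def by (auto intro!: derivative_eq_intros)

lemma has_derivative_Z: "(Z has_derivative (\<lambda>v. Z x * (l * (v \<bullet> g x)))) (at x)"
proof -
  have "((\<lambda>x. \<Sum>y\<in>Y. e y x) has_derivative (\<lambda>v. \<Sum>y\<in>Y. e y x * (l * (v \<bullet> y)))) (at x)"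
    by (intro has_derivative_sum has_derivative_e)
  moreover have "(\<Sum>y\<in>Y. e y x * (l * (v \<bullet> y))) = Z x * (l * (v \<bullet> g x))" for v
  proof -
    have "Z x * (l * (v \<bullet> g x)) = (\<Sum>y\<in>Y. Z x * (l * (p y x * (y \<bullet> v))))"
      by (simp add: inner_g inner_commute[of v "g x"] sum_distrib_left)
    also have "\<dots> = (\<Sum>y\<in>Y. e y x * (l * (v \<bullet> y)))"
      using Z_pos[of x] by (intro sum.cong) (auto simp: p_def inner_commute)
    finally show ?thesis by simp
  qed
  ultimately show ?thesis unfolding Z_def by simp
qed

lemma has_derivative_p: "(p y has_derivative (\<lambda>v. l * p y x * ((y - g x) \<bullet> v))) (at x)"
proof -
  have Z0: "Z x \<noteq> 0" using Z_pos[of x] by simp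
  have "((\<lambda>x. e y x / Z x) has_derivative
      (\<lambda>v. (e y x * (l * (v \<bullet> y)) * Z x - e y x * (Z x * (l * (v \<bullet> g x)))) / (Z x * Z x))) (at x)"
    by (rule has_derivative_divide'[OF has_derivative_e has_derivative_Z Z0])
  moreover have "(e y x * (l * (v \<bullet> y)) * Z x - e y x * (Z x * (l * (v \<bullet> g x)))) / (Z x * Z x)
     = l * p y x * ((y - g x) \<bullet> v)" for v
    using Z0 by (simp add: p_def inner_diff_left inner_commute[of v] divide_simps) (simp add: algebra_simps)
  ultimately show ?thesis unfolding p_def by simp
qed

lemma cov_mult: "cov x *v v = l *\<^sub>R (\<Sum>y\<in>Y. (p y x * ((y - g x) \<bullet> v)) *\<^sub>R (y - g x))"
proof (rule vec_eq_iff[THEN iffD2], intro allI)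
  fix i
  have "(cov x *v v) $ i = (\<Sum>j\<in>UNIV. \<Sum>y\<in>Y. l * (p y x * ((y - g x) $ i * (y - g x) $ j)) * v $ j)"
    by (simp add: matrix_vector_mult_def cov_def sum_distrib_left sum_distrib_right mult_ac)
  also have "\<dots> = (\<Sum>y\<in>Y. \<Sum>j\<in>UNIV. l * (p y x * ((y - g x) $ i * (y - g x) $ j)) * v $ j)"
    by (rule sum.swap)
  also have "\<dots> = (\<Sum>y\<in>Y. l * (p y x * ((y - g x) \<bullet> v) * (y - g x) $ i))"
    by (simp add: inner_vec_def sum_distrib_left sum_distrib_right mult_ac)
  finally show "(cov x *v v) $ i = (l *\<^sub>R (\<Sum>y\<in>Y. (p y x * ((y - g x) \<bullet> v)) *\<^sub>R (y - g x))) $ i"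
    by (simp add: sum_distrib_left mult_ac)
qed

lemma has_derivative_g: "(g has_derivative (*v) (cov x)) (at x)"
proof -
  have "((\<lambda>x. \<Sum>y\<in>Y. p y x *\<^sub>R y) has_derivative (\<lambda>v. \<Sum>y\<in>Y. (l * p y x * ((y - g x) \<bullet> v)) *\<^sub>R y)) (at x)"
    by (intro has_derivative_sum has_derivative_scaleR_left has_derivative_p)
  moreover have "(\<Sum>y\<in>Y. (l * p y x * ((y - g x) \<bullet> v)) *\<^sub>R y) = cov x *v v" for v
  proof -
    have "cov x *v v = (\<Sum>y\<in>Y. (l * p y x * ((y - g x) \<bullet> v)) *\<^sub>R y)
        - (l * (\<Sum>y\<in>Y. p y x * ((y - g x) \<bullet> v))) *\<^sub>R g x"
      unfolding cov_mult by (simp add: scaleR_right_diff_distrib sum_subtractf scaleR_sum_right sum_distrib_left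
         scaleR_left.sum mult_ac)
    then show ?thesis by (simp add: sum_p_centered)
  qed
  ultimately show ?thesis unfolding g_def by simp
qed

lemma cov_quadratic: "v \<bullet> (cov x *v v) = l * (\<Sum>y\<in>Y. p y x * ((y - g x) \<bullet> v)\<^sup>2)"
  by (simp add: cov_mult inner_sum_right power2_eq_square inner_commute sum_distrib_left mult_ac)

lemma cov_nonneg: "0 \<le> v \<bullet> (cov x *v v)"
  unfolding cov_quadratic using l p_pos by (simp add: sum_nonneg less_imp_le)

text \<open>The second moment is smallest about the mean. With \<open>a = 0\<close> this bounds
  \<open>cov\<close> by the size of the slopes; with \<open>a\<close> the mean at another point it
  compares the covariances at two points.\<close>

lemma variance_eq: "(\<Sum>y\<in>Y. p y x * ((y - a) \<bullet> v)\<^sup>2) = (\<Sum>y\<in>Y. p y x * ((y - g x) \<bullet> v)\<^sup>2) + ((g x - a) \<bullet> v)\<^sup>2"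
proof -
  have "(\<Sum>y\<in>Y. p y x * ((y - a) \<bullet> v)\<^sup>2) = (\<Sum>y\<in>Y. p y x * ((y - g x) \<bullet> v)\<^sup>2
      + 2 * ((g x - a) \<bullet> v) * (p y x * ((y - g x) \<bullet> v)) + ((g x - a) \<bullet> v)\<^sup>2 * p y x)"
    by (intro sum.cong) (auto simp: inner_diff_left power2_eq_square algebra_simps)
  also have "\<dots> = (\<Sum>y\<in>Y. p y x * ((y - g x) \<bullet> v)\<^sup>2)
      + 2 * ((g x - a) \<bullet> v) * (\<Sum>y\<in>Y. p y x * ((y - g x) \<bullet> v)) + ((g x - a) \<bullet> v)\<^sup>2 * (\<Sum>y\<in>Y. p y x)"
    by (simp add: sum.distrib sum_distrib_left)
  finally show ?thesis by (simp add: sum_p_centered sum_p)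
qed

lemma cov_le: "v \<bullet> (cov x *v v) \<le> l * \<epsilon>\<^sup>2 * (v \<bullet> v)"
proof -
  have "(\<Sum>y\<in>Y. p y x * ((y - g x) \<bullet> v)\<^sup>2) \<le> (\<Sum>y\<in>Y. p y x * ((y - 0) \<bullet> v)\<^sup>2)"
    using variance_eq[of x 0 v] by simp
  also have "\<dots> \<le> (\<Sum>y\<in>Y. p y x * (\<epsilon>\<^sup>2 * (v \<bullet> v)))"
  proof (intro sum_mono mult_left_mono)
    fix y assume "y \<in> Y"
    then have "norm y \<le> \<epsilon>" using Yball by auto
    then have "(norm y)\<^sup>2 * (norm v)\<^sup>2 \<le> \<epsilon>\<^sup>2 * (norm v)\<^sup>2"
      by (intro mult_right_mono power_mono) auto
    moreover have "(y \<bullet> v)\<^sup>2 \<le> (norm y)\<^sup>2 * (norm v)\<^sup>2"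
      using Cauchy_Schwarz_ineq[of y v] by (simp add: power2_norm_eq_inner)
    ultimately show "((y - 0) \<bullet> v)\<^sup>2 \<le> \<epsilon>\<^sup>2 * (v \<bullet> v)" by (simp add: power2_norm_eq_inner)
  qed (use p_pos in \<open>simp add: less_imp_le\<close>)
  finally show ?thesis using l sum_p[of x] 
    by (simp add: cov_quadratic mult.assoc flip: sum_distrib_right)
qed

lemma continuous_cov: "continuous_on UNIV cov"
proof -
  have "continuous_on UNIV (p y)" for y
    using has_derivative_p by (intro continuous_at_imp_continuous_on) (blast intro: has_derivative_continuous)
  moreover have "continuous_on UNIV g"
    using has_derivative_g by (intro continuous_at_imp_continuous_on) (blast intro: has_derivative_continuous)
  ultimately show ?thesis unfolding cov_def by (intro continuous_intros)
qed

text \<open>A displacement \<open>s\<close> changes every exponent by at most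
  \<open>l * \<epsilon> * s \<le> 1/4\<close>. Numerator and normalisation each cost a factor
  \<open>exp (1/4)\<close>, and \<open>exp (1/2) \<le> 2\<close>.\<close>

lemma p_ratio:
  assumes "norm (x - x') \<le> s" "y \<in> Y" "4 * l * \<epsilon> * s \<le> 1"
  shows "p y x' \<le> 2 * p y x"
proof -
  have \<epsilon>0: "0 \<le> \<epsilon>" using norm_g[of x] norm_ge_zero order_trans by blast
  have bd: "e z u \<le> exp (1/4) * e z w" if "z \<in> Y" "norm (u - w) \<le> s" for z u w
  proof -
    have "(u - w) \<bullet> z \<le> norm (u - w) * norm z" by (rule norm_cauchy_schwarz)
    also have "\<dots> \<le> s * \<epsilon>" using that Yball order_trans[OF norm_ge_zero that(2)]
      by (intro mult_mono) auto
    finally have "l * ((u - w) \<bullet> z) \<le> l * (s * \<epsilon>)" using l by simp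
    also have "\<dots> \<le> 1/4" using assms(3) by (simp add: mult_ac)
    finally have "l * (u \<bullet> z - d z) \<le> 1/4 + l * (w \<bullet> z - d z)"
      by (simp add: inner_diff_left algebra_simps)
    then have "exp (l * (u \<bullet> z - d z)) \<le> exp (1/4 + l * (w \<bullet> z - d z))" by simp
    then show ?thesis by (simp add: e_def exp_add)
  qed
  have s': "norm (x' - x) \<le> s" using assms(1) by (simp add: norm_minus_commute)
  have "Z x \<le> exp (1/4) * Z x'"
    unfolding Z_def sum_distrib_left by (intro sum_mono bd assms)
  then have "e y x' * Z x \<le> (exp (1/4) * e y x) * (exp (1/4) * Z x')"
    using e_pos Z_pos by (intro mult_mono bd assms s') (auto intro: less_imp_le)
  also have "\<dots> = exp (1/2) * (e y x * Z x')" by (simp add: field_simps flip: exp_add)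
  also have "\<dots> \<le> 2 * (e y x * Z x')"
  proof (rule mult_right_mono)
    show "exp (1/2) \<le> (2::real)" using exp_bound[of "1/2"] by (simp add: power2_eq_square)
  qed (use e_pos Z_pos in \<open>simp add: less_imp_le\<close>)
  finally show ?thesis using Z_pos[of x] Z_pos[of x'] by (simp add: p_def field_simps)
qed

text \<open>Measuring the spread at \<open>x'\<close> about the mean at \<open>x\<close> only
  enlarges it, so just the weights have to be compared. Hence the Hessian is comparable to itself at
  a scale known in advance, and integrals of it can be replaced by finite sums.\<close>

lemma cov_ratio:
  assumes "norm (x - x') \<le> s" "4 * l * \<epsilon> * s \<le> 1"
  shows "v \<bullet> (cov x' *v v) \<le> 2 * (v \<bullet> (cov x *v v))"
proof -
  have "(\<Sum>y\<in>Y. p y x' * ((y - g x') \<bullet> v)\<^sup>2) \<le> (\<Sum>y\<in>Y. p y x' * ((y - g x) \<bullet> v)\<^sup>2)"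
    using variance_eq[of x' "g x" v] by simp
  also have "\<dots> \<le> (\<Sum>y\<in>Y. 2 * p y x * ((y - g x) \<bullet> v)\<^sup>2)"
    using p_ratio[OF assms(1) _ assms(2)] by (intro sum_mono mult_right_mono) auto
  finally have "(\<Sum>y\<in>Y. p y x' * ((y - g x') \<bullet> v)\<^sup>2) \<le> 2 * (\<Sum>y\<in>Y. p y x * ((y - g x) \<bullet> v)\<^sup>2)"
    by (simp add: sum_distrib_left mult.assoc)
  then show ?thesis using l by (simp add: cov_quadratic)
qed

end

section \<open>Averaging the Hessian over a cross of coordinate segments\<close>

lemma axis_inner_matrix: "axis i 1 \<bullet> (A *v axis i 1) = A $ i $ (i::'n)" for A :: "real ^ 'n ^ 'n"
  by (simp add: matrix_vector_mult_basis column_def inner_axis')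

lemma matrix_sum_vector_mult:
  fixes F :: "'i \<Rightarrow> real ^ 'n ^ 'm"
  shows "(\<Sum>i\<in>A. F i) *v v = (\<Sum>i\<in>A. F i *v v)"
  by (induction A rule: infinite_finite_induct) (simp_all add: matrix_vector_mult_add_rdistrib)

text \<open>The largest coordinate of \<open>b\<close> carries the inner product up to a dimensional
  factor. This trades an unknown direction for one of finitely many axes.\<close>

lemma inner_le_of_coordinates:
  fixes b z :: "real ^ 'n"
  assumes "real CARD('n) * norm z \<le> R"
  obtains i where "b \<bullet> z \<le> R * \<bar>b $ i\<bar>"
proof -
  obtain i where i: "\<And>j. \<bar>b $ j\<bar> \<le> \<bar>b $ i\<bar>"
    using Max_in[of "range (\<lambda>j. \<bar>b $ j\<bar>)"] Max_ge[of "range (\<lambda>j. \<bar>b $ j\<bar>)"]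
    by (metis (no_types, lifting) finite_class.finite_UNIV finite_imageI image_iff image_is_empty UNIV_not_empty rangeI)
  have "b \<bullet> z \<le> (\<Sum>j\<in>(UNIV::'n set). \<bar>b $ i\<bar> * norm z)"
    unfolding inner_vec_def
  proof (rule sum_mono)
    fix j
    have "b $ j * z $ j \<le> \<bar>b $ j\<bar> * \<bar>z $ j\<bar>" by (metis abs_ge_self abs_mult)
    also have "\<dots> \<le> \<bar>b $ i\<bar> * norm z" using i component_le_norm_cart by (intro mult_mono) auto
    finally show "b $ j \<bullet> z $ j \<le> \<bar>b $ i\<bar> * norm z" by simp
  qed
  also have "\<dots> = \<bar>b $ i\<bar> * (real CARD('n) * norm z)" by simp
  also have "\<dots> \<le> \<bar>b $ i\<bar> * R" using assms by (intro mult_left_mono) auto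
  finally show ?thesis using that[of i] by (simp add: mult.commute)
qed

context soft_maximum
begin

text \<open>For \<open>k < m\<close> these are the left endpoints of \<open>m\<close> equal pieces
  of the segment from \<open>-R\<close> to \<open>R\<close> on axis \<open>i\<close>. A single value
  of \<open>cov\<close> may be tiny at a point slightly off a crease; averaging translates over the
  cross lets every point within reach of the crease feel it.\<close>

definition node :: "real \<Rightarrow> nat \<Rightarrow> 'n \<Rightarrow> nat \<Rightarrow> real ^ 'n" where
  "node R m i k = (2 * R * real k / real m - R) *\<^sub>R axis i 1"
definition w :: "real \<Rightarrow> nat \<Rightarrow> real ^ 'n \<Rightarrow> real ^ 'n" where
  "w R m x = (1 / (real CARD('n) * real m)) *\<^sub>R (\<Sum>i\<in>UNIV. \<Sum>k<m. g (x + node R m i k))"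
definition W :: "real \<Rightarrow> nat \<Rightarrow> real ^ 'n \<Rightarrow> real ^ 'n ^ 'n" where
  "W R m x = (1 / (real CARD('n) * real m)) *\<^sub>R (\<Sum>i\<in>UNIV. \<Sum>k<m. cov (x + node R m i k))"

lemma W_mult: "W R m x *v v = (1 / (real CARD('n) * real m)) *\<^sub>R (\<Sum>i\<in>UNIV. \<Sum>k<m. cov (x + node R m i k) *v v)"
  by (simp add: W_def matrix_sum_vector_mult flip: scaleR_matrix_vector_assoc)

lemma W_quadratic: "v \<bullet> (W R m x *v v) = (1 / (real CARD('n) * real m)) * (\<Sum>i\<in>UNIV. \<Sum>k<m. v \<bullet> (cov (x + node R m i k) *v v))"
  by (simp add: W_mult inner_sum_right)

lemma norm_w: "m > 0 \<Longrightarrow> norm (w R m x) \<le> \<epsilon>"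
proof -
  assume m: "m > 0"
  have "norm (\<Sum>i\<in>(UNIV::'n set). \<Sum>k<m. g (x + node R m i k)) \<le> (\<Sum>i\<in>(UNIV::'n set). \<Sum>k<m. norm (g (x + node R m i k)))"
    by (rule order_trans[OF norm_sum]) (intro sum_mono norm_sum)
  also have "\<dots> \<le> (\<Sum>i\<in>(UNIV::'n set). \<Sum>k<m. \<epsilon>)" by (intro sum_mono norm_g)
  also have "\<dots> = real CARD('n) * real m * \<epsilon>" by simp
  finally show ?thesis using m by (simp add: w_def divide_simps mult_ac)
qed

lemma has_derivative_w: "(w R m has_derivative (*v) (W R m x)) (at x)"
proof -
  have g': "((\<lambda>x. g (x + c)) has_derivative (*v) (cov (x + c))) (at x)" for c
  proof -
    have "((\<lambda>x. x + c) has_derivative (\<lambda>v. v)) (at x)" by (auto intro!: derivative_eq_intros)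
    from has_derivative_compose[OF this has_derivative_g] show ?thesis .
  qed
  have "((\<lambda>x. (1 / (real CARD('n) * real m)) *\<^sub>R (\<Sum>i\<in>(UNIV::'n set). \<Sum>k<m. g (x + node R m i k))) has_derivative
     (\<lambda>v. (1 / (real CARD('n) * real m)) *\<^sub>R (\<Sum>i\<in>(UNIV::'n set). \<Sum>k<m. cov (x + node R m i k) *v v))) (at x)"
    by (intro has_derivative_scaleR_right has_derivative_sum g')
  then show ?thesis by (simp add: w_def[abs_def] W_mult[abs_def])
qed

lemma continuous_W: "continuous_on UNIV (W R m)"
proof -
  have "continuous_on UNIV (\<lambda>x. cov (x + c))" for c
    by (rule continuous_on_compose2[OF continuous_cov]) (auto intro: continuous_intros)
  then show ?thesis unfolding W_def by (intro continuous_intros)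
qed

lemma transpose_W: "transpose (W R m x) = W R m x"
proof -
  have "cov z $ i $ j = cov z $ j $ i" for z i j
    by (simp add: cov_def mult_ac)
  then show ?thesis by (simp add: W_def transpose_def vec_eq_iff)
qed

lemma W_nonneg: "0 \<le> v \<bullet> (W R m x *v v)"
  unfolding W_quadratic by (intro mult_nonneg_nonneg sum_nonneg cov_nonneg) auto

lemma W_le: "v \<bullet> (W R m x *v v) \<le> l * \<epsilon>\<^sup>2 * (v \<bullet> v)"
proof (cases "m = 0")
  case True
  then show ?thesis using l by (simp add: W_quadratic)
next
  case False
  have "(\<Sum>i\<in>UNIV. \<Sum>k<m. v \<bullet> (cov (x + node R m i k) *v v)) \<le> (\<Sum>i\<in>(UNIV::'n set). \<Sum>k<m. l * \<epsilon>\<^sup>2 * (v \<bullet> v))"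
    by (intro sum_mono cov_le)
  also have "\<dots> = (real CARD('n) * real m) * (l * \<epsilon>\<^sup>2 * (v \<bullet> v))" by simp
  finally show ?thesis using False unfolding W_quadratic
    by (simp add: divide_simps mult_ac)
qed

text \<open>The mean value theorem evaluates the increment over each of the \<open>m\<close> pieces
  at an interior point, and \<open>cov_ratio\<close> moves that point to the node at the price of a
  factor 2.\<close>

lemma line_average:
  assumes R: "R > 0" and m: "m > 0" "4 * l * \<epsilon> * (2 * R / m) \<le> 1"
  shows "(g (x + R *\<^sub>R axis i 1) - g (x - R *\<^sub>R axis i 1)) $ i \<le> 4 * R / m * (\<Sum>k<m. cov (x + node R m i k) $ i $ i)"
proof -
  define s where "s = 2 * R / m"
  define G where "G t = g (x + t *\<^sub>R axis i 1) $ i" for t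
  have s: "s > 0" using R m by (simp add: s_def)
  have dG: "(G has_real_derivative cov (x + t *\<^sub>R axis i 1) $ i $ i) (at t)" for t
  proof -
    have "((\<lambda>t. x + t *\<^sub>R axis i 1) has_derivative (\<lambda>h. h *\<^sub>R axis i 1)) (at t)"
      by (auto intro!: derivative_eq_intros)
    from has_derivative_compose[OF this has_derivative_g]
    have "((\<lambda>t. g (x + t *\<^sub>R axis i 1)) has_derivative (\<lambda>h. cov (x + t *\<^sub>R axis i 1) *v (h *\<^sub>R axis i 1))) (at t)" .
    from bounded_linear.has_derivative[OF bounded_linear_vec_nth this, of i]
    show ?thesis unfolding has_field_derivative_def G_def
      by (simp add: matrix_vector_mult_scaleR matrix_vector_mult_basis column_def mult_commute_abs)
  qed
  have step: "G (- R + real (Suc k) * s) - G (- R + real k * s) \<le> 2 * s * cov (x + node R m i k) $ i $ i" for k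
  proof -
    let ?a = "- R + real k * s" and ?b = "- R + real (Suc k) * s"
    have ab: "?a < ?b" using s by simp
    obtain t where t: "?a < t" "t < ?b" "G ?b - G ?a = (?b - ?a) * (cov (x + t *\<^sub>R axis i 1) $ i $ i)"
      using MVT2[OF ab, of G "\<lambda>t. cov (x + t *\<^sub>R axis i 1) $ i $ i"] dG by auto
    have node: "node R m i k = ?a *\<^sub>R axis i 1" by (simp add: node_def s_def mult_ac)
    have "norm ((x + node R m i k) - (x + t *\<^sub>R axis i 1)) \<le> s"
      using t by (simp add: node algebra_simps flip: scaleR_diff_left)
    from cov_ratio[OF this, of "axis i 1"] m(2)
    have "cov (x + t *\<^sub>R axis i 1) $ i $ i \<le> 2 * cov (x + node R m i k) $ i $ i"
      by (simp add: axis_inner_matrix s_def)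
    then have "s * cov (x + t *\<^sub>R axis i 1) $ i $ i \<le> s * (2 * cov (x + node R m i k) $ i $ i)"
      using s by (intro mult_left_mono) auto
    then show ?thesis using t(3) by (simp add: algebra_simps)
  qed
  have "(\<Sum>k<m. G (- R + real (Suc k) * s) - G (- R + real k * s)) \<le> (\<Sum>k<m. 2 * s * cov (x + node R m i k) $ i $ i)"
    by (intro sum_mono step)
  then have "G (- R + real m * s) - G (- R) \<le> 2 * s * (\<Sum>k<m. cov (x + node R m i k) $ i $ i)"
    by (subst (asm) sum_lessThan_telescope) (simp add: sum_distrib_left)
  moreover have "- R + real m * s = R" using m by (simp add: s_def)
  ultimately show ?thesis by (simp add: G_def s_def)
qed

text \<open>Tangents at the two outer points bound the second difference by a gradient increment,
  hence by diagonal Hessian entries at the nodes. Adding the remaining nonnegative entries gives a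
  trace, which no longer depends on the axis.\<close>

lemma trace_W_ge:
  assumes R: "R > 0" and m: "m > 0" "4 * l * \<epsilon> * (2 * R / m) \<le> 1"
  shows "L (x + R *\<^sub>R axis i 1) + L (x - R *\<^sub>R axis i 1) - 2 * L x \<le> 4 * R\<^sup>2 * real CARD('n) * trace (W R m x)"
proof -
  let ?e = "axis i 1 :: real ^ 'n"
  have nn: "0 \<le> cov z $ j $ j" for z j
    using cov_nonneg[of "axis j 1" z] by (simp add: axis_inner_matrix)
  have "L (x + R *\<^sub>R ?e) - L x \<le> R * g (x + R *\<^sub>R ?e) $ i"
    using subgradient[of "x + R *\<^sub>R ?e" x] by (simp add: inner_axis')
  moreover have "L (x - R *\<^sub>R ?e) - L x \<le> - (R * g (x - R *\<^sub>R ?e) $ i)"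
    using subgradient[of "x - R *\<^sub>R ?e" x] by (simp add: inner_axis')
  ultimately have "L (x + R *\<^sub>R ?e) + L (x - R *\<^sub>R ?e) - 2 * L x \<le> R * (g (x + R *\<^sub>R ?e) - g (x - R *\<^sub>R ?e)) $ i"
    by (simp add: algebra_simps)
  also have "\<dots> \<le> R * (4 * R / m * (\<Sum>k<m. cov (x + node R m i k) $ i $ i))"
    using R by (intro mult_left_mono line_average assms) auto
  also have "\<dots> \<le> R * (4 * R / m * (\<Sum>j\<in>UNIV. \<Sum>k<m. \<Sum>i\<in>UNIV. cov (x + node R m j k) $ i $ i))"
  proof (intro mult_left_mono)
    have "(\<Sum>k<m. cov (x + node R m i k) $ i $ i) \<le> (\<Sum>k<m. \<Sum>i'\<in>UNIV. cov (x + node R m i k) $ i' $ i')"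
      by (intro sum_mono member_le_sum nn) auto
    also have "\<dots> \<le> (\<Sum>j\<in>UNIV. \<Sum>k<m. \<Sum>i'\<in>UNIV. cov (x + node R m j k) $ i' $ i')"
      by (intro member_le_sum[of i UNIV "\<lambda>j. \<Sum>k<m. \<Sum>i'\<in>UNIV. cov (x + node R m j k) $ i' $ i'"] sum_nonneg nn) auto
    finally show "(\<Sum>k<m. cov (x + node R m i k) $ i $ i) \<le> (\<Sum>j\<in>UNIV. \<Sum>k<m. \<Sum>i'\<in>UNIV. cov (x + node R m j k) $ i' $ i')" .
  qed (use R in auto)
  also have "\<dots> = 4 * R\<^sup>2 * real CARD('n) * trace (W R m x)"
  proof -
    have "trace (W R m x) = (1 / (real CARD('n) * real m)) * (\<Sum>i\<in>UNIV. \<Sum>j\<in>UNIV. \<Sum>k<m. cov (x + node R m j k) $ i $ i)"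
      by (simp add: trace_def W_def sum_distrib_left)
    also have "(\<Sum>i\<in>UNIV. \<Sum>j\<in>UNIV. \<Sum>k<m. cov (x + node R m j k) $ i $ i) = (\<Sum>j\<in>UNIV. \<Sum>k<m. \<Sum>i\<in>UNIV. cov (x + node R m j k) $ i $ i)"
      by (subst sum.swap) (intro sum.cong sum.swap refl)
    finally show ?thesis using m(1) by (simp add: power2_eq_square)
  qed
  finally show ?thesis .
qed

text \<open>The tangents of \<open>L\<close> at \<open>x2\<close> and \<open>x0\<close> differ by an
  affine function of slope \<open>b\<close> whose value at \<open>x2\<close> is the gap. Moving from
  \<open>x0\<close> by \<open>R\<close> along the axis where \<open>b\<close> is largest, with the
  right sign, does not lower that value, and the other half of the second difference is nonnegative
  by convexity.\<close>

lemma trace_W_ge_gap: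
  assumes R: "R > 0" and m: "m > 0" "4 * l * \<epsilon> * (2 * R / m) \<le> 1"
    and z: "real CARD('n) * norm (x2 - x0) \<le> R"
  shows "L x2 - L x0 - (x2 - x0) \<bullet> g x0 \<le> 4 * R\<^sup>2 * real CARD('n) * trace (W R m x0)"
proof -
  define b where "b = g x2 - g x0"
  obtain i where i: "b \<bullet> (x2 - x0) \<le> R * \<bar>b $ i\<bar>" using inner_le_of_coordinates[OF z] .
  define e where "e = (axis i 1 :: real ^ 'n)"
  have sg: "L x0 + (x0 + r *\<^sub>R e - x0) \<bullet> g x0 \<le> L (x0 + r *\<^sub>R e)"
       "L x2 + (x0 + r *\<^sub>R e - x2) \<bullet> g x2 \<le> L (x0 + r *\<^sub>R e)" for r
    by (rule subgradient)+
  have gap: "L x2 - L x0 - (x2 - x0) \<bullet> g x0 + (r * b $ i - b \<bullet> (x2 - x0)) \<le> L (x0 + r *\<^sub>R e) - L x0 - r * g x0 $ i" for r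
    using sg(2)[of r] by (simp add: b_def e_def inner_axis' inner_diff_left inner_diff_right inner_add_left algebra_simps inner_commute[of x2] inner_commute[of x0])
  have other: "0 \<le> L (x0 + r *\<^sub>R e) - L x0 - r * g x0 $ i" for r
    using sg(1)[of r] by (simp add: e_def inner_axis')
  have "L x2 - L x0 - (x2 - x0) \<bullet> g x0 \<le> L (x0 + R *\<^sub>R e) + L (x0 - R *\<^sub>R e) - 2 * L x0"
  proof (cases "b $ i \<ge> 0")
    case True
    then show ?thesis using gap[of R] other[of "-R"] i by simp
  next
    case False
    then show ?thesis using gap[of "-R"] other[of R] i by simp
  qed
  also have "\<dots> \<le> 4 * R\<^sup>2 * real CARD('n) * trace (W R m x0)"
    unfolding e_def by (rule trace_W_ge[OF assms(1-3)])
  finally show ?thesis .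
qed

end

text \<open>\<open>\<Lambda>\<close> comes before the centres because it depends on \<open>l\<close>
  and the size of the slopes but not on the heights \<open>d\<close>, which are the only data
  adapted to \<open>c\<close>.\<close>

theorem collapsing_field:
  fixes M :: nat and t \<epsilon> :: real
  assumes t: "t > 0" and \<epsilon>: "\<epsilon> > 0" and small: "real M * (64 * real CARD('n) ^ 3 * t) ^ CARD('n) < \<epsilon> ^ CARD('n)"
  shows "\<exists>\<Lambda>>0. \<forall>c :: nat \<Rightarrow> real ^ 'n. \<exists>w W. (\<forall>x. (w has_derivative (*v) (W x)) (at x)) \<and>
     continuous_on UNIV W \<and> (\<forall>x. norm (w x) \<le> \<epsilon>) \<and> (\<forall>x. transpose (W x) = W x) \<and>
     (\<forall>x v. 0 \<le> v \<bullet> (W x *v v) \<and> v \<bullet> (W x *v v) \<le> \<Lambda> * (v \<bullet> v)) \<and>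
     (\<forall>i<M. \<forall>x\<in>cball (c i) t. 1 \<le> trace (W x))"
proof -
  define n where "n = real CARD('n)"
  have n: "n \<ge> 1" by (simp add: n_def Suc_leI)
  \<comment> \<open>Tuned backwards from the final comparison: with \<open>R = 2 * n * t\<close> the
    factor \<open>4 * R\<^sup>2 * n\<close> equals \<open>t * J / 2\<close>. This is what remains of
    \<open>t * J\<close> after two errors of \<open>t * J / 4\<close>, one from near activity and
    one, by the choice of \<open>l\<close>, from smoothing.\<close>
  define J where "J = 32 * n ^ 3 * t"
  define l where "l = 4 * real (Suc M) / (t * J)"
  define R where "R = 2 * n * t"
  have J: "J > 0" and l: "l > 0" and R: "R > 0" using n t by (simp_all add: J_def l_def R_def)
  obtain Y :: "(real ^ 'n) set" where Y: "finite Y" "card Y = Suc M" "Y \<subseteq> cball 0 \<epsilon>"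
    "\<And>x y. x \<in> Y \<Longrightarrow> y \<in> Y \<Longrightarrow> x \<noteq> y \<Longrightarrow> 2 * J \<le> dist x y"
  proof (rule separated_card_ge[where 'n='n, of "2 * J" \<epsilon> M])
    show "real M * (2 * J) ^ CARD('n) < \<epsilon> ^ CARD('n)"
      using small by (simp add: J_def n_def mult_ac)
  qed (use J \<epsilon> in auto)
  obtain m :: nat where m: "m > 0" "4 * l * \<epsilon> * (2 * R / m) \<le> 1"
  proof -
    obtain m :: nat where "m > 8 * l * \<epsilon> * R" using reals_Archimedean2 by blast
    then show ?thesis using that[of "Suc m"] by (simp add: field_simps)
  qed
  show ?thesis
  proof (intro exI[of _ "l * \<epsilon>\<^sup>2"] conjI allI)
    fix c :: "nat \<Rightarrow> real ^ 'n"
    obtain d where d: "\<And>i. i \<in> {..<M} \<Longrightarrow> \<exists>y\<in>Y. \<exists>y'\<in>Y. y \<noteq> y' \<and>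
     (\<forall>z\<in>Y. c i \<bullet> z - d z \<le> c i \<bullet> y - d y + t * J / 4) \<and> (\<forall>z\<in>Y. c i \<bullet> z - d z \<le> c i \<bullet> y' - d y' + t * J / 4)"
      using near_optimal_potential[of "{..<M}" Y "t * J / 4" c] Y t J by auto
    interpret soft_maximum Y d l \<epsilon>
      using Y l by unfold_locales auto
    have tr: "1 \<le> trace (W R m x0)" if i: "i < M" and x0: "x0 \<in> cball (c i) t" for i x0
    proof -
      \<comment> \<open>Of two active slopes \<open>2 * J\<close> apart, at least one is at distance
        \<open>J\<close> or more from the mean slope \<open>g x0\<close>.\<close>
      obtain y where y: "y \<in> Y" "J \<le> norm (y - g x0)" "\<And>z. z \<in> Y \<Longrightarrow> c i \<bullet> z - d z \<le> c i \<bullet> y - d y + t * J / 4"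
      proof -
        obtain y y' where yy: "y \<in> Y" "y' \<in> Y" "y \<noteq> y'"
          "\<And>z. z \<in> Y \<Longrightarrow> c i \<bullet> z - d z \<le> c i \<bullet> y - d y + t * J / 4"
          "\<And>z. z \<in> Y \<Longrightarrow> c i \<bullet> z - d z \<le> c i \<bullet> y' - d y' + t * J / 4"
          using d[of i] i by auto
        have "2 * J \<le> dist y y'" using Y(4) yy by auto
        also have "\<dots> \<le> norm (y - g x0) + norm (y' - g x0)"
          using dist_triangle2[of y y' "g x0"] by (simp add: dist_norm)
        finally have "J \<le> norm (y - g x0) \<or> J \<le> norm (y' - g x0)" by linarith
        then show ?thesis using that yy by blast
      qed
      have y0: "norm (y - g x0) > 0" using y J by linarith
      \<comment> \<open>Moving from the centre by \<open>t\<close> in the direction of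
        \<open>y - g x0\<close> raises the affine function with slope \<open>y\<close> by at least
        \<open>t * J\<close> relative to the tangent of \<open>L\<close> at
        \<open>x0\<close>.\<close>
      define u where "u = (t / norm (y - g x0)) *\<^sub>R (y - g x0)"
      define x2 where "x2 = c i + u"
      have nu: "norm u = t" using y0 t by (simp add: u_def)
      have "norm (x2 - x0) \<le> norm u + norm (c i - x0)"
        unfolding x2_def using norm_triangle_ineq[of u "c i - x0"] by (simp add: algebra_simps)
      also have "\<dots> \<le> 2 * t" using nu x0 by (simp add: dist_norm)
      finally have z: "real CARD('n) * norm (x2 - x0) \<le> R"
        using n by (simp add: R_def n_def)
      have uJ: "t * J \<le> u \<bullet> (y - g x0)"
      proof -
        have "u \<bullet> (y - g x0) = (t / norm (y - g x0)) * (norm (y - g x0))\<^sup>2" by (simp add: u_def power2_norm_eq_inner)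
        also have "\<dots> = t * norm (y - g x0)" using y0 by (simp add: power2_eq_square)
        finally show ?thesis using y(2) t by simp
      qed
      have "x2 \<bullet> y - d y \<le> L x2" by (rule L_ge[OF y(1)])
      moreover have "L (c i) \<le> c i \<bullet> y - d y + t * J / 4 + t * J / 4"
      proof -
        have "real (card Y) / l = t * J / 4" using Y(2) t J by (simp add: l_def field_simps)
        then show ?thesis using L_le[of "c i" "c i \<bullet> y - d y + t * J / 4"] y(3) by metis
      qed
      moreover have "L x0 + (c i - x0) \<bullet> g x0 \<le> L (c i)" by (rule subgradient)
      moreover have "x2 \<bullet> y = c i \<bullet> y + u \<bullet> y" "(x2 - x0) \<bullet> g x0 = (c i - x0) \<bullet> g x0 + u \<bullet> g x0"
        by (simp_all add: x2_def inner_add_left inner_diff_left)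
      ultimately have "t * J / 2 \<le> L x2 - L x0 - (x2 - x0) \<bullet> g x0"
        using uJ unfolding inner_diff_right[of u] by argo
      also have "\<dots> \<le> 4 * R\<^sup>2 * n * trace (W R m x0)"
        unfolding n_def by (rule trace_W_ge_gap[OF R m z])
      also have "4 * R\<^sup>2 * n = t * J / 2"
        by (simp add: R_def J_def power2_eq_square power3_eq_cube)
      finally show ?thesis using t J by simp
    qed
    show "\<exists>w W. (\<forall>x. (w has_derivative (*v) (W x)) (at x)) \<and>
     continuous_on UNIV W \<and> (\<forall>x. norm (w x) \<le> \<epsilon>) \<and> (\<forall>x. transpose (W x) = W x) \<and>
     (\<forall>x v. 0 \<le> v \<bullet> (W x *v v) \<and> v \<bullet> (W x *v v) \<le> l * \<epsilon>\<^sup>2 * (v \<bullet> v)) \<and>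
     (\<forall>i<M. \<forall>x\<in>cball (c i) t. 1 \<le> trace (W x))"
      by (rule exI[of _ "w R m"], rule exI[of _ "W R m"])
        (use has_derivative_w continuous_W norm_w[OF m(1)] transpose_W W_nonneg W_le tr in blast)
  qed (use l \<epsilon> in auto)
qed

section \<open>Nonexpansive maps collapsing a null set\<close>

text \<open>The derivative field is an argument of its own because it is the fields, not the maps,
  that are later selected in L^2.\<close>

definition C1_contraction :: "(real ^ 'n \<Rightarrow> real ^ 'n) \<Rightarrow> (real ^ 'n \<Rightarrow> real ^ 'n ^ 'n) \<Rightarrow> bool" where
  "C1_contraction P B \<longleftrightarrow> (\<forall>x. (P has_derivative (*v) (B x)) (at x)) \<and> continuous_on UNIV B \<and>
     (\<forall>x v. norm (B x *v v) \<le> norm v)"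

lemma C1_contraction_Lipschitz:
  assumes "C1_contraction P B"
  shows "norm (P x - P y) \<le> norm (x - y)"
proof -
  have "norm (P x - P y) \<le> 1 * norm (x - y)"
  proof (rule differentiable_bound[of UNIV P "\<lambda>x. (*v) (B x)"])
    show "onorm ((*v) (B x)) \<le> 1" for x
      using assms by (intro onorm_le) (simp add: C1_contraction_def)
  qed (use assms in \<open>auto simp: C1_contraction_def\<close>)
  then show ?thesis by simp
qed

section \<open>Positive semidefinite matrices and contractions\<close>

lemma inner_matrix_transpose: "(A *v x) \<bullet> y = x \<bullet> (transpose A *v y)" for A :: "real ^ 'n ^ 'm"
  by (metis dot_lmul_matrix vector_transpose_matrix)

lemma norm_matrix_power2: "(norm A)\<^sup>2 = (\<Sum>i\<in>UNIV. \<Sum>j\<in>UNIV. (A $ i $ j)\<^sup>2)" for A :: "real ^ 'n ^ 'm"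
  by (simp add: norm_vec_def L2_set_def sum_nonneg)

lemma norm_matrix_columns: "(norm A)\<^sup>2 = (\<Sum>k\<in>UNIV. (norm (A *v axis k 1))\<^sup>2)" for A :: "real ^ 'n ^ 'm"
  unfolding norm_matrix_power2
  by (subst sum.swap) (simp add: matrix_vector_mult_basis column_def norm_vec_def L2_set_def sum_nonneg)

lemma contraction_transpose:
  fixes B :: "real ^ 'n ^ 'm"
  assumes "\<And>v. norm (B *v v) \<le> norm v"
  shows "norm (transpose B *v u) \<le> norm u"
proof -
  let ?w = "transpose B *v u"
  have "(norm ?w)\<^sup>2 = (B *v ?w) \<bullet> u"
    by (simp add: inner_matrix_transpose power2_norm_eq_inner)
  also have "\<dots> \<le> norm (B *v ?w) * norm u" by (rule norm_cauchy_schwarz)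
  also have "\<dots> \<le> norm ?w * norm u" using assms by (intro mult_right_mono) auto
  finally have "norm ?w * norm ?w \<le> norm ?w * norm u" by (simp add: power2_eq_square)
  then show ?thesis by (cases "norm ?w = 0") auto
qed

lemma psd_diagonal_nonneg:
  fixes A :: "real ^ 'n ^ 'n"
  assumes "\<And>v. 0 \<le> v \<bullet> (A *v v)"
  shows "0 \<le> A $ i $ i"
  using assms[of "axis i 1"] by (simp add: axis_inner_matrix)

lemma psd_trace_nonneg:
  fixes A :: "real ^ 'n ^ 'n"
  assumes "\<And>v. 0 \<le> v \<bullet> (A *v v)"
  shows "0 \<le> trace A"
  unfolding trace_def by (intro sum_nonneg psd_diagonal_nonneg assms)

text \<open>Positivity at \<open>axis i 1 + axis j 1\<close> and at
  \<open>axis i 1 - axis j 1\<close> bounds an off-diagonal entry by the mean of two diagonal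
  ones.\<close>

lemma psd_entry_le_trace:
  fixes A :: "real ^ 'n ^ 'n"
  assumes sym: "transpose A = A" and psd: "\<And>v. 0 \<le> v \<bullet> (A *v v)"
  shows "\<bar>A $ i $ j\<bar> \<le> trace A"
proof -
  have d: "0 \<le> A $ k $ k" "A $ k $ k \<le> trace A" for k
    using psd_diagonal_nonneg[OF psd] by (auto simp: trace_def intro!: member_le_sum)
  have ji: "A $ j $ i = A $ i $ j" using sym by (metis transpose_def vec_lambda_beta)
  have col: "A *v axis k 1 = column k A" for k by (rule matrix_vector_mult_basis)
  have "0 \<le> A $ i $ i + A $ j $ j + 2 * A $ i $ j"
    using psd[of "axis i 1 + axis j 1"] ji
    by (simp add: matrix_vector_right_distrib inner_add_left col column_def inner_axis')
  moreover have "0 \<le> A $ i $ i + A $ j $ j - 2 * A $ i $ j"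
    using psd[of "axis i 1 - axis j 1"] ji
    by (simp add: matrix_vector_mult_diff_distrib inner_diff_left col column_def inner_axis')
  ultimately show ?thesis using d[of i] d[of j] by linarith
qed

text \<open>In operator form, the square of \<open>H\<close> is at most \<open>\<Lambda>\<close>
  times \<open>H\<close>. Instead of diagonalising, positivity is tested at \<open>b\<close> minus
  \<open>1 / \<Lambda>\<close> times \<open>H *v b\<close>.\<close>

lemma psd_norm_power2_le:
  fixes H :: "real ^ 'n ^ 'n"
  assumes sym: "transpose H = H" and psd: "\<And>v. 0 \<le> v \<bullet> (H *v v)"
    and le: "\<And>v. v \<bullet> (H *v v) \<le> \<Lambda> * (v \<bullet> v)" and \<Lambda>: "\<Lambda> > 0"
  shows "(norm (H *v b))\<^sup>2 \<le> \<Lambda> * (b \<bullet> (H *v b))"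
proof -
  let ?h = "H *v b"
  have s: "b \<bullet> (H *v ?h) = ?h \<bullet> ?h" using inner_matrix_transpose[of H b ?h] sym by simp
  have "0 \<le> (b - (1/\<Lambda>) *\<^sub>R ?h) \<bullet> (H *v (b - (1/\<Lambda>) *\<^sub>R ?h))" by (rule psd)
  also have "\<dots> = b \<bullet> ?h - (2/\<Lambda>) * (?h \<bullet> ?h) + (1/\<Lambda>)\<^sup>2 * (?h \<bullet> (H *v ?h))"
    by (simp add: matrix_vector_mult_diff_distrib matrix_vector_mult_scaleR inner_diff_left inner_diff_right s
        power2_eq_square algebra_simps)
  also have "\<dots> \<le> b \<bullet> ?h - (2/\<Lambda>) * (?h \<bullet> ?h) + (1/\<Lambda>)\<^sup>2 * (\<Lambda> * (?h \<bullet> ?h))"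
    by (intro add_left_mono mult_left_mono le) auto
  also have "\<dots> = b \<bullet> ?h - (?h \<bullet> ?h) / \<Lambda>"
    using \<Lambda> by (simp add: power2_eq_square field_simps)
  finally show ?thesis using \<Lambda> by (simp add: power2_norm_eq_inner field_simps)
qed

text \<open>The first-order decrease of the squared norm is \<open>2 * \<tau>\<close> times the
  quadratic form; for \<open>\<tau> * \<Lambda> \<le> 1\<close> the second-order term returns at
  most half of it.\<close>

lemma contraction_step:
  fixes H :: "real ^ 'n ^ 'n"
  assumes sym: "transpose H = H" and psd: "\<And>v. 0 \<le> v \<bullet> (H *v v)"
    and le: "\<And>v. v \<bullet> (H *v v) \<le> \<Lambda> * (v \<bullet> v)" and \<Lambda>: "\<Lambda> > 0"
    and \<tau>: "0 \<le> \<tau>" "\<tau> * \<Lambda> \<le> 1"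
  shows "(norm ((mat 1 - \<tau> *\<^sub>R H) *v b))\<^sup>2 \<le> (norm b)\<^sup>2 - \<tau> * (b \<bullet> (H *v b))"
proof -
  let ?h = "H *v b"
  have eq: "(mat 1 - \<tau> *\<^sub>R H) *v b = b - \<tau> *\<^sub>R ?h"
    by (simp add: matrix_vector_mult_diff_rdistrib flip: scaleR_matrix_vector_assoc)
  have "(norm ((mat 1 - \<tau> *\<^sub>R H) *v b))\<^sup>2 = (norm b)\<^sup>2 - 2 * \<tau> * (b \<bullet> ?h) + \<tau> * (\<tau> * (norm ?h)\<^sup>2)"
    unfolding eq by (simp add: power2_norm_eq_inner inner_diff_left inner_diff_right inner_commute algebra_simps
        del: scaleR_matrix_vector_assoc)
  also have "\<dots> \<le> (norm b)\<^sup>2 - 2 * \<tau> * (b \<bullet> ?h) + \<tau> * (\<tau> * (\<Lambda> * (b \<bullet> ?h)))"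
    using \<tau> psd_norm_power2_le[OF sym psd le \<Lambda>] by (intro add_left_mono mult_left_mono) auto
  also have "\<tau> * (\<tau> * (\<Lambda> * (b \<bullet> ?h))) \<le> \<tau> * (b \<bullet> ?h)"
    using mult_right_mono[OF \<tau>(2) psd[of b]] \<tau>(1) by (intro mult_left_mono) (auto simp: mult_ac)
  finally show ?thesis by simp
qed

text \<open>The sum is the trace of \<open>H\<close> times \<open>B ** transpose B\<close>. The
  defect \<open>Q\<close> of the latter from the identity is positive semidefinite with trace at
  most \<open>1 / (2 * n\<^sup>2)\<close>, which therefore bounds all its entries. The entries of
  \<open>H\<close> are at most its trace, so the \<open>n\<^sup>2\<close> products lose at most half
  of \<open>trace H\<close>.\<close>

lemma nearly_isometric_trace:
  fixes B H :: "real ^ 'n ^ 'n"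
  assumes sym: "transpose H = H" and psd: "\<And>v. 0 \<le> v \<bullet> (H *v v)"
    and B: "\<And>v. norm (B *v v) \<le> norm v"
    and big: "real CARD('n) - 1 / (2 * (real CARD('n))\<^sup>2) \<le> (norm B)\<^sup>2"
  shows "trace H / 2 \<le> (\<Sum>k\<in>UNIV. (B *v axis k 1) \<bullet> (H *v (B *v axis k 1)))"
proof -
  define n where "n = real CARD('n)"
  have n: "n > 0" by (simp add: n_def)
  define Q where "Q = mat 1 - B ** transpose B"
  have BB: "(B ** transpose B) $ i $ j = (\<Sum>k\<in>UNIV. B $ i $ k * B $ j $ k)" for i j
    by (simp add: matrix_matrix_mult_def transpose_def)
  have Qsym: "transpose Q = Q"
    by (simp add: Q_def vec_eq_iff transpose_def mat_def matrix_matrix_mult_def mult.commute)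
  have Qpsd: "0 \<le> v \<bullet> (Q *v v)" for v
  proof -
    have "v \<bullet> (Q *v v) = v \<bullet> v - v \<bullet> (B *v (transpose B *v v))"
      by (simp add: Q_def matrix_vector_mult_diff_rdistrib inner_diff_right flip: matrix_vector_mul_assoc)
    also have "v \<bullet> (B *v (transpose B *v v)) = (transpose B *v v) \<bullet> (transpose B *v v)"
      by (metis inner_commute inner_matrix_transpose)
    finally show ?thesis
      using contraction_transpose[OF B, of v] by (simp add: norm_le)
  qed
  have trQ: "trace Q = n - (norm B)\<^sup>2"
    unfolding norm_matrix_power2
    by (simp add: Q_def trace_sub trace_I n_def) (simp add: trace_def BB power2_eq_square)
  have q: "\<bar>Q $ i $ j\<bar> \<le> 1 / (2 * n\<^sup>2)" for i j
    using psd_entry_le_trace[OF Qsym Qpsd, of i j] trQ big by (simp add: n_def)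
  have "(\<Sum>k\<in>UNIV. (B *v axis k 1) \<bullet> (H *v (B *v axis k 1))) = (\<Sum>k\<in>UNIV. \<Sum>i\<in>UNIV. \<Sum>j\<in>UNIV. H $ i $ j * (B $ i $ k * B $ j $ k))"
  proof (rule sum.cong)
    fix k
    have "(B *v axis k 1) $ i = B $ i $ k" for i by (simp add: matrix_vector_mult_basis column_def)
    moreover have "v \<bullet> (H *v v) = (\<Sum>i\<in>UNIV. \<Sum>j\<in>UNIV. H $ i $ j * (v $ i * v $ j))" for v
      by (simp add: inner_vec_def matrix_vector_mult_def sum_distrib_left mult_ac)
    ultimately show "(B *v axis k 1) \<bullet> (H *v (B *v axis k 1)) = (\<Sum>i\<in>UNIV. \<Sum>j\<in>UNIV. H $ i $ j * (B $ i $ k * B $ j $ k))"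
      by simp
  qed simp
  also have "\<dots> = (\<Sum>i\<in>UNIV. \<Sum>k\<in>UNIV. \<Sum>j\<in>UNIV. H $ i $ j * (B $ i $ k * B $ j $ k))"
    by (rule sum.swap)
  also have "\<dots> = (\<Sum>i\<in>UNIV. \<Sum>j\<in>UNIV. H $ i $ j * (B ** transpose B) $ i $ j)"
    unfolding BB sum_distrib_left by (intro sum.cong sum.swap refl)
  also have "\<dots> = (\<Sum>i\<in>UNIV. \<Sum>j\<in>UNIV. H $ i $ j * (mat 1 :: real ^ 'n ^ 'n) $ i $ j) - (\<Sum>i\<in>UNIV. \<Sum>j\<in>UNIV. H $ i $ j * Q $ i $ j)"
    by (simp add: Q_def right_diff_distrib sum_subtractf)
  also have "(\<Sum>i\<in>UNIV. \<Sum>j\<in>UNIV. H $ i $ j * (mat 1 :: real ^ 'n ^ 'n) $ i $ j) = trace H"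
    by (simp add: mat_def trace_def if_distrib[of "\<lambda>x. _ * x"] cong: if_cong)
  finally have eq: "(\<Sum>k\<in>UNIV. (B *v axis k 1) \<bullet> (H *v (B *v axis k 1))) = trace H - (\<Sum>i\<in>UNIV. \<Sum>j\<in>UNIV. H $ i $ j * Q $ i $ j)" .
  have "(\<Sum>i\<in>UNIV. \<Sum>j\<in>UNIV. H $ i $ j * Q $ i $ j) \<le> (\<Sum>i\<in>(UNIV::'n set). \<Sum>j\<in>(UNIV::'n set). trace H * (1 / (2 * n\<^sup>2)))"
  proof (intro sum_mono)
    fix i j
    have "H $ i $ j * Q $ i $ j \<le> \<bar>H $ i $ j\<bar> * \<bar>Q $ i $ j\<bar>" by (metis abs_ge_self abs_mult)
    also have "\<dots> \<le> trace H * (1 / (2 * n\<^sup>2))"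
      using psd_trace_nonneg[OF psd] by (intro mult_mono psd_entry_le_trace[OF sym psd] q) auto
    finally show "H $ i $ j * Q $ i $ j \<le> trace H * (1 / (2 * n\<^sup>2))" .
  qed
  also have "\<dots> = trace H / 2"
    using n by (simp add: power2_eq_square flip: n_def)
  finally show ?thesis using eq by linarith
qed

theorem contraction_collapsing_null_set:
  fixes K :: "(real ^ 'n) set"
  assumes K: "compact K" "negligible K" and e: "e > 0"
  obtains P B where "C1_contraction P B" "\<And>x. norm (P x - x) \<le> e"
    "\<And>x. x \<in> K \<Longrightarrow> (norm (B x))\<^sup>2 \<le> real CARD('n) - 1 / (2 * (real CARD('n))\<^sup>2)"
proof -
  define n where "n = real CARD('n)"
  have n: "n \<ge> 1" by (simp add: n_def Suc_leI)
  define a where "a = n - 1 / (2 * n\<^sup>2)"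
  obtain t and c :: "nat \<Rightarrow> real ^ 'n" and M where t: "t > 0" and cov: "K \<subseteq> (\<Union>i<M. cball (c i) t)"
    and small: "real M * t ^ CARD('n) < (e / (64 * n ^ 3)) ^ CARD('n)"
  proof (rule null_compact_cover[OF K])
    show "(e / (64 * n ^ 3)) ^ CARD('n) > 0" using e n by simp
  qed
  have small': "real M * (64 * real CARD('n) ^ 3 * t) ^ CARD('n) < e ^ CARD('n)"
  proof -
    define m where "m = CARD('n)"
    define b where "b = 64 * n ^ 3"
    have b: "b > 0" using n by (simp add: b_def)
    have "real M * t ^ m < (e / b) ^ m" using small by (simp only: m_def b_def)
    then have "real M * t ^ m * b ^ m < e ^ m" using b by (simp add: power_divide pos_less_divide_eq)
    then have "real M * (b * t) ^ m < e ^ m" by (simp add: power_mult_distrib mult_ac)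
    then show ?thesis by (simp only: m_def b_def n_def)
  qed
  obtain \<Lambda> where \<Lambda>: "\<Lambda> > 0" and field: "\<And>c :: nat \<Rightarrow> real ^ 'n. \<exists>w W. (\<forall>x. (w has_derivative (*v) (W x)) (at x)) \<and>
     continuous_on UNIV W \<and> (\<forall>x. norm (w x) \<le> e) \<and> (\<forall>x. transpose (W x) = W x) \<and>
     (\<forall>x v. 0 \<le> v \<bullet> (W x *v v) \<and> v \<bullet> (W x *v v) \<le> \<Lambda> * (v \<bullet> v)) \<and>
     (\<forall>i<M. \<forall>x\<in>cball (c i) t. 1 \<le> trace (W x))"
    using collapsing_field[where 'n='n, OF t e small'] by (elim exE conjE) (rule that, assumption, erule spec)
  (* \<Lambda> does not depend on the centres, so one step size \<tau> serves for all images of K. *)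
  obtain N :: nat where N: "\<Lambda> < real N" using reals_Archimedean2 by blast
  then have N0: "N > 0" using \<Lambda> by (cases N) auto
  \<comment> \<open>The \<open>N\<close> steps have total length \<open>1 / n\<^sup>2\<close>. At a
    loss of \<open>\<tau> / 2\<close> each they bring the squared norm from \<open>n\<close> down to
    \<open>a\<close>, while the displacements add up to at most \<open>e\<close>.\<close>
  define \<tau> where "\<tau> = 1 / (n\<^sup>2 * N)"
  have \<tau>: "\<tau> > 0" using n N0 by (simp add: \<tau>_def)
  have \<tau>\<Lambda>: "\<tau> * \<Lambda> \<le> 1"
  proof -
    have "1 * \<Lambda> \<le> n\<^sup>2 * real N" using N n \<Lambda> by (intro mult_mono) auto
    then show ?thesis using n N0 by (simp add: \<tau>_def)
  qed
  \<comment> \<open>The maximum encodes two regimes at a point of \<open>K\<close>. At or below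
    \<open>a\<close> it is enough that further steps do not increase the norm; above
    \<open>a\<close> the derivative is close enough to an isometry to lose
    \<open>\<tau> / 2\<close>.\<close>
  have "\<exists>P B. C1_contraction P B \<and> (\<forall>x. norm (P x - x) \<le> j * \<tau> * e) \<and>
      (\<forall>x\<in>K. (norm (B x))\<^sup>2 \<le> max a (n - j * \<tau> / 2))" for j :: nat
  proof (induction j)
    case 0
    have "(*v) (mat 1 :: real ^ 'n ^ 'n) = (\<lambda>v. v)" by (simp add: fun_eq_iff)
    then have "C1_contraction (\<lambda>x. x) (\<lambda>x. mat 1 :: real ^ 'n ^ 'n)"
      by (simp add: C1_contraction_def has_derivative_ident)
    moreover have "(norm (mat 1 :: real ^ 'n ^ 'n))\<^sup>2 = n"
      by (simp add: norm_matrix_power2 mat_def n_def if_distrib[of "\<lambda>x. x\<^sup>2"] cong: if_cong)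
    ultimately show ?case by (intro exI[of _ "\<lambda>x. x"] exI[of _ "\<lambda>x. mat 1"]) simp
  next
    case (Suc j)
    then obtain P B where P: "C1_contraction P B" "\<And>x. norm (P x - x) \<le> j * \<tau> * e"
      "\<And>x. x \<in> K \<Longrightarrow> (norm (B x))\<^sup>2 \<le> max a (n - j * \<tau> / 2)" by blast
    have P': "(P has_derivative (*v) (B x)) (at x)" "continuous_on UNIV B" "norm (B x *v v) \<le> norm v" for x v
      using P(1) by (auto simp: C1_contraction_def)
    obtain w W where w: "\<And>x. (w has_derivative (*v) (W x)) (at x)" "continuous_on UNIV W" "\<And>x. norm (w x) \<le> e"
      and sym: "\<And>x. transpose (W x) = W x" and psd: "\<And>x v. 0 \<le> v \<bullet> (W x *v v)"
      and le: "\<And>x v. v \<bullet> (W x *v v) \<le> \<Lambda> * (v \<bullet> v)"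
      and tr: "\<And>i x. i < M \<Longrightarrow> x \<in> cball (P (c i)) t \<Longrightarrow> 1 \<le> trace (W x)"
      using field[of "\<lambda>i. P (c i)"] by blast
    define P2 where "P2 x = P x - \<tau> *\<^sub>R w (P x)" for x
    define S where "S x = mat 1 - \<tau> *\<^sub>R W x" for x
    define B2 where "B2 x = S (P x) ** B x" for x
    have step: "(norm (S x *v b))\<^sup>2 \<le> (norm b)\<^sup>2 - \<tau> * (b \<bullet> (W x *v b))" for x b
      unfolding S_def using contraction_step[OF sym psd le \<Lambda> _ \<tau>\<Lambda>] \<tau> by simp
    have "C1_contraction P2 B2"
      unfolding C1_contraction_def
    proof (intro conjI allI)
      fix x
      have "((\<lambda>x. w (P x)) has_derivative (\<lambda>v. W (P x) *v (B x *v v))) (at x)"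
        by (rule has_derivative_compose[OF P'(1) w(1)])
      then have "(P2 has_derivative (\<lambda>v. B x *v v - \<tau> *\<^sub>R (W (P x) *v (B x *v v)))) (at x)"
        unfolding P2_def by (intro has_derivative_diff P'(1) has_derivative_scaleR_right)
      moreover have "(*v) (B2 x) = (\<lambda>v. B x *v v - \<tau> *\<^sub>R (W (P x) *v (B x *v v)))"
      proof (rule ext)
        fix v
        have "B2 x *v v = S (P x) *v (B x *v v)" by (simp add: B2_def matrix_vector_mul_assoc)
        also have "\<dots> = B x *v v - (\<tau> *\<^sub>R W (P x)) *v (B x *v v)"
          unfolding S_def by (simp only: matrix_vector_mult_diff_rdistrib matrix_vector_mul_lid)
        finally show "B2 x *v v = B x *v v - \<tau> *\<^sub>R (W (P x) *v (B x *v v))"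
          by (simp only: scaleR_matrix_vector_assoc)
      qed
      ultimately show "(P2 has_derivative (*v) (B2 x)) (at x)" by (simp only:)
    next
      have "continuous_on UNIV P"
        using P'(1) by (intro continuous_at_imp_continuous_on) (blast intro: has_derivative_continuous)
      then have "continuous_on UNIV (\<lambda>x. W (P x))"
        by (rule continuous_on_compose2[OF w(2)]) auto
      then show "continuous_on UNIV B2"
        unfolding B2_def S_def matrix_matrix_mult_def using P'(2) by (intro continuous_intros)
    next
      fix x v
      have "(norm (S (P x) *v (B x *v v)))\<^sup>2 \<le> (norm (B x *v v))\<^sup>2"
        using step[of "P x" "B x *v v"] mult_nonneg_nonneg[OF less_imp_le[OF \<tau>] psd[of "B x *v v" "P x"]] by linarith
      then have "norm (S (P x) *v (B x *v v)) \<le> norm (B x *v v)" by (rule power2_le_imp_le) simp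
      then show "norm (B2 x *v v) \<le> norm v"
        using P'(3)[of x v] by (simp add: B2_def flip: matrix_vector_mul_assoc)
    qed
    moreover have "norm (P2 x - x) \<le> Suc j * \<tau> * e" for x
    proof -
      have "norm (P2 x - x) \<le> norm (P x - x) + norm (\<tau> *\<^sub>R w (P x))"
        unfolding P2_def using norm_triangle_ineq4[of "P x - x" "\<tau> *\<^sub>R w (P x)"] by (simp add: algebra_simps)
      also have "norm (\<tau> *\<^sub>R w (P x)) \<le> \<tau> * e" using w(3) \<tau> by simp
      finally show ?thesis using P(2)[of x] by (simp add: algebra_simps)
    qed
    moreover have "(norm (B2 x))\<^sup>2 \<le> max a (n - Suc j * \<tau> / 2)" if x: "x \<in> K" for x
    proof -
      define D where "D = (\<Sum>k\<in>UNIV. (B x *v axis k 1) \<bullet> (W (P x) *v (B x *v axis k 1)))"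
      have D0: "0 \<le> D" unfolding D_def by (intro sum_nonneg psd)
      have "(norm (B2 x))\<^sup>2 = (\<Sum>k\<in>UNIV. (norm (S (P x) *v (B x *v axis k 1)))\<^sup>2)"
        by (simp add: norm_matrix_columns B2_def matrix_vector_mul_assoc)
      also have "\<dots> \<le> (\<Sum>k\<in>UNIV. (norm (B x *v axis k 1))\<^sup>2 - \<tau> * ((B x *v axis k 1) \<bullet> (W (P x) *v (B x *v axis k 1))))"
        by (intro sum_mono step)
      also have "\<dots> = (norm (B x))\<^sup>2 - \<tau> * D"
        by (simp add: sum_subtractf norm_matrix_columns D_def sum_distrib_left)
      finally have le2: "(norm (B2 x))\<^sup>2 \<le> (norm (B x))\<^sup>2 - \<tau> * D" .
      show ?thesis
      proof (cases "(norm (B x))\<^sup>2 \<le> a")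
        case True
        then show ?thesis using le2 mult_nonneg_nonneg[OF less_imp_le[OF \<tau>] D0] by linarith
      next
        case False
        obtain i where i: "i < M" "x \<in> cball (c i) t" using cov x by auto
        \<comment> \<open>Since \<open>P\<close> is nonexpansive, balls of the original radius
          \<open>t\<close> about the moved centres still cover the image of
          \<open>K\<close>.\<close>
        have "P x \<in> cball (P (c i)) t"
          using i C1_contraction_Lipschitz[OF P(1), of "c i" x] by (simp add: dist_norm)
        then have "1 \<le> trace (W (P x))" using tr i by blast
        moreover have "trace (W (P x)) / 2 \<le> D"
          unfolding D_def using False by (intro nearly_isometric_trace sym psd P') (simp add: a_def n_def)
        ultimately have "\<tau> * (1/2) \<le> \<tau> * D" using \<tau> by (intro mult_left_mono) auto
        then have "(norm (B2 x))\<^sup>2 \<le> (norm (B x))\<^sup>2 - \<tau> / 2" using le2 by simp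
        moreover have "(norm (B x))\<^sup>2 \<le> n - j * \<tau> / 2" using P(3)[OF x] False by simp
        moreover have "real (Suc j) * \<tau> / 2 = real j * \<tau> / 2 + \<tau> / 2" by (simp add: algebra_simps)
        ultimately have "(norm (B2 x))\<^sup>2 \<le> n - real (Suc j) * \<tau> / 2" by linarith
        then show ?thesis by (rule max.coboundedI2)
      qed
    qed
    ultimately show ?case by blast
  qed
  from this[of N] obtain P B where PB: "C1_contraction P B" "\<And>x. norm (P x - x) \<le> N * \<tau> * e"
      "\<And>x. x \<in> K \<Longrightarrow> (norm (B x))\<^sup>2 \<le> max a (n - N * \<tau> / 2)" by blast
  have N\<tau>: "N * \<tau> = 1 / n\<^sup>2" using N0 by (simp add: \<tau>_def)
  have "1 / n\<^sup>2 \<le> 1" using n by simp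
  then have Ne: "N * \<tau> * e \<le> e" using N\<tau> e mult_right_mono[of "1 / n\<^sup>2" 1 e] by simp
  have ma: "max a (n - N * \<tau> / 2) = a" using N\<tau> by (simp add: a_def)
  show ?thesis
  proof (rule that[OF PB(1)])
    show "norm (P x - x) \<le> e" for x using PB(2)[of x] Ne by linarith
    show "(norm (B x))\<^sup>2 \<le> real CARD('n) - 1 / (2 * (real CARD('n))\<^sup>2)" if "x \<in> K" for x
      using PB(3)[OF that] ma by (simp add: a_def n_def)
  qed
qed

section \<open>Curves and upper gradients\<close>

text \<open>Recursive form of the sum in \<open>curve_length\<close>, so that inserting a point into
  a partition can be handled by list induction.\<close>

fun polygon_length :: "(real \<Rightarrow> 'a::metric_space) \<Rightarrow> real list \<Rightarrow> real" where
  "polygon_length \<gamma> (x # y # zs) = dist (\<gamma> x) (\<gamma> y) + polygon_length \<gamma> (y # zs)"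
| "polygon_length \<gamma> _ = 0"

lemma polygon_length_nonneg: "0 \<le> polygon_length \<gamma> ts"
  by (induction \<gamma> ts rule: polygon_length.induct) auto

lemma sum_dist_polygon_length:
  "(\<Sum>i<length ts - 1. ennreal (dist (\<gamma> (ts ! i)) (\<gamma> (ts ! Suc i)))) = ennreal (polygon_length \<gamma> ts)"
proof (induction \<gamma> ts rule: polygon_length.induct)
  case (1 \<gamma> x y zs)
  have "(\<Sum>i<length (x # y # zs) - 1. ennreal (dist (\<gamma> ((x # y # zs) ! i)) (\<gamma> ((x # y # zs) ! Suc i))))
     = ennreal (dist (\<gamma> x) (\<gamma> y)) + (\<Sum>i<length (y # zs) - 1. ennreal (dist (\<gamma> ((y # zs) ! i)) (\<gamma> ((y # zs) ! Suc i))))"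
    by (simp add: sum.lessThan_Suc_shift del: sum.lessThan_Suc sum_ennreal)
  then show ?case unfolding 1 by (simp add: ennreal_plus polygon_length_nonneg)
qed auto

lemma curve_length_eq:
  "curve_length \<gamma> a b = (SUP ts\<in>{ts. sorted ts \<and> set ts \<subseteq> {a..b}}. ennreal (polygon_length \<gamma> ts))"
  unfolding curve_length_def sum_dist_polygon_length ..

lemma polygon_length_le_curve_length:
  "sorted ts \<Longrightarrow> set ts \<subseteq> {a..b} \<Longrightarrow> ennreal (polygon_length \<gamma> ts) \<le> curve_length \<gamma> a b"
  unfolding curve_length_eq by (rule SUP_upper) simp

lemma polygon_length_append:
  "polygon_length \<gamma> xs + polygon_length \<gamma> ys \<le> polygon_length \<gamma> (xs @ ys)"
proof (induction \<gamma> xs rule: polygon_length.induct)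
  case ("2_2" \<gamma> v)
  then show ?case by (cases ys) auto
qed auto

lemma polygon_length_insert:
  "polygon_length \<gamma> (xs @ ys) \<le> polygon_length \<gamma> (xs @ [s]) + polygon_length \<gamma> (s # ys)"
proof (induction \<gamma> xs rule: polygon_length.induct)
  case ("2_1" \<gamma>)
  then show ?case by (cases ys) auto
next
  case ("2_2" \<gamma> v)
  then show ?case
    by (cases ys) (auto intro: dist_triangle add_right_mono simp: polygon_length_nonneg simp flip: add.assoc)
qed auto

lemma polygon_length_short:
  assumes "\<And>x y. x \<in> set ts \<Longrightarrow> y \<in> set ts \<Longrightarrow> dist (\<gamma> x) (\<gamma> y) \<le> e" "0 \<le> e"
  shows "polygon_length \<gamma> ts \<le> real (length ts) * e"
  using assms
proof (induction \<gamma> ts rule: polygon_length.induct)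
  case (1 \<gamma> x y zs)
  have "dist (\<gamma> x) (\<gamma> y) \<le> e" using 1(2)[of x y] by simp
  moreover have "polygon_length \<gamma> (y # zs) \<le> real (length (y # zs)) * e"
    by (rule 1(1)) (use 1(2,3) in auto)
  ultimately show ?case by (simp add: algebra_simps)
qed auto

lemma curve_length_ge_dist: "s \<le> t \<Longrightarrow> ennreal (dist (\<gamma> s) (\<gamma> t)) \<le> curve_length \<gamma> s t"
  using polygon_length_le_curve_length[of "[s, t]" s t \<gamma>] by simp

lemma curve_length_refl: "curve_length \<gamma> a a = 0"
proof -
  have "polygon_length \<gamma> ts = 0" if "set ts \<subseteq> {a}" for ts
    using that by (induction \<gamma> ts rule: polygon_length.induct) auto
  then show ?thesis unfolding curve_length_eq by (auto simp: SUP_eq_const bot_ennreal intro!: antisym SUP_least)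
qed

lemma sorted_split:
  fixes ts :: "real list"
  assumes "sorted ts"
  shows "ts = filter (\<lambda>x. x \<le> s) ts @ filter (\<lambda>x. s < x) ts"
  using assms
proof (induction ts)
  case (Cons x ts)
  show ?case
  proof (cases "x \<le> s")
    case False
    then have "filter (\<lambda>x. x \<le> s) ts = []" "filter (\<lambda>x. s < x) ts = ts"
      using Cons.prems by (auto simp: filter_empty_conv filter_id_conv)
    then show ?thesis using False by simp
  qed (use Cons in auto)
qed simp

lemma curve_length_add:
  assumes "a \<le> s" "s \<le> b"
  shows "curve_length \<gamma> a b = curve_length \<gamma> a s + curve_length \<gamma> s b"
proof (rule antisym)
  show "curve_length \<gamma> a b \<le> curve_length \<gamma> a s + curve_length \<gamma> s b"
    unfolding curve_length_eq[of \<gamma> a b]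
  proof (rule SUP_least)
    fix ts assume "ts \<in> {ts. sorted ts \<and> set ts \<subseteq> {a..b}}"
    then have ts: "sorted ts" "set ts \<subseteq> {a..b}" by auto
    let ?l = "filter (\<lambda>x. x \<le> s) ts" and ?r = "filter (\<lambda>x. s < x) ts"
    have "polygon_length \<gamma> ts \<le> polygon_length \<gamma> (?l @ [s]) + polygon_length \<gamma> (s # ?r)"
      using polygon_length_insert[of \<gamma> ?l ?r s] sorted_split[OF ts(1), of s] by simp
    then have "ennreal (polygon_length \<gamma> ts) \<le> ennreal (polygon_length \<gamma> (?l @ [s])) + ennreal (polygon_length \<gamma> (s # ?r))"
      by (simp add: polygon_length_nonneg flip: ennreal_plus)
    also have "\<dots> \<le> curve_length \<gamma> a s + curve_length \<gamma> s b"
      using ts assms by (intro add_mono polygon_length_le_curve_length) (auto simp: sorted_append sorted_wrt_filter)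
    finally show "ennreal (polygon_length \<gamma> ts) \<le> curve_length \<gamma> a s + curve_length \<gamma> s b" .
  qed
next
  have ne: "{ts. sorted ts \<and> set ts \<subseteq> {u..v}} \<noteq> {}" for u v :: real
    by (auto intro: exI[of _ "[]"])
  have "curve_length \<gamma> a s + curve_length \<gamma> s b = (SUP xs\<in>{ts. sorted ts \<and> set ts \<subseteq> {a..s}}.
      SUP ys\<in>{ts. sorted ts \<and> set ts \<subseteq> {s..b}}. ennreal (polygon_length \<gamma> xs) + ennreal (polygon_length \<gamma> ys))"
    unfolding curve_length_eq ennreal_SUP_add_right[OF ne, symmetric] ennreal_SUP_add_left[OF ne] ..
  also have "\<dots> \<le> curve_length \<gamma> a b"
  proof (intro SUP_least)
    fix xs ys assume "xs \<in> {ts. sorted ts \<and> set ts \<subseteq> {a..s}}" "ys \<in> {ts. sorted ts \<and> set ts \<subseteq> {s..b}}"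
    then have xy: "sorted xs" "set xs \<subseteq> {a..s}" "sorted ys" "set ys \<subseteq> {s..b}" by auto
    have "ennreal (polygon_length \<gamma> xs) + ennreal (polygon_length \<gamma> ys) \<le> ennreal (polygon_length \<gamma> (xs @ ys))"
      using polygon_length_append[of \<gamma> xs ys] by (simp add: polygon_length_nonneg flip: ennreal_plus)
    also have "\<dots> \<le> curve_length \<gamma> a b"
      using xy assms by (intro polygon_length_le_curve_length) (force simp: sorted_append)+
    finally show "ennreal (polygon_length \<gamma> xs) + ennreal (polygon_length \<gamma> ys) \<le> curve_length \<gamma> a b" .
  qed
  finally show "curve_length \<gamma> a s + curve_length \<gamma> s b \<le> curve_length \<gamma> a b" .
qed

section \<open>Arc length of a rectifiable curve\<close>

context
  fixes \<gamma> :: "real \<Rightarrow> 'a::metric_space" and a b :: real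
  assumes rect: "rectifiable_curve \<gamma> a b"
begin

lemma rectifiable_le: "a \<le> b" and rectifiable_continuous: "continuous_on {a..b} \<gamma>" and rectifiable_finite: "curve_length \<gamma> a b < \<infinity>"
  using rect by (auto simp: rectifiable_curve_def)

definition "arclen s = enn2real (curve_length \<gamma> a s)"

lemma curve_length_finite:
  assumes "a \<le> s" "s \<le> t" "t \<le> b"
  shows "curve_length \<gamma> s t < \<infinity>"
proof -
  have "curve_length \<gamma> s t \<le> curve_length \<gamma> a t"
    using curve_length_add[of a s t \<gamma>] assms by (simp add: add_increasing)
  also have "\<dots> \<le> curve_length \<gamma> a b"
    using curve_length_add[of a t b \<gamma>] assms by (simp add: add_increasing2)
  finally show ?thesis using rectifiable_finite by simp
qed

lemma arclen_eq: "a \<le> s \<Longrightarrow> s \<le> b \<Longrightarrow> curve_length \<gamma> a s = ennreal (arclen s)"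
  using curve_length_finite[of a s] by (simp add: arclen_def)

lemma arclen_nonneg: "0 \<le> arclen s" by (simp add: arclen_def)

lemma curve_length_arclen:
  assumes "a \<le> s" "s \<le> t" "t \<le> b"
  shows "curve_length \<gamma> s t = ennreal (arclen t - arclen s)" "arclen s \<le> arclen t"
proof -
  have "ennreal (arclen t) = ennreal (arclen s) + curve_length \<gamma> s t"
    using curve_length_add[of a s t \<gamma>] assms by (simp add: arclen_eq)
  moreover obtain r where r: "curve_length \<gamma> s t = ennreal r" "0 \<le> r"
    using curve_length_finite[OF assms] by (cases "curve_length \<gamma> s t") auto
  ultimately have "arclen t = arclen s + r"
    using arclen_nonneg by (simp flip: ennreal_plus)
  then show "curve_length \<gamma> s t = ennreal (arclen t - arclen s)" "arclen s \<le> arclen t"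
    using r by auto
qed

lemma dist_le_arclen:
  assumes "a \<le> s" "s \<le> t" "t \<le> b"
  shows "dist (\<gamma> s) (\<gamma> t) \<le> arclen t - arclen s"
  using curve_length_ge_dist[OF assms(2), of \<gamma>] curve_length_arclen[OF assms] by simp

text \<open>A partition whose polygon misses the total length by less than \<open>e/2\<close> is
  refined by \<open>s\<close> and \<open>t\<close>. The outer polygons are at most the outer arc
  lengths, and the middle one has a bounded number of points, all with close images by uniform
  continuity; so the middle arc must be short.\<close>

lemma arclen_uniformly_small:
  assumes e: "e > 0"
  obtains \<delta> where "\<delta> > 0" "\<And>s t. a \<le> s \<Longrightarrow> s \<le> t \<Longrightarrow> t \<le> b \<Longrightarrow> t - s < \<delta> \<Longrightarrow> arclen t - arclen s < e"
proof -
  have "arclen b - e/2 < arclen b" using e by simp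
  obtain ts where ts: "sorted ts" "set ts \<subseteq> {a..b}" "arclen b - e/2 < polygon_length \<gamma> ts"
  proof -
    have "ennreal (arclen b) = (SUP ts\<in>{ts. sorted ts \<and> set ts \<subseteq> {a..b}}. ennreal (polygon_length \<gamma> ts))"
      using arclen_eq[of b] rectifiable_le by (simp add: curve_length_eq)
    moreover have "ennreal (arclen b - e/2) < ennreal (arclen b) \<or> arclen b - e/2 < 0"
      using e by (auto simp: ennreal_less_iff)
    \<comment> \<open>\<open>ennreal\<close> sends negative numbers to 0, so the strict comparison
      with the supremum may fail when \<open>arclen b - e/2\<close> is negative; there the empty
      partition will do.\<close>
    ultimately consider "arclen b - e/2 < 0" | 
       "ennreal (arclen b - e/2) < (SUP ts\<in>{ts. sorted ts \<and> set ts \<subseteq> {a..b}}. ennreal (polygon_length \<gamma> ts))" by auto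
    then show ?thesis
    proof cases
      case 1
      then show ?thesis using that[of "[]"] by simp
    next
      case 2
      then obtain ts where "sorted ts" "set ts \<subseteq> {a..b}" "ennreal (arclen b - e/2) < ennreal (polygon_length \<gamma> ts)"
        unfolding less_SUP_iff by auto
      then show ?thesis using that by (metis ennreal_leI not_less)
    qed
  qed
  define N where "N = real (length ts + 2)"
  define e' where "e' = e / (2 * N)"
  have e': "e' > 0" using e by (simp add: e'_def N_def)
  have "uniformly_continuous_on {a..b} \<gamma>"
    using rectifiable_continuous by (rule compact_uniformly_continuous) simp
  then obtain \<delta> where \<delta>: "\<delta> > 0" "\<And>x y. x \<in> {a..b} \<Longrightarrow> y \<in> {a..b} \<Longrightarrow> dist y x < \<delta> \<Longrightarrow> dist (\<gamma> y) (\<gamma> x) < e'"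
    using e' unfolding uniformly_continuous_on_def by metis
  show ?thesis
  proof (rule that[OF \<delta>(1)])
    fix s t assume st: "a \<le> s" "s \<le> t" "t \<le> b" "t - s < \<delta>"
    define l r where "l = filter (\<lambda>x. x \<le> s) ts" and "r = filter (\<lambda>x. s < x) ts"
    define m u where "m = filter (\<lambda>x. x \<le> t) r" and "u = filter (\<lambda>x. t < x) r"
    have srt: "sorted l" "sorted r" "sorted m" "sorted u"
      using ts(1) by (auto simp: l_def r_def m_def u_def sorted_wrt_filter)
    have p1: "polygon_length \<gamma> ts \<le> polygon_length \<gamma> (l @ [s]) + polygon_length \<gamma> (s # r)"
      using polygon_length_insert[of \<gamma> l r s] sorted_split[OF ts(1), of s] by (simp add: l_def r_def)
    have p2: "polygon_length \<gamma> (s # r) \<le> polygon_length \<gamma> (s # m @ [t]) + polygon_length \<gamma> (t # u)"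
      using polygon_length_insert[of \<gamma> "s # m" u t] sorted_split[OF srt(2), of t] by (simp add: m_def u_def)
    have "ennreal (polygon_length \<gamma> (l @ [s])) \<le> curve_length \<gamma> a s"
      by (rule polygon_length_le_curve_length) (use ts st srt in \<open>auto simp: l_def sorted_append\<close>)
    then have q1: "polygon_length \<gamma> (l @ [s]) \<le> arclen s"
      using st arclen_eq[of s] arclen_nonneg by simp
    have "ennreal (polygon_length \<gamma> (t # u)) \<le> curve_length \<gamma> t b"
      by (rule polygon_length_le_curve_length) (use ts st srt in \<open>auto simp: u_def r_def\<close>)
    then have q2: "polygon_length \<gamma> (t # u) \<le> arclen b - arclen t"
      using st curve_length_arclen[of t b] by simp
    have "polygon_length \<gamma> (s # m @ [t]) \<le> real (length (s # m @ [t])) * e'"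
    proof (rule polygon_length_short)
      fix x y assume "x \<in> set (s # m @ [t])" "y \<in> set (s # m @ [t])"
      then have "x \<in> {s..t}" "y \<in> {s..t}" using st by (auto simp: m_def r_def)
      then have "dist y x < \<delta>" "x \<in> {a..b}" "y \<in> {a..b}" using st by (auto simp: dist_real_def)
      then show "dist (\<gamma> x) (\<gamma> y) \<le> e'" using \<delta>(2)[of x y] by (simp add: dist_commute)
    qed (use e' in simp)
    also have "\<dots> \<le> N * e'"
    proof (rule mult_right_mono)
      have "length m \<le> length r" "length r \<le> length ts" unfolding m_def r_def by (rule length_filter_le)+
      then show "real (length (s # m @ [t])) \<le> N" by (simp add: N_def)
    qed (use e' in simp)
    also have "\<dots> = e / 2"
    proof -
      have "N > 0" by (simp add: N_def)
      then show ?thesis by (simp add: e'_def)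
    qed
    finally show "arclen t - arclen s < e" using p1 p2 q1 q2 ts(3) by linarith
  qed
qed

lemma arclen_continuous: "continuous_on {a..b} arclen"
proof (rule continuous_onI)
  fix x e :: real assume x: "x \<in> {a..b}" and e: "e > 0"
  obtain \<delta> where \<delta>: "\<delta> > 0" "\<And>s t. a \<le> s \<Longrightarrow> s \<le> t \<Longrightarrow> t \<le> b \<Longrightarrow> t - s < \<delta> \<Longrightarrow> arclen t - arclen s < e"
    using arclen_uniformly_small[OF e] by blast
  show "\<exists>d>0. \<forall>x'\<in>{a..b}. dist x' x < d \<longrightarrow> dist (arclen x') (arclen x) \<le> e"
  proof (intro exI conjI ballI impI)
    fix y assume y: "y \<in> {a..b}" "dist y x < \<delta>"
    show "dist (arclen y) (arclen x) \<le> e"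
    proof (cases "x \<le> y")
      case True
      then show ?thesis using \<delta>(2)[of x y] curve_length_arclen(2)[of x y] x y by (auto simp: dist_real_def)
    next
      case False
      then show ?thesis using \<delta>(2)[of y x] curve_length_arclen(2)[of y x] x y by (auto simp: dist_real_def)
    qed
  qed (rule \<delta>(1))
qed

lemma arclength_param_exists:
  assumes "0 \<le> t" "t \<le> arclen b"
  obtains s where "s \<in> {a..b}" "arclen s = t" "arclength_param \<gamma> a b t = \<gamma> s"
proof -
  have "arclen a = 0" by (simp add: arclen_def curve_length_refl)
  then obtain s0 where s0: "a \<le> s0" "s0 \<le> b" "arclen s0 = t"
    using IVT'[of arclen a t b] assms rectifiable_le arclen_continuous by auto
  define s where "s = (SOME s. s \<in> {a..b} \<and> curve_length \<gamma> a s = ennreal t)"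
  have "s \<in> {a..b} \<and> curve_length \<gamma> a s = ennreal t"
    unfolding s_def by (rule someI[of _ s0]) (use s0 arclen_eq in auto)
  then have "s \<in> {a..b}" "arclen s = t" using assms by (auto simp: arclen_def)
  then show ?thesis using that by (simp add: arclength_param_def s_def)
qed

lemma arclength_param_dist:
  assumes "0 \<le> t" "t \<le> u" "u \<le> arclen b"
  shows "dist (arclength_param \<gamma> a b t) (arclength_param \<gamma> a b u) \<le> u - t"
proof -
  obtain s where s: "s \<in> {a..b}" "arclen s = t" "arclength_param \<gamma> a b t = \<gamma> s"
    using arclength_param_exists[of t] assms by auto
  obtain v where v: "v \<in> {a..b}" "arclen v = u" "arclength_param \<gamma> a b u = \<gamma> v"
    using arclength_param_exists[of u] assms by auto
  show ?thesis
  proof (cases "s \<le> v")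
    case True
    then show ?thesis using dist_le_arclen[of s v] s v by simp
  next
    case False
    then have "arclen v \<le> arclen s" using curve_length_arclen(2)[of v s] s v by simp
    then show ?thesis using dist_le_arclen[of v s] False s v assms by (simp add: dist_commute)
  qed
qed

lemma arclength_param_0: "arclength_param \<gamma> a b 0 = \<gamma> a"
  and arclength_param_end: "arclength_param \<gamma> a b (arclen b) = \<gamma> b"
proof -
  obtain s where s: "s \<in> {a..b}" "arclen s = 0" "arclength_param \<gamma> a b 0 = \<gamma> s"
    using arclength_param_exists[of 0] arclen_nonneg by auto
  then show "arclength_param \<gamma> a b 0 = \<gamma> a"
    using dist_le_arclen[of a s] by (simp add: arclen_def curve_length_refl)
  obtain s where s: "s \<in> {a..b}" "arclen s = arclen b" "arclength_param \<gamma> a b (arclen b) = \<gamma> s"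
    using arclength_param_exists[of "arclen b"] arclen_nonneg by auto
  then show "arclength_param \<gamma> a b (arclen b) = \<gamma> b"
    using dist_le_arclen[of s b] by simp
qed

end

text \<open>The bound on an interval is additive under subdivision, so Bolzano's bisection principle
  reduces it to short intervals around a point. No differentiability of \<open>F\<close> is
  involved.\<close>

lemma local_Lipschitz_integral_bound:
  fixes F h :: "real \<Rightarrow> real"
  assumes h: "continuous_on UNIV h" and T: "0 \<le> T"
    and loc: "\<And>t e. e > 0 \<Longrightarrow> \<exists>r>0. \<forall>u v. \<bar>u - t\<bar> < r \<and> \<bar>v - t\<bar> < r \<longrightarrow> \<bar>F u - F v\<bar> \<le> (h t + e) * \<bar>u - v\<bar>"
  shows "\<bar>F T - F 0\<bar> \<le> integral {0..T} h"
proof (rule field_le_epsilon)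
  fix e0 :: real assume e0: "e0 > 0"
  define e where "e = e0 / (2 * T + 1)"
  have e: "e > 0" using e0 T by (simp add: e_def)
  \<comment> \<open>One \<open>e\<close> covers the slack in the local Lipschitz constant, the other
    the variation of \<open>h\<close> near the point.\<close>
  define k where "k t = h t + 2 * e" for t
  have k: "continuous_on UNIV k" unfolding k_def by (intro continuous_intros h)
  have ki: "k integrable_on {u..v}" for u v
    by (rule integrable_continuous_interval) (rule continuous_on_subset[OF k], simp)
  have "\<bar>F T - F 0\<bar> \<le> integral {0..T} k"
    using T
  proof (induction rule: Bolzano)
    case (trans x y z)
    then show ?case using Henstock_Kurzweil_Integration.integral_combine[OF trans(3,4) ki] by linarith
  next
    case (local t)
    obtain r where r: "r > 0" "\<And>u v. \<bar>u - t\<bar> < r \<Longrightarrow> \<bar>v - t\<bar> < r \<Longrightarrow> \<bar>F u - F v\<bar> \<le> (h t + e) * \<bar>u - v\<bar>"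
      using loc[OF e, of t] by auto
    obtain d where d: "d > 0" "\<And>u. \<bar>u - t\<bar> < d \<Longrightarrow> \<bar>h u - h t\<bar> < e"
      using h e unfolding continuous_on_iff dist_real_def by (metis UNIV_I)
    show ?case
    proof (intro exI conjI allI impI)
      fix u v assume uv: "u \<le> t \<and> t \<le> v \<and> v - u < min r d"
      have "\<bar>F v - F u\<bar> \<le> (h t + e) * \<bar>v - u\<bar>" using r(2)[of v u] uv by simp
      also have "\<dots> = integral {u..v} (\<lambda>_. h t + e)" using uv by simp
      also have "\<dots> \<le> integral {u..v} k"
      proof (rule integral_le)
        fix x assume "x \<in> {u..v}"
        then have "\<bar>h x - h t\<bar> < e" using uv by (intro d(2)) auto
        then show "h t + e \<le> k x" by (simp add: k_def)
      qed (auto intro: ki)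
      finally show "\<bar>F v - F u\<bar> \<le> integral {u..v} k" .
    qed (use r d in simp)
  qed
  also have "\<dots> = integral {0..T} h + 2 * e * T"
    unfolding k_def using T
    by (subst integral_add) (auto intro: integrable_continuous_interval continuous_on_subset[OF h])
  also have "2 * e * T \<le> e0"
    using e0 T by (simp add: e_def field_simps)
  finally show "\<bar>F T - F 0\<bar> \<le> integral {0..T} h + e0" by simp
qed

theorem local_Lipschitz_upper_gradient:
  fixes f g :: "'a::metric_space \<Rightarrow> real"
  assumes g: "continuous_on UNIV g" "\<And>x. 0 \<le> g x"
    and loc: "\<And>x e. e > 0 \<Longrightarrow> \<exists>r>0. \<forall>y\<in>ball x r. \<forall>z\<in>ball x r. \<bar>f y - f z\<bar> \<le> (g x + e) * dist y z"
  shows "upper_gradient f (\<lambda>x. ennreal (g x))"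
  unfolding upper_gradient_def
proof (intro conjI allI impI)
  show "(\<lambda>x. ennreal (g x)) \<in> borel_measurable borel"
    using borel_measurable_continuous_onI[OF g(1)] by simp
next
  fix \<gamma> :: "real \<Rightarrow> 'a" and a b :: real
  assume rect: "rectifiable_curve \<gamma> a b"
  define T where "T = arclen \<gamma> a b"
  have T: "0 \<le> T" unfolding T_def by (rule arclen_nonneg[OF rect])
  \<comment> \<open>Clamping the parameter extends the 1-Lipschitz arc-length parametrization to the
    whole line, where endpoints need no special treatment.\<close>
  define c where "c t = arclength_param \<gamma> a b (max 0 (min T t))" for t
  have c1: "dist (c t) (c u) \<le> \<bar>t - u\<bar>" for t u
  proof -
    have le: "dist (c t) (c u) \<le> u - t" if "t \<le> u" for t u
    proof -
      have "dist (c t) (c u) \<le> max 0 (min T u) - max 0 (min T t)"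
        unfolding c_def using T that by (intro arclength_param_dist[OF rect]) (auto simp: T_def)
      also have "\<dots> \<le> u - t" using that T by (auto simp: max_def min_def)
      finally show ?thesis .
    qed
    show ?thesis using le[of t u] le[of u t] by (cases "t \<le> u") (auto simp: dist_commute)
  qed
  have cc: "continuous_on UNIV c"
    by (rule continuous_onI) (metis c1 dist_real_def less_imp_le order_trans)
  define h where "h t = g (c t)" for t
  have h: "continuous_on UNIV h"
    unfolding h_def by (rule continuous_on_compose2[OF g(1) cc]) auto
  have "\<bar>f (c T) - f (c 0)\<bar> \<le> integral {0..T} h"
  proof (rule local_Lipschitz_integral_bound[OF h T])
    fix t e :: real assume e: "e > 0"
    obtain r where r: "r > 0" "\<And>y z. y \<in> ball (c t) r \<Longrightarrow> z \<in> ball (c t) r \<Longrightarrow> \<bar>f y - f z\<bar> \<le> (g (c t) + e) * dist y z"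
      using loc[OF e, of "c t"] by blast
    show "\<exists>r>0. \<forall>u v. \<bar>u - t\<bar> < r \<and> \<bar>v - t\<bar> < r \<longrightarrow> \<bar>f (c u) - f (c v)\<bar> \<le> (h t + e) * \<bar>u - v\<bar>"
    proof (intro exI[of _ r] conjI allI impI)
      fix u v assume uv: "\<bar>u - t\<bar> < r \<and> \<bar>v - t\<bar> < r"
      have "c u \<in> ball (c t) r" "c v \<in> ball (c t) r"
        using uv c1[of t u] c1[of t v] by (auto simp: abs_minus_commute)
      then have "\<bar>f (c u) - f (c v)\<bar> \<le> (g (c t) + e) * dist (c u) (c v)" by (rule r(2))
      also have "\<dots> \<le> (g (c t) + e) * \<bar>u - v\<bar>" using g(2)[of "c t"] e by (intro mult_left_mono c1) auto
      finally show "\<bar>f (c u) - f (c v)\<bar> \<le> (h t + e) * \<bar>u - v\<bar>" by (simp add: h_def)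
    qed (rule r(1))
  qed
  moreover have "c T = \<gamma> b" "c 0 = \<gamma> a"
    using arclength_param_end[OF rect] arclength_param_0[OF rect] T by (simp_all add: c_def T_def)
  ultimately have 1: "\<bar>f (\<gamma> a) - f (\<gamma> b)\<bar> \<le> integral {0..T} h"
    by (simp add: abs_minus_commute)
  have "curve_integral (\<lambda>x. ennreal (g x)) \<gamma> a b = (\<integral>\<^sup>+t. ennreal (indicator {0..T} t * h t) \<partial>lborel)"
    unfolding curve_integral_def T_def[symmetric] arclen_def[OF rect, symmetric]
    by (intro nn_integral_cong) (auto simp: indicator_def h_def c_def)
  also have "\<dots> = ennreal (integral {0..T} h)"
  proof (rule nn_integral_has_integral_lebesgue)
    show "0 \<le> h x" for x by (simp add: h_def g)
    have "h integrable_on {0..T}"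
      by (rule integrable_continuous_interval) (rule continuous_on_subset[OF h], simp)
    then show "(h has_integral integral {0..T} h) {0..T}" by (rule integrable_integral)
  qed
  finally show "ennreal \<bar>f (\<gamma> a) - f (\<gamma> b)\<bar> \<le> curve_integral (\<lambda>x. ennreal (g x)) \<gamma> a b"
    using 1 by (simp add: ennreal_leI)
qed

section \<open>Doubling measures\<close>

text \<open>Zorn's lemma is applied to disjoint subfamilies with an extra invariant: a ball that
  meets the subfamily meets a member of at least half its radius. The factor 5 is then one radius of
  the member plus the diameter of the other ball.\<close>

lemma Vitali_5r_covering:
  fixes A :: "'a::metric_space set" and r :: "'a \<Rightarrow> real"
  assumes r: "\<And>x. x \<in> A \<Longrightarrow> 0 < r x" "\<And>x. x \<in> A \<Longrightarrow> r x \<le> R"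
  obtains C where "C \<subseteq> A" "\<And>x y. x \<in> C \<Longrightarrow> y \<in> C \<Longrightarrow> x \<noteq> y \<Longrightarrow> ball x (r x) \<inter> ball y (r y) = {}"
    "\<And>x. x \<in> A \<Longrightarrow> \<exists>y\<in>C. ball x (r x) \<subseteq> ball y (5 * r y)"
proof -
  define meets where "meets x y \<longleftrightarrow> ball x (r x) \<inter> ball y (r y) \<noteq> {}" for x y
  define \<Omega> where "\<Omega> = {C. C \<subseteq> A \<and> (\<forall>x\<in>C. \<forall>y\<in>C. x \<noteq> y \<longrightarrow> \<not> meets x y) \<and>
     (\<forall>x\<in>A. (\<exists>y\<in>C. meets x y) \<longrightarrow> (\<exists>y\<in>C. meets x y \<and> r x \<le> 2 * r y))}"
  have \<Omega>1: "C \<subseteq> A" and \<Omega>2: "\<And>x y. x \<in> C \<Longrightarrow> y \<in> C \<Longrightarrow> x \<noteq> y \<Longrightarrow> \<not> meets x y"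
    and \<Omega>3: "\<And>x. x \<in> A \<Longrightarrow> \<exists>y\<in>C. meets x y \<Longrightarrow> \<exists>y\<in>C. meets x y \<and> r x \<le> 2 * r y" if "C \<in> \<Omega>" for C
    using that unfolding \<Omega>_def by simp_all
  have \<Omega>I: "C \<in> \<Omega>" if "C \<subseteq> A" "\<And>x y. x \<in> C \<Longrightarrow> y \<in> C \<Longrightarrow> x \<noteq> y \<Longrightarrow> \<not> meets x y"
    "\<And>x. x \<in> A \<Longrightarrow> \<exists>y\<in>C. meets x y \<Longrightarrow> \<exists>y\<in>C. meets x y \<and> r x \<le> 2 * r y" for C
    using that unfolding \<Omega>_def by simp
  have "\<exists>C\<in>\<Omega>. \<forall>X\<in>\<Omega>. C \<subseteq> X \<longrightarrow> X = C"
  proof (rule subset_Zorn_nonempty)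
    show "\<Omega> \<noteq> {}" by (auto simp: \<Omega>_def intro: exI[of _ "{}"])
  next
    fix \<C> assume ch: "\<C> \<noteq> {}" "subset.chain \<Omega> \<C>"
    then have sub: "\<C> \<subseteq> \<Omega>" and lin: "\<And>X Y. X \<in> \<C> \<Longrightarrow> Y \<in> \<C> \<Longrightarrow> X \<subseteq> Y \<or> Y \<subseteq> X"
      by (auto simp: subset_chain_def)
    have "\<not> meets x y" if xy: "x \<in> \<Union>\<C>" "y \<in> \<Union>\<C>" "x \<noteq> y" for x y
    proof -
      obtain X Y where X: "X \<in> \<C>" "x \<in> X" and Y: "Y \<in> \<C>" "y \<in> Y" using xy by blast
      then obtain Z where "Z \<in> \<C>" "x \<in> Z" "y \<in> Z" using lin[OF X(1) Y(1)] by blast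
      then show ?thesis using \<Omega>2[of Z x y] sub xy(3) by blast
    qed
    moreover have "\<Union>\<C> \<subseteq> A" using sub \<Omega>1 by blast
    moreover have "\<exists>y\<in>\<Union>\<C>. meets x y \<and> r x \<le> 2 * r y" if x: "x \<in> A" "\<exists>y\<in>\<Union>\<C>. meets x y" for x
    proof -
      obtain y Y where Y: "Y \<in> \<C>" "y \<in> Y" "meets x y" using x(2) by blast
      then have "\<exists>y\<in>Y. meets x y \<and> r x \<le> 2 * r y" using \<Omega>3[of Y x] sub x(1) by blast
      then show ?thesis using Y(1) by blast
    qed
    ultimately show "\<Union>\<C> \<in> \<Omega>" by (intro \<Omega>I)
  qed
  then obtain C where C: "C \<in> \<Omega>" and max: "\<And>X. X \<in> \<Omega> \<Longrightarrow> C \<subseteq> X \<Longrightarrow> X = C" by blast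
  have CA: "C \<subseteq> A" and disj: "\<And>x y. x \<in> C \<Longrightarrow> y \<in> C \<Longrightarrow> x \<noteq> y \<Longrightarrow> \<not> meets x y"
    and big: "\<And>x. x \<in> A \<Longrightarrow> \<exists>y\<in>C. meets x y \<Longrightarrow> \<exists>y\<in>C. meets x y \<and> r x \<le> 2 * r y"
    using \<Omega>1[OF C] \<Omega>2[OF C] \<Omega>3[OF C] by blast+
  have sym: "meets x y \<Longrightarrow> meets y x" for x y by (auto simp: meets_def)
  have self: "meets x x" if "x \<in> A" for x
    using centre_in_ball[of x "r x"] r(1)[OF that] unfolding meets_def by blast
  have meet: "\<exists>y\<in>C. meets x y" if x: "x \<in> A" for x
  proof (rule ccontr)
    assume no: "\<not> ?thesis"
    \<comment> \<open>Among the balls meeting no chosen one, a ball with radius above half the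
      supremum can be added without breaking the invariant, which contradicts maximality.\<close>
    define N where "N = {x \<in> A. \<forall>y\<in>C. \<not> meets x y}"
    have xN: "x \<in> N" using no x by (simp add: N_def)
    have bdd: "bdd_above (r ` N)" using r(2) by (auto simp: N_def bdd_above_def)
    define S where "S = Sup (r ` N)"
    have leS: "r y \<le> S" if "y \<in> N" for y unfolding S_def using bdd that by (simp add: cSup_upper)
    have "S > 0" using leS[OF xN] r(1)[OF x] by linarith
    then have "S / 2 < S" by simp
    then obtain z where z: "z \<in> N" "S / 2 < r z"
      unfolding S_def using less_cSupD[of "r ` N"] xN by blast
    have "insert z C \<in> \<Omega>"
    proof -
      have "\<not> meets x y" if "x \<in> insert z C" "y \<in> insert z C" "x \<noteq> y" for x y
        using that disj z(1) sym unfolding N_def by blast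
      moreover have "\<exists>y\<in>insert z C. meets x y \<and> r x \<le> 2 * r y" if w: "x \<in> A" "\<exists>y\<in>insert z C. meets x y" for x
      proof (cases "\<exists>y\<in>C. meets x y")
        case True
        then show ?thesis using big[OF w(1)] by blast
      next
        case False
        then have "x \<in> N" "meets x z" using w by (auto simp: N_def)
        then show ?thesis using leS[of x] z(2) by force
      qed
      moreover have "insert z C \<subseteq> A" using CA z(1) by (simp add: N_def)
      ultimately show ?thesis by (intro \<Omega>I)
    qed
    then have "z \<in> C" using max[of "insert z C"] by blast
    then show False using z(1) self[of z] unfolding N_def by blast
  qed
  have "\<exists>y\<in>C. ball x (r x) \<subseteq> ball y (5 * r y)" if x: "x \<in> A" for x
  proof -
    obtain y where y: "y \<in> C" "meets x y" "r x \<le> 2 * r y" using big[OF x meet[OF x]] by blast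
    obtain q where q: "dist x q < r x" "dist y q < r y" using y(2) by (auto simp: meets_def)
    have "dist y w < 5 * r y" if "dist x w < r x" for w
    proof -
      have "dist y w \<le> dist y q + dist q x + dist x w"
        using dist_triangle[of y w x] dist_triangle[of y x q] by linarith
      then show ?thesis using q that y(3) by (simp add: dist_commute)
    qed
    then have "ball x (r x) \<subseteq> ball y (5 * r y)" by (simp add: subset_iff)
    then show ?thesis using y(1) by blast
  qed
  then show ?thesis using that[of C] CA disj unfolding meets_def by blast
qed

section \<open>Density points and mean oscillation for doubling measures\<close>

locale doubling_measure =
  fixes M :: "'a::metric_space measure" and C :: real
  assumes mms: "metric_measure_space M" and C: "C > 1"
    and doubling: "\<And>x r. r > 0 \<Longrightarrow> emeasure M (ball x (2 * r)) \<le> ennreal C * emeasure M (ball x r)"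
begin

lemma space_UNIV [simp]: "space M = UNIV"
  using mms by (auto simp: metric_measure_space_def radon_measure_def)

lemma borel_sets: "A \<in> sets borel \<Longrightarrow> A \<in> sets M"
  using mms by (auto simp: metric_measure_space_def radon_measure_def)

lemma open_sets: "open A \<Longrightarrow> A \<in> sets M"
  by (simp add: borel_sets)

lemma borel_measurable_M: "f \<in> borel_measurable borel \<Longrightarrow> f \<in> borel_measurable M"
  by (rule measurableI) (auto intro!: borel_sets simp: measurable_sets_borel)

lemma ball_sets [simp]: "ball x r \<in> sets M"
  by (simp add: open_sets)

lemma ball_finite: "emeasure M (ball x r) < \<infinity>"
  using mms by (cases "r > 0") (auto simp: metric_measure_space_def ball_empty)

lemma ball_pos: "r > 0 \<Longrightarrow> emeasure M (ball x r) > 0"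
  using mms by (auto simp: metric_measure_space_def)

lemma ball_fmeasurable [simp]: "ball x r \<in> fmeasurable M"
  using ball_finite by (simp add: fmeasurableI)

lemma measure_ball_pos: "r > 0 \<Longrightarrow> measure M (ball x r) > 0"
  using ball_pos[of r x] ball_finite[of x r] by (simp add: measure_def enn2real_positive_iff)

lemma doubling_power: "r > 0 \<Longrightarrow> emeasure M (ball x (2 ^ N * r)) \<le> ennreal (C ^ N) * emeasure M (ball x r)"
proof (induction N)
  case (Suc N)
  have "emeasure M (ball x (2 ^ Suc N * r)) \<le> ennreal C * emeasure M (ball x (2 ^ N * r))"
    using doubling[of "2 ^ N * r" x] Suc(2) by (simp add: mult.assoc)
  also have "\<dots> \<le> ennreal C * (ennreal (C ^ N) * emeasure M (ball x r))"
    by (intro mult_left_mono Suc) auto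
  also have "\<dots> = ennreal (C ^ Suc N) * emeasure M (ball x r)"
    using C by (simp add: ennreal_mult mult.assoc)
  finally show ?case .
qed simp

lemma outer_regular:
  assumes "A \<in> sets M" "emeasure M A < \<infinity>" "\<eta> > 0"
  obtains V where "open V" "A \<subseteq> V" "emeasure M (V - A) \<le> ennreal \<eta>" "emeasure M V < \<infinity>"
proof -
  define c where "c = emeasure M A + ennreal \<eta>"
  have eq: "emeasure M A = (INF V\<in>{V. open V \<and> A \<subseteq> V}. emeasure M V)"
    using mms assms(1) by (auto simp: metric_measure_space_def radon_measure_def)
  have "emeasure M A < c"
    using assms(2,3) by (cases "emeasure M A") (auto simp: c_def ennreal_less_iff simp flip: ennreal_plus)
  then have "(INF V\<in>{V. open V \<and> A \<subseteq> V}. emeasure M V) < c" unfolding eq .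
  then obtain V where V: "open V" "A \<subseteq> V" "emeasure M V < c"
    by (auto simp: INF_less_iff)
  have fin: "emeasure M V < \<infinity>" using less_le_trans[OF V(3) top_greatest] by simp
  have "emeasure M (V - A) = emeasure M V - emeasure M A"
    using assms V(1,2) by (intro emeasure_Diff) (auto simp: open_sets)
  also have "\<dots> \<le> ennreal \<eta>" using less_imp_le[OF V(3)] fin by (auto simp: c_def ennreal_minus_le_iff)
  finally show ?thesis using that V fin by blast
qed

text \<open>Disjoint balls with a proportion \<open>c\<close> outside \<open>A\<close> share the
  small measure of \<open>V - A\<close>, and their enlargements cover \<open>B\<close>. The cover
  \<open>W\<close> is produced because \<open>B\<close> itself is not known to be
  measurable.\<close>

lemma thin_points_small_cover:
  assumes A: "A \<in> sets M" "emeasure M A < \<infinity>" and c: "c > 0" and \<eta>: "\<eta> > 0"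
    and B: "B \<subseteq> A" "\<And>x \<rho>. x \<in> B \<Longrightarrow> \<rho> > 0 \<Longrightarrow> \<exists>r>0. r < \<rho> \<and> ennreal c * emeasure M (ball x r) \<le> emeasure M (ball x r - A)"
  obtains W where "W \<in> sets M" "B \<subseteq> W" "emeasure M W \<le> ennreal \<eta>"
proof -
  \<comment> \<open>Enlarging a ball 5 times stays within 3 doublings, at a cost of
    \<open>C ^ 3\<close>; passing from a ball to its part outside \<open>A\<close> costs
    \<open>1 / c\<close>.\<close>
  define \<eta>' where "\<eta>' = \<eta> * c / C ^ 3"
  have \<eta>': "\<eta>' > 0" using \<eta> c C by (simp add: \<eta>'_def)
  obtain V where V: "open V" "A \<subseteq> V" "emeasure M (V - A) \<le> ennreal \<eta>'" "emeasure M V < \<infinity>"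
    using outer_regular[OF A \<eta>'] by blast
  have "\<exists>r. 0 < r \<and> r \<le> 1 \<and> ball x r \<subseteq> V \<and> ennreal c * emeasure M (ball x r) \<le> emeasure M (ball x r - A)" if "x \<in> B" for x
  proof -
    obtain \<rho> where \<rho>: "\<rho> > 0" "ball x \<rho> \<subseteq> V" using V(1,2) B(1) \<open>x \<in> B\<close> by (meson open_contains_ball subsetD)
    then obtain r where r: "r > 0" "r < min \<rho> 1" "ennreal c * emeasure M (ball x r) \<le> emeasure M (ball x r - A)"
      using B(2)[OF \<open>x \<in> B\<close>, of "min \<rho> 1"] by auto
    have "ball x r \<subseteq> V" using subset_ball[of r \<rho> x] r(2) \<rho>(2) by auto
    then show ?thesis using r by (intro exI[of _ r]) auto
  qed
  then obtain r where r: "\<And>x. x \<in> B \<Longrightarrow> 0 < r x" "\<And>x. x \<in> B \<Longrightarrow> r x \<le> 1" "\<And>x. x \<in> B \<Longrightarrow> ball x (r x) \<subseteq> V"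
    "\<And>x. x \<in> B \<Longrightarrow> ennreal c * emeasure M (ball x (r x)) \<le> emeasure M (ball x (r x) - A)"
    by metis
  obtain D where D: "D \<subseteq> B" and disj: "\<And>x y. x \<in> D \<Longrightarrow> y \<in> D \<Longrightarrow> x \<noteq> y \<Longrightarrow> ball x (r x) \<inter> ball y (r y) = {}"
    and cover: "\<And>x. x \<in> B \<Longrightarrow> \<exists>y\<in>D. ball x (r x) \<subseteq> ball y (5 * r y)"
    using Vitali_5r_covering[of B r 1] r(1,2) by metis
  \<comment> \<open>No separability is assumed: \<open>D\<close> is countable because its disjoint
    balls have positive measure inside the set \<open>V\<close> of finite measure.\<close>
  have "countable D"
  proof -
    have Vf: "V \<in> fmeasurable M" using V by (simp add: fmeasurableI open_sets)
    have "(\<lambda>x. measure M (ball x (r x))) summable_on D"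
    proof (rule nonneg_bdd_above_summable_on)
      show "bdd_above (sum (\<lambda>x. measure M (ball x (r x))) ` {F. F \<subseteq> D \<and> finite F})"
      proof (rule bdd_aboveI2)
        fix F assume F: "F \<in> {F. F \<subseteq> D \<and> finite F}"
        have "(\<Sum>x\<in>F. measure M (ball x (r x))) = measure M (\<Union>x\<in>F. ball x (r x))"
          using F disj by (intro measure_UNION'[symmetric]) (auto simp: pairwise_def disjnt_def)
        also have "\<dots> \<le> measure M V"
          using F D r(3) by (intro measure_mono_fmeasurable[OF _ _ Vf] sets.finite_UN) auto
        finally show "(\<Sum>x\<in>F. measure M (ball x (r x))) \<le> measure M V" .
      qed
    qed simp
    then have "countable {x \<in> D. measure M (ball x (r x)) \<noteq> 0}" by (rule summable_countable_real)
    also have "{x \<in> D. measure M (ball x (r x)) \<noteq> 0} = D"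
    proof -
      have "measure M (ball x (r x)) \<noteq> 0" if "x \<in> D" for x
        using measure_ball_pos[OF r(1), of x x] that D by auto
      then show ?thesis by blast
    qed
    finally show ?thesis .
  qed
  define I where "I = to_nat_on D ` D"
  define g where "g = from_nat_into D"
  have gI: "g n \<in> D" if "n \<in> I" for n using that \<open>countable D\<close> by (auto simp: g_def I_def)
  have ginj: "g n \<noteq> g m" if "n \<in> I" "m \<in> I" "n \<noteq> m" for n m
    using that \<open>countable D\<close> by (auto simp: g_def I_def)
  have gsurj: "\<exists>n\<in>I. g n = x" if "x \<in> D" for x
    using that \<open>countable D\<close> by (auto simp: g_def I_def)
  define X where "X n = (if n \<in> I then ball (g n) (5 * r (g n)) else {})" for n
  define Y where "Y n = (if n \<in> I then ball (g n) (r (g n)) - A else {})" for n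
  have meas: "range X \<subseteq> sets M" "range Y \<subseteq> sets M" using A(1) by (auto simp: X_def Y_def)
  have XY: "emeasure M (X n) \<le> ennreal (C ^ 3 / c) * emeasure M (Y n)" for n
  proof (cases "n \<in> I")
    case True
    define x where "x = g n"
    have x: "x \<in> B" using gI[OF True] D x_def by blast
    have "emeasure M (ball x (5 * r x)) \<le> emeasure M (ball x (2 ^ 3 * r x))"
      using r(1)[OF x] by (intro emeasure_mono subset_ball) auto
    also have "\<dots> \<le> ennreal (C ^ 3) * emeasure M (ball x (r x))"
      by (rule doubling_power[OF r(1)[OF x]])
    also have "\<dots> = ennreal (C ^ 3 / c) * (ennreal c * emeasure M (ball x (r x)))"
      using c C by (simp add: mult.assoc[symmetric] flip: ennreal_mult)
    also have "\<dots> \<le> ennreal (C ^ 3 / c) * emeasure M (ball x (r x) - A)"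
      by (intro mult_left_mono r(4)[OF x]) simp
    finally show ?thesis using True by (simp add: X_def Y_def x_def)
  qed (simp add: X_def Y_def)
  have "emeasure M (\<Union>n. X n) \<le> (\<Sum>n. emeasure M (X n))"
    by (rule emeasure_subadditive_countably[OF meas(1)])
  also have "\<dots> \<le> (\<Sum>n. ennreal (C ^ 3 / c) * emeasure M (Y n))"
    by (intro suminf_le XY) auto
  also have "\<dots> = ennreal (C ^ 3 / c) * (\<Sum>n. emeasure M (Y n))" by simp
  also have "(\<Sum>n. emeasure M (Y n)) = emeasure M (\<Union>n. Y n)"
  proof (rule suminf_emeasure[OF meas(2)])
    show "disjoint_family Y"
      unfolding disjoint_family_on_def
    proof (intro ballI impI)
      fix m n :: nat assume "m \<noteq> n"
      then have "ball (g m) (r (g m)) \<inter> ball (g n) (r (g n)) = {}" if "m \<in> I" "n \<in> I"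
        using disj[OF gI gI ginj] that by blast
      then show "Y m \<inter> Y n = {}" by (auto simp: Y_def)
    qed
  qed
  also have "emeasure M (\<Union>n. Y n) \<le> emeasure M (V - A)"
  proof (rule emeasure_mono)
    have "Y n \<subseteq> V - A" for n using r(3)[of "g n"] gI[of n] D by (auto simp: Y_def)
    then show "(\<Union>n. Y n) \<subseteq> V - A" by blast
  qed (use V A in \<open>auto simp: open_sets\<close>)
  also note V(3)
  also have "ennreal (C ^ 3 / c) * ennreal \<eta>' = ennreal \<eta>"
    using c C \<eta> by (simp add: \<eta>'_def flip: ennreal_mult)
  finally have "emeasure M (\<Union>n. X n) \<le> ennreal \<eta>" by (simp add: mult_left_mono)
  moreover have "B \<subseteq> (\<Union>n. X n)"
  proof
    fix x assume x: "x \<in> B"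
    then obtain y where y: "y \<in> D" "ball x (r x) \<subseteq> ball y (5 * r y)" using cover by blast
    obtain n where "n \<in> I" "g n = y" using gsurj[OF y(1)] by blast
    moreover have "x \<in> ball y (5 * r y)" using y(2) r(1)[OF x] centre_in_ball[of x "r x"] by blast
    ultimately show "x \<in> (\<Union>n. X n)" by (auto simp: X_def)
  qed
  moreover have "(\<Union>n. X n) \<in> sets M" using meas(1) by blast
  ultimately show ?thesis using that by blast
qed

text \<open>For each threshold \<open>1 / Suc m\<close> the exceptional points have covers of
  arbitrarily small measure, hence lie in a null set; countably many thresholds suffice.\<close>

theorem AE_density_point:
  assumes A: "A \<in> sets M" "emeasure M A < \<infinity>"
  shows "AE x in M. x \<in> A \<longrightarrow> (\<forall>c>0. \<exists>\<rho>>0. \<forall>r. 0 < r \<and> r < \<rho> \<longrightarrow> emeasure M (ball x r - A) \<le> ennreal c * emeasure M (ball x r))"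
proof -
  define B where "B c = {x \<in> A. \<forall>\<rho>>0. \<exists>r>0. r < \<rho> \<and> ennreal c * emeasure M (ball x r) < emeasure M (ball x r - A)}" for c
  have "AE x in M. x \<notin> B (1 / Suc m)" for m
  proof -
    have "\<exists>W. W \<in> sets M \<and> B (1 / Suc m) \<subseteq> W \<and> emeasure M W \<le> ennreal (1 / Suc k)" for k
    proof (rule thin_points_small_cover[OF A, of "1 / Suc m" "1 / Suc k" "B (1 / Suc m)"])
      show "B (1 / Suc m) \<subseteq> A" by (auto simp: B_def)
      show "\<exists>r>0. r < \<rho> \<and> ennreal (1 / Suc m) * emeasure M (ball x r) \<le> emeasure M (ball x r - A)"
        if "x \<in> B (1 / Suc m)" "\<rho> > 0" for x \<rho>
        using that unfolding B_def by (blast intro: less_imp_le)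
    qed auto
    then obtain W where W: "\<And>k. W k \<in> sets M" "\<And>k. B (1 / Suc m) \<subseteq> W k" "\<And>k. emeasure M (W k) \<le> ennreal (1 / Suc k)"
      by metis
    have "emeasure M (\<Inter>k. W k) \<le> ennreal e" if "e > 0" for e
    proof -
      obtain k where "1 / Suc k < e" using nat_approx_posE[OF \<open>e > 0\<close>] by (metis of_nat_Suc)
      then have "ennreal (1 / Suc k) \<le> ennreal e" by (intro ennreal_leI) simp
      moreover have "emeasure M (\<Inter>k. W k) \<le> emeasure M (W k)" using W(1) by (intro emeasure_mono) auto
      ultimately show ?thesis using W(3)[of k] by (meson order_trans)
    qed
    then have "emeasure M (\<Inter>k. W k) = 0"
      by (metis ennreal_le_epsilon add_0 le_zero_eq)
    then have "(\<Inter>k. W k) \<in> null_sets M" using W(1) by (auto intro: sets.countable_INT)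
    then have "AE x in M. x \<notin> (\<Inter>k. W k)" by (rule AE_not_in)
    then show ?thesis by eventually_elim (use W(2) in blast)
  qed
  then have "AE x in M. \<forall>m. x \<notin> B (1 / Suc m)" by (simp add: AE_all_countable)
  then show ?thesis
  proof eventually_elim
    fix x assume x: "\<forall>m. x \<notin> B (1 / Suc m)"
    show "x \<in> A \<longrightarrow> (\<forall>c>0. \<exists>\<rho>>0. \<forall>r. 0 < r \<and> r < \<rho> \<longrightarrow> emeasure M (ball x r - A) \<le> ennreal c * emeasure M (ball x r))"
    proof (intro impI allI)
      fix c :: real assume "x \<in> A" "c > 0"
      obtain m where m: "1 / Suc m < c" using nat_approx_posE[OF \<open>c > 0\<close>] by (metis of_nat_Suc)
      obtain \<rho> where \<rho>: "\<rho> > 0" "\<And>r. 0 < r \<Longrightarrow> r < \<rho> \<Longrightarrow> emeasure M (ball x r - A) \<le> ennreal (1 / Suc m) * emeasure M (ball x r)"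
      proof -
        have "\<exists>\<rho>>0. \<forall>r. 0 < r \<and> r < \<rho> \<longrightarrow> emeasure M (ball x r - A) \<le> ennreal (1 / Suc m) * emeasure M (ball x r)"
          using spec[OF x, of m] \<open>x \<in> A\<close> unfolding B_def mem_Collect_eq by (meson not_le)
        then show ?thesis using that by blast
      qed
      have "emeasure M (ball x r - A) \<le> ennreal c * emeasure M (ball x r)" if "0 < r" "r < \<rho>" for r
        by (rule order_trans[OF \<rho>(2)[OF that]]) (use m in \<open>auto intro!: mult_right_mono ennreal_leI\<close>)
      then show "\<exists>\<rho>>0. \<forall>r. 0 < r \<and> r < \<rho> \<longrightarrow> emeasure M (ball x r - A) \<le> ennreal c * emeasure M (ball x r)"
        using \<rho>(1) by blast
    qed
  qed
qed

text \<open>A large increment between \<open>x\<close> and \<open>y\<close> makes \<open>u\<close>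
  differ from \<open>m\<close> at one of the two points. The Lipschitz bound spreads this over a
  ball of comparable radius, which by doubling is a fixed proportion of the ball about
  \<open>x\<close>, so the mean oscillation cannot be small.\<close>

lemma small_oscillation_imp_small_increments:
  fixes u :: "'a \<Rightarrow> real"
  assumes L: "L > 0" "\<And>y z. \<bar>u y - u z\<bar> \<le> L * dist y z"
    and osc: "\<And>\<kappa>. \<kappa> > 0 \<Longrightarrow> \<exists>\<rho>>0. \<forall>r. 0 < r \<and> r < \<rho> \<longrightarrow>
       (\<exists>m. (\<integral>\<^sup>+y\<in>ball x r. ennreal \<bar>u y - m\<bar> \<partial>M) \<le> ennreal (\<kappa> * r) * emeasure M (ball x r))"
    and e: "e > 0"
  shows "\<exists>\<rho>>0. \<forall>y. dist y x < \<rho> \<longrightarrow> \<bar>u y - u x\<bar> \<le> e * dist y x"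
proof -
  \<comment> \<open>Within \<open>\<theta> * s\<close> of the bad point \<open>u\<close> changes by
    at most \<open>e * s / 4\<close>, half of the deviation there; \<open>\<theta> \<le> 1/2\<close>
    keeps the small ball inside \<open>ball x (2 * s)\<close>.\<close>
  define \<theta> where "\<theta> = min (1/2) (e / (4 * L))"
  have \<theta>: "\<theta> > 0" "\<theta> \<le> 1/2" "L * \<theta> \<le> e / 4"
    using e L(1) by (auto simp: \<theta>_def min_def field_simps)
  obtain N :: nat where N: "4 / \<theta> < 2 ^ N" using real_arch_pow[of 2 "4 / \<theta>"] by auto
  \<comment> \<open>On a ball of radius \<open>2 * s\<close>, after \<open>N\<close> doublings, the
    allowed integral is \<open>e * s / 8\<close> times the measure of the small ball, half of the
    lower bound \<open>e * s / 4\<close>.\<close>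
  define \<kappa> where "\<kappa> = e / (16 * C ^ N)"
  have CN: "C ^ N > 0" using C by simp
  have \<kappa>: "\<kappa> > 0" using e CN by (simp add: \<kappa>_def)
  obtain \<rho> where \<rho>: "\<rho> > 0" "\<And>r. 0 < r \<Longrightarrow> r < \<rho> \<Longrightarrow>
       (\<exists>m. (\<integral>\<^sup>+y\<in>ball x r. ennreal \<bar>u y - m\<bar> \<partial>M) \<le> ennreal (\<kappa> * r) * emeasure M (ball x r))"
    using osc[OF \<kappa>] by blast
  show ?thesis
  proof (intro exI[of _ "\<rho> / 2"] conjI allI impI)
    fix y assume y: "dist y x < \<rho> / 2"
    define s where "s = dist y x"
    show "\<bar>u y - u x\<bar> \<le> e * dist y x"
    proof (rule ccontr)
      assume "\<not> ?thesis"
      then have big: "e * s < \<bar>u y - u x\<bar>" by (simp add: s_def)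
      have s: "s > 0" using big L(2)[of y x] by (cases "s = 0") (auto simp: s_def)
      obtain m where m: "(\<integral>\<^sup>+w\<in>ball x (2 * s). ennreal \<bar>u w - m\<bar> \<partial>M) \<le> ennreal (\<kappa> * (2 * s)) * emeasure M (ball x (2 * s))"
        using \<rho>(2)[of "2 * s"] s y by (auto simp: s_def)
      obtain z where z: "e * s / 2 \<le> \<bar>u z - m\<bar>" "dist z x \<le> s"
      proof (cases "e * s / 2 \<le> \<bar>u x - m\<bar>")
        case True
        then show ?thesis using that[of x] s by simp
      next
        case False
        then have "e * s / 2 \<le> \<bar>u y - m\<bar>" using big by linarith
        then show ?thesis using that[of y] by (simp add: s_def)
      qed
      let ?b = "ball z (\<theta> * s)"
      have sub: "?b \<subseteq> ball x (2 * s)"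
      proof
        fix w assume "w \<in> ?b"
        then have "dist z w < \<theta> * s" by simp
        also have "\<dots> \<le> 1/2 * s" using \<theta> s by (intro mult_right_mono) auto
        finally have "dist z w < 1/2 * s" .
        then show "w \<in> ball x (2 * s)" using z(2) dist_triangle[of x w z] s by (simp add: dist_commute)
      qed
      have low: "e * s / 4 \<le> \<bar>u w - m\<bar>" if "w \<in> ?b" for w
      proof -
        have "\<bar>u z - u w\<bar> \<le> L * (\<theta> * s)"
          using L(2)[of z w] that L(1) by (smt (verit) mem_ball mult_left_mono)
        also have "\<dots> \<le> e * s / 4" using mult_right_mono[OF \<theta>(3), of s] s by (simp add: mult_ac)
        finally have "\<bar>u z - u w\<bar> \<le> e * s / 4" .
        moreover have "\<bar>u z - m\<bar> \<le> \<bar>u z - u w\<bar> + \<bar>u w - m\<bar>" by simp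
        ultimately show ?thesis using z(1) by linarith
      qed
      have "ennreal (e * s / 4) * emeasure M ?b = (\<integral>\<^sup>+w\<in>?b. ennreal (e * s / 4) \<partial>M)"
        by (simp add: nn_integral_cmult_indicator)
      also have "\<dots> \<le> (\<integral>\<^sup>+w\<in>ball x (2 * s). ennreal \<bar>u w - m\<bar> \<partial>M)"
        using sub low by (intro nn_integral_mono) (auto simp: indicator_def intro!: ennreal_leI)
      also note m
      also have "emeasure M (ball x (2 * s)) \<le> ennreal (C ^ N) * emeasure M ?b"
      proof -
        have "4 * s \<le> 2 ^ N * (\<theta> * s)"
          using N \<theta>(1) s by (simp add: field_simps)
        have "ball x (2 * s) \<subseteq> ball z (2 ^ N * (\<theta> * s))"
        proof
          fix w assume "w \<in> ball x (2 * s)"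
          then have "dist z w < 4 * s" using z(2) dist_triangle[of z w x] s by (simp add: dist_commute)
          then show "w \<in> ball z (2 ^ N * (\<theta> * s))" using \<open>4 * s \<le> _\<close> by simp
        qed
        then have "emeasure M (ball x (2 * s)) \<le> emeasure M (ball z (2 ^ N * (\<theta> * s)))"
          by (intro emeasure_mono) auto
        also have "\<dots> \<le> ennreal (C ^ N) * emeasure M ?b"
          using \<theta> s by (intro doubling_power) simp
        finally show ?thesis .
      qed
      also have "ennreal (\<kappa> * (2 * s)) * (ennreal (C ^ N) * emeasure M ?b) = ennreal (e * s / 8) * emeasure M ?b"
        using C CN s e by (simp add: \<kappa>_def mult.assoc[symmetric] flip: ennreal_mult)
      finally have le: "ennreal (e * s / 4) * emeasure M ?b \<le> ennreal (e * s / 8) * emeasure M ?b"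
        by (simp add: mult_left_mono)
      have bm: "emeasure M ?b = ennreal (measure M ?b)" "measure M ?b > 0"
        using measure_ball_pos[of "\<theta> * s" z] \<theta> s by (simp_all add: emeasure_eq_measure2)
      have "e * s / 4 * measure M ?b \<le> e * s / 8 * measure M ?b"
        using le bm e s by (simp flip: ennreal_mult)
      then show False using bm(2) e s by (simp add: mult_le_cancel_right)
    qed
  qed (use \<rho> in simp)
qed

end

section \<open>Selecting a convergent sequence by convexity\<close>

lemma parallelogram_midpoint:
  fixes a b :: "'a::real_inner"
  shows "(norm (a - b))\<^sup>2 = 2 * (norm a)\<^sup>2 + 2 * (norm b)\<^sup>2 - 4 * (norm ((1/2) *\<^sub>R (a + b)))\<^sup>2"
  by (simp add: power2_norm_eq_inner inner_add_left inner_add_right inner_diff_left inner_diff_right inner_commute field_simps)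

text \<open>
  By the parallelogram law, nearly minimal elements of a decreasing sequence of convex sets in
  \<open>L\<^sup>2\<close> form a Cauchy sequence; this takes the place of weak compactness and Mazur's lemma.
\<close>

lemma (in finite_measure) Cauchy_selection:
  fixes G :: "nat \<Rightarrow> ('a \<Rightarrow> 'b::euclidean_space) set"
  assumes ne: "\<And>k. G k \<noteq> {}" and dec: "\<And>k l. k \<le> l \<Longrightarrow> G l \<subseteq> G k"
    and meas: "\<And>k f. f \<in> G k \<Longrightarrow> f \<in> borel_measurable M"
    and bd: "\<And>k f x. f \<in> G k \<Longrightarrow> norm (f x) \<le> c"
    and mid: "\<And>k f g. f \<in> G k \<Longrightarrow> g \<in> G k \<Longrightarrow> (\<lambda>x. (1/2) *\<^sub>R (f x + g x)) \<in> G k"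
  obtains E where "\<And>j. E j \<in> G j" "\<And>j. (\<integral>x. (norm (E j x - E (Suc j) x))\<^sup>2 \<partial>M) \<le> (1/16) ^ j"
proof -
  define Q where "Q f = (\<integral>x. (norm (f x))\<^sup>2 \<partial>M)" for f :: "'a \<Rightarrow> 'b"
  have int: "integrable M (\<lambda>x. (norm (f x))\<^sup>2)" if "f \<in> G k" for f k
  proof (rule integrable_const_bound[where B="c\<^sup>2"])
    show "(\<lambda>x. (norm (f x))\<^sup>2) \<in> borel_measurable M" using meas[OF that] by measurable
    have "(norm (f x))\<^sup>2 \<le> c\<^sup>2" for x using bd[OF that] by (intro power_mono) auto
    then show "AE x in M. norm ((norm (f x))\<^sup>2) \<le> c\<^sup>2" by simp
  qed
  have Q0: "0 \<le> Q f" for f unfolding Q_def by simp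
  have Qle: "Q f \<le> c\<^sup>2 * measure M (space M)" if "f \<in> G k" for f k
  proof -
    have "Q f \<le> (\<integral>x. c\<^sup>2 \<partial>M)"
      unfolding Q_def using bd[OF that] by (intro integral_mono int[OF that] power_mono) auto
    then show ?thesis by (simp add: mult.commute)
  qed
  define d where "d k = Inf (Q ` G k)" for k
  have bb: "bdd_below (Q ` G k)" for k using Q0 unfolding bdd_below_def by blast
  have dle: "d k \<le> Q f" if "f \<in> G k" for f k unfolding d_def using bb that by (simp add: cInf_lower)
  have dmono: "d k \<le> d l" if "k \<le> l" for k l
    unfolding d_def using dec[OF that] ne bb by (intro cInf_superset_mono) auto
  have dub: "d k \<le> c\<^sup>2 * measure M (space M)" for k
    using ne[of k] dle[of _ k] Qle[of _ k] by (meson ex_in_conv order_trans)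
  have bdd: "bdd_above (range d)" using dub unfolding bdd_above_def by blast
  define D where "D = Sup (range d)"
  have dD: "d k \<le> D" for k unfolding D_def using bdd by (simp add: cSup_upper)
  \<comment> \<open>Six of these make \<open>(1/16) ^ j\<close>: near-minimality of the two
    functions contributes \<open>2 * s j\<close> each, and the remaining gap
    \<open>D - d (k j)\<close> another \<open>2 * s j\<close>.\<close>
  define s where "s j = (1/16 :: real) ^ j / 6" for j :: nat
  have s: "s j > 0" for j by (simp add: s_def)
  have ss: "s (Suc j) \<le> s j" for j by (simp add: s_def)
  have "\<exists>K. D - d K < s j" for j
  proof -
    have "D - s j < D" using s by simp
    then obtain K where "D - s j < d K" unfolding D_def using less_cSupD[of "range d"] by blast
    then show ?thesis by (intro exI[of _ K]) linarith
  qed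
  then obtain K where K: "\<And>j. D - d (K j) < s j" by metis
  \<comment> \<open>The partial sums make \<open>k\<close> monotone and at least \<open>K j\<close>;
    the summand \<open>j\<close> makes it at least \<open>j\<close>, so that \<open>E j\<close> also
    lies in \<open>G j\<close>.\<close>
  define k where "k j = j + (\<Sum>i\<le>j. K i)" for j
  have kK: "K j \<le> k j" for j unfolding k_def by (simp add: member_le_sum trans_le_add2)
  have kj: "j \<le> k j" and kS: "k j \<le> k (Suc j)" for j by (simp_all add: k_def)
  have "\<exists>f\<in>G (k j). Q f < d (k j) + s j" for j
  proof -
    have "d (k j) < d (k j) + s j" using s by simp
    then show ?thesis unfolding d_def using cInf_lessD[of "Q ` G (k j)"] ne by blast
  qed
  then obtain E where E: "\<And>j. E j \<in> G (k j)" "\<And>j. Q (E j) < d (k j) + s j" by metis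
  show ?thesis
  proof (rule that[of E])
    show "E j \<in> G j" for j using E(1) dec[OF kj] by blast
    fix j
    let ?f = "E j" and ?g = "E (Suc j)"
    have g: "?g \<in> G (k j)" using E(1) dec[OF kS] by blast
    let ?m = "\<lambda>x. (1/2) *\<^sub>R (?f x + ?g x)"
    have m: "?m \<in> G (k j)" using mid[OF E(1) g] .
    define qm where "qm = Q ?m"
    have dm: "d (k j) \<le> qm" unfolding qm_def by (rule dle[OF m])
    have "(\<integral>x. (norm (?f x - ?g x))\<^sup>2 \<partial>M) = 2 * Q ?f + 2 * Q ?g - 4 * qm"
      unfolding parallelogram_midpoint Q_def qm_def using int[OF E(1)[of j]] int[OF g] int[OF m] by simp
    also have "\<dots> \<le> 2 * (d (k j) + s j) + 2 * (d (k (Suc j)) + s (Suc j)) - 4 * d (k j)"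
      using E(2)[of j] E(2)[of "Suc j"] dm by argo
    also have "\<dots> \<le> 6 * s j"
      using K[of j] dmono[OF kK[of j]] dD[of "k (Suc j)"] ss[of j] by argo
    finally show "(\<integral>x. (norm (?f x - ?g x))\<^sup>2 \<partial>M) \<le> (1/16) ^ j" by (simp add: s_def)
  qed
qed

text \<open>Markov's inequality at threshold \<open>(1/4) ^ k\<close> for squares of integral at
  most \<open>(1/16) ^ k\<close> gives summable exceptional measures. By Borel-Cantelli almost every
  point lies in some \<open>T m\<close>, and countably many null sets cannot fill the space.\<close>

lemma (in finite_measure) fast_Cauchy_uniform:
  fixes E :: "nat \<Rightarrow> 'a \<Rightarrow> 'b::euclidean_space"
  assumes meas: "\<And>j. E j \<in> borel_measurable M"
    and bd: "\<And>j x. norm (E j x) \<le> c"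
    and E: "\<And>j. (\<integral>x. (norm (E j x - E (Suc j) x))\<^sup>2 \<partial>M) \<le> (1/16) ^ j"
    and pos: "emeasure M (space M) > 0"
  obtains m where "{x \<in> space M. \<forall>k\<ge>m. norm (E k x - E (Suc k) x) \<le> (1/2) ^ k} \<in> sets M"
    "emeasure M {x \<in> space M. \<forall>k\<ge>m. norm (E k x - E (Suc k) x) \<le> (1/2) ^ k} > 0"
proof -
  have [measurable]: "E j \<in> borel_measurable M" for j by (rule meas)
  define A where "A k = {x \<in> space M. (1/4) ^ k \<le> (norm (E k x - E (Suc k) x))\<^sup>2}" for k
  define T where "T m = {x \<in> space M. \<forall>k\<ge>m. norm (E k x - E (Suc k) x) \<le> (1/2) ^ k}" for m
  have A: "A k \<in> sets M" for k unfolding A_def by measurable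
  have T: "T m \<in> sets M" for m unfolding T_def by measurable
  have le: "measure M (A k) \<le> (1/4) ^ k" for k
  proof -
    have "integrable M (\<lambda>x. (norm (E k x - E (Suc k) x))\<^sup>2)"
    proof (rule integrable_const_bound[where B="(2 * c)\<^sup>2"])
      have "(norm (E k x - E (Suc k) x))\<^sup>2 \<le> (2 * c)\<^sup>2" for x
        using bd[of k x] bd[of "Suc k" x] norm_triangle_ineq4[of "E k x" "E (Suc k) x"]
        by (intro power_mono) auto
      then show "AE x in M. norm ((norm (E k x - E (Suc k) x))\<^sup>2) \<le> (2 * c)\<^sup>2" by simp
    qed measurable
    then have "measure M (A k) \<le> (\<integral>x. (norm (E k x - E (Suc k) x))\<^sup>2 \<partial>M) / (1/4) ^ k"
      unfolding A_def by (rule integral_Markov_inequality_measure[where A="{}"]) auto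
    also have "\<dots> \<le> (1/16) ^ k / (1/4) ^ k" by (intro divide_right_mono E) simp
    also have "\<dots> = (1/4) ^ k" by (simp flip: power_divide)
    finally show ?thesis .
  qed
  have "AE x in M. eventually (\<lambda>k. x \<in> space M - A k) sequentially"
  proof (rule borel_cantelli_AE1[OF A])
    show "summable (\<lambda>k. measure M (A k))"
      by (rule summable_comparison_test'[where g="\<lambda>k. (1/4) ^ k" and N=0]) (use le in auto)
  qed (simp add: emeasure_finite less_top[symmetric])
  then have ae: "AE x in M. \<exists>m. x \<in> T m"
  proof eventually_elim
    fix x assume "eventually (\<lambda>k. x \<in> space M - A k) sequentially"
    then obtain m where m: "\<And>k. k \<ge> m \<Longrightarrow> x \<in> space M - A k" by (auto simp: eventually_sequentially)
    have "norm (E k x - E (Suc k) x) \<le> (1/2) ^ k" if "k \<ge> m" for k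
    proof -
      have "(norm (E k x - E (Suc k) x))\<^sup>2 \<le> ((1/2) ^ k)\<^sup>2"
      proof -
        have "((1/2::real) ^ k)\<^sup>2 = (1/4) ^ k" by (simp add: power2_eq_square flip: power_mult_distrib)
        then show ?thesis using m[OF that] by (auto simp: A_def)
      qed
      then show ?thesis by (rule power2_le_imp_le) simp
    qed
    then show "\<exists>m. x \<in> T m" using m[of m] by (auto simp: T_def)
  qed
  have "\<exists>m. emeasure M (T m) > 0"
  proof (rule ccontr)
    assume "\<not> ?thesis"
    then have "T m \<in> null_sets M" for m using T by (auto simp: null_sets_def)
    then have "AE x in M. \<forall>m. x \<notin> T m" by (simp add: AE_all_countable AE_not_in)
    then have "AE x in M. False" using ae by eventually_elim blast
    then have "space M \<in> null_sets M" using AE_iff_null[of M "\<lambda>_. False"] by simp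
    then show False using pos by (simp add: null_sets_def)
  qed
  then show ?thesis using that T unfolding T_def by blast
qed

section \<open>The Poincare inequality at density points\<close>

lemma C1_contraction_norm_le:
  fixes B :: "real ^ 'n \<Rightarrow> real ^ 'n ^ 'n"
  assumes "C1_contraction P B"
  shows "norm (B x) \<le> real CARD('n)"
proof -
  have n: "real CARD('n) \<ge> 1" by (simp add: Suc_leI)
  have "(norm (B x))\<^sup>2 \<le> (\<Sum>k\<in>(UNIV::'n set). 1)"
    unfolding norm_matrix_columns
  proof (rule sum_mono)
    fix k :: 'n
    have "norm (B x *v axis k 1) \<le> norm (axis k (1::real) :: real ^ 'n)"
      using assms unfolding C1_contraction_def by blast
    then have "norm (B x *v axis k 1) \<le> 1" by (simp add: norm_axis_1)
    then show "(norm (B x *v axis k 1))\<^sup>2 \<le> 1" by (simp add: power_le_one)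
  qed
  also have "\<dots> \<le> (real CARD('n))\<^sup>2" using n by (simp add: power2_eq_square)
  finally show ?thesis by (rule power2_le_imp_le) simp
qed

lemma C1_contraction_midpoint:
  assumes P: "C1_contraction P B" and Q: "C1_contraction Q D"
  shows "C1_contraction (\<lambda>x. (1/2) *\<^sub>R (P x + Q x)) (\<lambda>x. (1/2) *\<^sub>R (B x + D x))"
  unfolding C1_contraction_def
proof (intro conjI allI)
  have eq: "((1/2) *\<^sub>R (B x + D x)) *v v = (1/2) *\<^sub>R (B x *v v + D x *v v)" for x v
    by (simp only: scaleR_matrix_vector_assoc[symmetric] matrix_vector_mult_add_rdistrib)
  show "((\<lambda>x. (1/2) *\<^sub>R (P x + Q x)) has_derivative (*v) ((1/2) *\<^sub>R (B x + D x))) (at x)" for x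
  proof -
    have "((\<lambda>x. (1/2) *\<^sub>R (P x + Q x)) has_derivative (\<lambda>v. (1/2) *\<^sub>R (B x *v v + D x *v v))) (at x)"
      using P Q unfolding C1_contraction_def by (intro has_derivative_scaleR_right has_derivative_add) auto
    moreover have "(*v) ((1/2) *\<^sub>R (B x + D x)) = (\<lambda>v. (1/2) *\<^sub>R (B x *v v + D x *v v))"
      by (rule ext) (rule eq)
    ultimately show ?thesis by (simp only:)
  qed
  show "continuous_on UNIV (\<lambda>x. (1/2) *\<^sub>R (B x + D x))"
    using P Q unfolding C1_contraction_def by (intro continuous_intros) auto
  show "norm (((1/2) *\<^sub>R (B x + D x)) *v v) \<le> norm v" for x v
  proof -
    have "norm (B x *v v + D x *v v) \<le> norm v + norm v"
      using P Q unfolding C1_contraction_def by (intro norm_triangle_mono) auto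
    then show ?thesis unfolding eq by simp
  qed
qed

lemma geometric_Cauchy:
  fixes a :: "nat \<Rightarrow> 'a::banach"
  assumes a: "\<And>k. norm (a k - a (Suc k)) \<le> (1/2) ^ k"
  obtains l where "a \<longlonglongrightarrow> l" "\<And>k. norm (a k - l) \<le> 2 * (1/2) ^ k" "\<And>k j. k \<le> j \<Longrightarrow> norm (a k - a j) \<le> 2 * (1/2) ^ k"
proof -
  have d: "norm (a k - a (k + i)) \<le> 2 * (1/2) ^ k - 2 * (1/2) ^ (k + i)" for k i
  proof (induction i)
    case (Suc i)
    have "norm (a k - a (k + Suc i)) \<le> norm (a k - a (k + i)) + norm (a (k + i) - a (Suc (k + i)))"
      using norm_triangle_ineq[of "a k - a (k + i)" "a (k + i) - a (Suc (k + i))"] by simp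
    also have "\<dots> \<le> 2 * (1/2) ^ k - 2 * (1/2) ^ (k + i) + (1/2) ^ (k + i)"
      using Suc a[of "k + i"] by linarith
    finally show ?case by simp
  qed simp
  have le: "norm (a k - a j) \<le> 2 * (1/2) ^ k" if "k \<le> j" for k j
  proof -
    have "norm (a k - a j) \<le> 2 * (1/2) ^ k - 2 * (1/2) ^ j" using d[of k "j - k"] that by simp
    moreover have "(0::real) \<le> (1/2) ^ j" by simp
    ultimately show ?thesis by linarith
  qed
  have "Cauchy a"
  proof (rule CauchyI')
    fix e :: real assume "e > 0"
    then obtain k where k: "(1/2) ^ k < e / 2" using real_arch_pow_inv[of "e/2" "1/2"] by auto
    have "dist (a m) (a n) < e" if "k \<le> m" "m < n" for m n
    proof -
      have "dist (a m) (a n) \<le> 2 * (1/2) ^ m" using le[of m n] that by (simp add: dist_norm)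
      also have "\<dots> \<le> 2 * (1/2) ^ k" using that by (intro mult_left_mono power_decreasing) auto
      finally show ?thesis using k by simp
    qed
    then show "\<exists>M. \<forall>m\<ge>M. \<forall>n>m. dist (a m) (a n) < e" by blast
  qed
  then obtain l where l: "a \<longlonglongrightarrow> l" using Cauchy_convergent_iff convergent_def by blast
  have "norm (a k - l) \<le> 2 * (1/2) ^ k" for k
  proof (rule LIMSEQ_le_const2)
    show "(\<lambda>j. norm (a k - a j)) \<longlonglongrightarrow> norm (a k - l)" by (intro tendsto_intros l)
    show "\<exists>N. \<forall>j\<ge>N. norm (a k - a j) \<le> 2 * (1/2) ^ k" using le by blast
  qed
  then show ?thesis using that l le by blast
qed

text \<open>The mean value inequality is used on a convex ball about \<open>\<phi> x\<close> in the
  target, so nothing about the shape of balls in the metric space enters.\<close>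

lemma local_Lipschitz_comp:
  fixes R :: "real ^ 'n \<Rightarrow> real ^ 'n" and \<phi> :: "'a::metric_space \<Rightarrow> real ^ 'n"
  assumes R: "\<And>z. (R has_derivative (*v) (D z)) (at z)" and D: "continuous_on UNIV D"
    and L: "0 \<le> L" "\<And>y z. norm (\<phi> y - \<phi> z) \<le> L * dist y z" and e: "e > 0"
  shows "\<exists>r>0. \<forall>y\<in>ball x r. \<forall>z\<in>ball x r. \<bar>R (\<phi> y) $ i - R (\<phi> z) $ i\<bar> \<le> (L * norm (D (\<phi> x)) + e) * dist y z"
proof -
  define e' where "e' = e / (L + 1)"
  have e': "e' > 0" "e' * L \<le> e" using e L(1) by (simp_all add: e'_def field_simps)
  obtain \<delta> where \<delta>: "\<delta> > 0" "\<And>w. dist w (\<phi> x) < \<delta> \<Longrightarrow> dist (D w) (D (\<phi> x)) < e'"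
    using D e'(1) unfolding continuous_on_iff by (metis UNIV_I)
  have bound: "norm (D w) \<le> norm (D (\<phi> x)) + e'" if "w \<in> ball (\<phi> x) \<delta>" for w
    using \<delta>(2)[of w] that norm_triangle_sub[of "D w" "D (\<phi> x)"] by (simp add: dist_norm dist_commute norm_minus_commute)
  have lip: "norm (R v - R w) \<le> (norm (D (\<phi> x)) + e') * norm (v - w)" if "v \<in> ball (\<phi> x) \<delta>" "w \<in> ball (\<phi> x) \<delta>" for v w
  proof (rule differentiable_bound[of "ball (\<phi> x) \<delta>" R "\<lambda>z. (*v) (D z)"])
    show "(R has_derivative (*v) (D z)) (at z within ball (\<phi> x) \<delta>)" for z
      using R by (rule has_derivative_at_withinI)
    show "onorm ((*v) (D z)) \<le> norm (D (\<phi> x)) + e'" if "z \<in> ball (\<phi> x) \<delta>" for z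
    proof (rule onorm_le)
      fix v
      have "norm (D z *v v) \<le> norm (D z) * norm v" by (rule norm_matrix_vector_le)
      also have "\<dots> \<le> (norm (D (\<phi> x)) + e') * norm v" by (intro mult_right_mono bound that) simp
      finally show "norm (D z *v v) \<le> (norm (D (\<phi> x)) + e') * norm v" .
    qed
  qed (use that in auto)
  define r where "r = \<delta> / (L + 1)"
  have r: "r > 0" "(L + 1) * r = \<delta>" using \<delta>(1) L(1) by (simp_all add: r_def)
  have near: "\<phi> y \<in> ball (\<phi> x) \<delta>" if "y \<in> ball x r" for y
  proof -
    have "norm (\<phi> x - \<phi> y) \<le> L * dist x y" by (rule L(2))
    also have "\<dots> \<le> L * r" using that L(1) by (intro mult_left_mono) auto
    also have "\<dots> < \<delta>" using r by (simp add: algebra_simps)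
    finally show ?thesis by (simp add: dist_norm)
  qed
  show ?thesis
  proof (intro exI[of _ r] conjI ballI)
    fix y z assume yz: "y \<in> ball x r" "z \<in> ball x r"
    have "\<bar>R (\<phi> y) $ i - R (\<phi> z) $ i\<bar> \<le> norm (R (\<phi> y) - R (\<phi> z))"
      using component_le_norm_cart[of "R (\<phi> y) - R (\<phi> z)" i] by simp
    also have "\<dots> \<le> (norm (D (\<phi> x)) + e') * norm (\<phi> y - \<phi> z)" by (intro lip near yz)
    also have "\<dots> \<le> (norm (D (\<phi> x)) + e') * (L * dist y z)"
      using e'(1) by (intro mult_left_mono L(2)) (simp add: add_nonneg_nonneg less_imp_le)
    also have "\<dots> = (L * norm (D (\<phi> x)) + e' * L) * dist y z" by (simp add: algebra_simps)
    also have "\<dots> \<le> (L * norm (D (\<phi> x)) + e) * dist y z" using e'(2) by (intro mult_right_mono) auto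
    finally show "\<bar>R (\<phi> y) $ i - R (\<phi> z) $ i\<bar> \<le> (L * norm (D (\<phi> x)) + e) * dist y z" .
  qed (rule r(1))
qed

text \<open>Differences of the maps along \<open>\<phi>\<close> are bounded but need not be in
  \<open>L^p\<close> when the total measure is infinite. The factor is 1 on the unit ball, where
  they are examined, and vanishes outside the ball of radius 2.\<close>

definition cutoff :: "'a::metric_space \<Rightarrow> 'a \<Rightarrow> real" where
  "cutoff x0 y = max 0 (min 1 (2 - dist x0 y))"

lemma cutoff_Lipschitz: "\<bar>cutoff x0 y - cutoff x0 z\<bar> \<le> dist y z"
proof -
  have "\<bar>dist x0 y - dist x0 z\<bar> \<le> dist y z"
    using dist_triangle[of x0 y z] dist_triangle[of x0 z y] by (simp add: dist_commute abs_le_iff)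
  then show ?thesis unfolding cutoff_def by (simp add: max_def min_def) linarith
qed

lemma cutoff_range: "0 \<le> cutoff x0 y" "cutoff x0 y \<le> 1"
  by (simp_all add: cutoff_def)

text \<open>Product rule: the cutoff is 1-Lipschitz and at most 1, so it adds only
  \<open>\<bar>h x\<bar>\<close> to the gradient. In the application this term is uniformly
  small.\<close>

lemma local_Lipschitz_cutoff:
  fixes h g :: "'a::metric_space \<Rightarrow> real"
  assumes h: "continuous_on UNIV h"
    and loc: "\<And>e. e > 0 \<Longrightarrow> \<exists>r>0. \<forall>y\<in>ball x r. \<forall>z\<in>ball x r. \<bar>h y - h z\<bar> \<le> (g x + e) * dist y z"
    and e: "e > 0"
  shows "\<exists>r>0. \<forall>y\<in>ball x r. \<forall>z\<in>ball x r. \<bar>cutoff x0 y * h y - cutoff x0 z * h z\<bar> \<le> (g x + \<bar>h x\<bar> + e) * dist y z"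
proof -
  obtain r1 where r1: "r1 > 0" "\<And>y z. y \<in> ball x r1 \<Longrightarrow> z \<in> ball x r1 \<Longrightarrow> \<bar>h y - h z\<bar> \<le> (g x + e/2) * dist y z"
    using loc[of "e/2"] e by (meson half_gt_zero)
  obtain r2 where r2: "r2 > 0" "\<And>z. dist z x < r2 \<Longrightarrow> dist (h z) (h x) < e/2"
    using h e unfolding continuous_on_iff by (metis UNIV_I half_gt_zero)
  show ?thesis
  proof (intro exI[of _ "min r1 r2"] conjI ballI)
    fix y z assume yz: "y \<in> ball x (min r1 r2)" "z \<in> ball x (min r1 r2)"
    have "\<bar>h z - h x\<bar> < e/2" using r2(2)[of z] yz by (simp add: dist_real_def dist_commute)
    then have "\<bar>h z\<bar> \<le> \<bar>h x\<bar> + e/2" by linarith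
    then have 1: "\<bar>h z\<bar> * \<bar>cutoff x0 y - cutoff x0 z\<bar> \<le> (\<bar>h x\<bar> + e/2) * dist y z"
      using e by (intro mult_mono cutoff_Lipschitz) auto
    have "\<bar>cutoff x0 y\<bar> * \<bar>h y - h z\<bar> \<le> 1 * ((g x + e/2) * dist y z)"
      using r1(2)[of y z] yz cutoff_range[of x0 y] by (intro mult_mono) auto
    moreover have "cutoff x0 y * h y - cutoff x0 z * h z = cutoff x0 y * (h y - h z) + h z * (cutoff x0 y - cutoff x0 z)"
      by (simp add: algebra_simps)
    then have "\<bar>cutoff x0 y * h y - cutoff x0 z * h z\<bar> \<le> \<bar>cutoff x0 y\<bar> * \<bar>h y - h z\<bar> + \<bar>h z\<bar> * \<bar>cutoff x0 y - cutoff x0 z\<bar>"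
      using abs_triangle_ineq[of "cutoff x0 y * (h y - h z)" "h z * (cutoff x0 y - cutoff x0 z)"] by (simp add: abs_mult)
    ultimately show "\<bar>cutoff x0 y * h y - cutoff x0 z * h z\<bar> \<le> (g x + \<bar>h x\<bar> + e) * dist y z"
      using 1 by (simp add: algebra_simps)
  qed (use r1 r2 in simp)
qed

section \<open>Gradients that are small on a set of density one\<close>

lemma ennreal_powr_ennreal: "0 \<le> u \<Longrightarrow> ennreal_powr (ennreal u) q = ennreal (u powr q)"
  by (simp add: ennreal_powr_def)

lemma ennreal_powr_mono:
  assumes "x \<le> y" "0 \<le> q"
  shows "ennreal_powr x q \<le> ennreal_powr y q"
proof (cases "y = \<infinity>")
  case False
  then have "x \<noteq> \<infinity>" using assms(1) by (auto simp: top_unique)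
  moreover have "enn2real x \<le> enn2real y" using assms(1) False by (intro enn2real_mono) (auto simp: less_top)
  ultimately show ?thesis using False assms(2) by (auto simp: ennreal_powr_def intro!: ennreal_leI powr_mono2)
qed (simp add: ennreal_powr_def)

context doubling_measure
begin

text \<open>Outside \<open>T\<close> the gradient is only bounded by \<open>b\<close>, but the
  measure there is a fraction \<open>(a / b) powr p\<close>, so this part contributes as much as
  \<open>a\<close> does on the whole ball. The \<open>p\<close>-th root of the resulting factor 2 is
  again at most 2.\<close>

lemma Poincare_small_gradient:
  fixes f g :: "'a \<Rightarrow> real"
  assumes p: "p > 1"
    and P: "(\<integral>\<^sup>+y\<in>ball x r. ennreal \<bar>f y - m\<bar> \<partial>M) / emeasure M (ball x r)
           \<le> ennreal (c * r) * ennreal_powr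
               ((\<integral>\<^sup>+y\<in>ball x (\<Lambda> * r). ennreal_powr (ennreal (g y)) p \<partial>M) / emeasure M (ball x (\<Lambda> * r))) (1 / p)"
    and r: "r > 0" and \<Lambda>: "\<Lambda> \<ge> 1" and c: "c > 0" and T: "T \<in> sets M"
    and g: "\<And>y. 0 \<le> g y" "\<And>y. y \<in> T \<Longrightarrow> g y \<le> a" "\<And>y. g y \<le> b" and ab: "0 < a" "0 < b"
    and thin: "emeasure M (ball x (\<Lambda> * r) - T) \<le> ennreal ((a / b) powr p) * emeasure M (ball x (\<Lambda> * r))"
  shows "(\<integral>\<^sup>+y\<in>ball x r. ennreal \<bar>f y - m\<bar> \<partial>M) \<le> ennreal (2 * c * a * r) * emeasure M (ball x r)"
proof -
  let ?B = "ball x (\<Lambda> * r)"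
  have \<Lambda>r: "\<Lambda> * r > 0" using \<Lambda> r by simp
  have "(\<integral>\<^sup>+y\<in>?B. ennreal_powr (ennreal (g y)) p \<partial>M) \<le> (\<integral>\<^sup>+y. ennreal (a powr p) * indicator ?B y + ennreal (b powr p) * indicator (?B - T) y \<partial>M)"
  proof (rule nn_integral_mono)
    fix y
    have eq: "ennreal_powr (ennreal (g y)) p = ennreal (g y powr p)" by (rule ennreal_powr_ennreal[OF g(1)])
    show "ennreal_powr (ennreal (g y)) p * indicator ?B y \<le> ennreal (a powr p) * indicator ?B y + ennreal (b powr p) * indicator (?B - T) y"
    proof (cases "y \<in> T")
      case True
      then have "g y powr p \<le> a powr p" using g(1,2) p by (intro powr_mono2) auto
      then have "ennreal (g y powr p) \<le> ennreal (a powr p)" by (rule ennreal_leI)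
      then show ?thesis unfolding eq using True by (cases "y \<in> ?B") simp_all
    next
      case False
      have "g y powr p \<le> b powr p" using g(1,3) p by (intro powr_mono2) auto
      then have le: "ennreal (g y powr p) \<le> ennreal (a powr p) + ennreal (b powr p)"
        using add_increasing[OF zero_le ennreal_leI] by blast
      show ?thesis unfolding eq by (cases "y \<in> ?B") (use le False in simp_all)
    qed
  qed
  also have "\<dots> = ennreal (a powr p) * emeasure M ?B + ennreal (b powr p) * emeasure M (?B - T)"
  proof -
    have sets: "?B \<in> sets M" "?B - T \<in> sets M" using T by auto
    then show ?thesis
      by (subst nn_integral_add) (simp_all only: nn_integral_cmult_indicator borel_measurable_times_ennreal
        borel_measurable_const borel_measurable_indicator)
  qed
  also have "\<dots> \<le> ennreal (a powr p) * emeasure M ?B + ennreal (b powr p) * (ennreal ((a / b) powr p) * emeasure M ?B)"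
    by (intro add_left_mono mult_left_mono thin) simp
  also have "\<dots> = ennreal (2 * a powr p) * emeasure M ?B"
  proof -
    have "b powr p * (a / b) powr p = a powr p" using ab by (simp add: powr_mult[symmetric])
    then have "ennreal (b powr p) * ennreal ((a / b) powr p) = ennreal (a powr p)"
      by (simp flip: ennreal_mult)
    then have "ennreal (b powr p) * (ennreal ((a / b) powr p) * emeasure M ?B) = ennreal (a powr p) * emeasure M ?B"
      by (simp add: mult.assoc[symmetric])
    moreover have "ennreal (2 * a powr p) = ennreal (a powr p) + ennreal (a powr p)" by (simp flip: ennreal_plus)
    ultimately show ?thesis by (simp add: distrib_right)
  qed
  finally have "(\<integral>\<^sup>+y\<in>?B. ennreal_powr (ennreal (g y)) p \<partial>M) / emeasure M ?B \<le> ennreal (2 * a powr p)"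
    using ball_pos[OF \<Lambda>r, of x] by (intro divide_le_posI_ennreal) (simp_all only: mult.commute)
  then have "ennreal_powr ((\<integral>\<^sup>+y\<in>?B. ennreal_powr (ennreal (g y)) p \<partial>M) / emeasure M ?B) (1 / p) \<le> ennreal_powr (ennreal (2 * a powr p)) (1 / p)"
    using p by (intro ennreal_powr_mono) auto
  also have "\<dots> = ennreal ((2 * a powr p) powr (1 / p))" by (simp add: ennreal_powr_ennreal)
  also have "\<dots> \<le> ennreal (2 * a)"
  proof (rule ennreal_leI)
    have "(2 * a powr p) powr (1 / p) = 2 powr (1 / p) * a"
      using p ab by (simp add: powr_mult powr_powr)
    also have "2 powr (1 / p) \<le> (2::real) powr 1" using p by (intro powr_mono) auto
    finally show "(2 * a powr p) powr (1 / p) \<le> 2 * a" using ab by simp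
  qed
  finally have "(\<integral>\<^sup>+y\<in>ball x r. ennreal \<bar>f y - m\<bar> \<partial>M) / emeasure M (ball x r) \<le> ennreal (c * r) * ennreal (2 * a)"
    by (intro order_trans[OF P] mult_left_mono) simp_all
  also have "\<dots> = ennreal (2 * c * a * r)" using c r ab by (simp add: mult_ac flip: ennreal_mult)
  finally have le: "(\<integral>\<^sup>+y\<in>ball x r. ennreal \<bar>f y - m\<bar> \<partial>M) / emeasure M (ball x r) \<le> ennreal (2 * c * a * r)" .
  have "(\<integral>\<^sup>+y\<in>ball x r. ennreal \<bar>f y - m\<bar> \<partial>M) = (\<integral>\<^sup>+y\<in>ball x r. ennreal \<bar>f y - m\<bar> \<partial>M) / emeasure M (ball x r) * emeasure M (ball x r)"
    using ball_pos[OF r, of x] ball_finite[of x r] by (simp add: ennreal_divide_times)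
  also have "\<dots> \<le> ennreal (2 * c * a * r) * emeasure M (ball x r)" by (rule mult_right_mono[OF le]) simp
  finally show ?thesis .
qed

end

lemma first_order_approx_zeroI:
  fixes \<phi> :: "'a::metric_space \<Rightarrow> real ^ 'n"
  assumes "\<And>e. e > 0 \<Longrightarrow> \<exists>\<rho>>0. \<forall>y. dist y x < \<rho> \<longrightarrow> \<bar>v \<bullet> \<phi> y - v \<bullet> \<phi> x\<bar> \<le> e * dist y x"
  shows "first_order_approx (\<lambda>_. 0) \<phi> x v"
proof -
  let ?q = "\<lambda>y. ennreal (\<bar>0 - 0 - v \<bullet> (\<phi> y - \<phi> x)\<bar> / dist y x)"
  have "Limsup (at x) ?q \<le> 0 + ennreal e" if e: "e > 0" for e
  proof -
    obtain \<rho> where \<rho>: "\<rho> > 0" "\<And>y. dist y x < \<rho> \<Longrightarrow> \<bar>v \<bullet> \<phi> y - v \<bullet> \<phi> x\<bar> \<le> e * dist y x"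
      using assms[OF e] by blast
    have "eventually (\<lambda>y. ?q y \<le> ennreal e) (at x)"
      unfolding eventually_at
    proof (intro exI[of _ \<rho>] conjI ballI impI)
      fix y assume "y \<noteq> x \<and> dist y x < \<rho>"
      then have "\<bar>v \<bullet> (\<phi> y - \<phi> x)\<bar> / dist y x \<le> e"
        using \<rho>(2)[of y] by (simp add: divide_le_eq inner_diff_right)
      then show "?q y \<le> ennreal e" by (simp add: ennreal_leI)
    qed (rule \<rho>(1))
    then show ?thesis by (simp add: Limsup_bounded)
  qed
  then have "Limsup (at x) ?q \<le> 0" by (rule ennreal_le_epsilon)
  then show ?thesis unfolding first_order_approx_def by simp
qed

context doubling_measure
begin

lemma in_Lp_cutoff:
  assumes h: "continuous_on UNIV h" "\<And>y. \<bar>h y\<bar> \<le> b" and p: "p > 0"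
  shows "in_Lp p M (\<lambda>y. cutoff x y * h y)"
proof -
  have "continuous_on UNIV (cutoff x)"
    unfolding cutoff_def by (intro continuous_intros)
  then have "(\<lambda>y. cutoff x y * h y) \<in> borel_measurable borel"
    using h(1) by (intro borel_measurable_continuous_onI continuous_intros)
  then have m: "(\<lambda>y. cutoff x y * h y) \<in> borel_measurable M" by (rule borel_measurable_M)
  have le: "\<bar>cutoff x y * h y\<bar> \<le> b" for y
  proof -
    have "\<bar>cutoff x y * h y\<bar> \<le> 1 * b"
      unfolding abs_mult using h(2) cutoff_range[of x y] by (intro mult_mono) auto
    then show ?thesis by simp
  qed
  have "integrable M (\<lambda>y. \<bar>cutoff x y * h y\<bar> powr p)"
  proof (rule integrableI_bounded_set[where A="ball x 2" and B="b powr p"])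
    show "(\<lambda>y. \<bar>cutoff x y * h y\<bar> powr p) \<in> borel_measurable M" using m by measurable
    show "emeasure M (ball x 2) < \<infinity>" by (rule ball_finite)
    show "AE y in M. y \<in> ball x 2 \<longrightarrow> norm (\<bar>cutoff x y * h y\<bar> powr p) \<le> b powr p"
      using le p by (intro AE_I2) (auto intro!: powr_mono2)
    show "AE y in M. y \<notin> ball x 2 \<longrightarrow> \<bar>cutoff x y * h y\<bar> powr p = 0"
      by (intro AE_I2) (auto simp: cutoff_def)
  qed simp
  then show ?thesis using m by (simp add: in_Lp_def)
qed

text \<open>Near \<open>x\<close> the displacement of \<open>Q k\<close> is linear in
  \<open>\<phi>\<close> with matrix close to \<open>l - mat 1\<close>, up to a constant. It differs
  from the displacement of \<open>Q j\<close>, negligible at the given scale, by a function with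
  small gradient on \<open>T\<close>. The Poincare inequality therefore makes
  \<open>l - mat 1\<close>, applied to \<open>\<phi>\<close>, oscillate by
  \<open>o(r)\<close>.\<close>

lemma limit_derivative_identity:
  fixes \<phi> :: "'a \<Rightarrow> real ^ 'n" and Q :: "nat \<Rightarrow> real ^ 'n \<Rightarrow> real ^ 'n"
  assumes p: "p > 1" and PI: "poincare_inequality p M" and \<phi>: "L-lipschitz_on UNIV \<phi>"
    and Q: "\<And>k. C1_contraction (Q k) (B k)" and close: "\<And>k z. norm (Q k z - z) \<le> (1/2) ^ k"
    and T: "T \<in> sets M" and fast: "\<And>y k. y \<in> T \<Longrightarrow> norm (B k (\<phi> y) - B (Suc k) (\<phi> y)) \<le> (1/2) ^ k"
    and x: "x \<in> T"
    and density: "\<And>c. c > 0 \<Longrightarrow> \<exists>\<rho>>0. \<forall>r. 0 < r \<and> r < \<rho> \<longrightarrow> emeasure M (ball x r - T) \<le> ennreal c * emeasure M (ball x r)"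
    and diff: "differentiable_wrt (\<lambda>_. 0) \<phi> x"
  shows "(\<lambda>k. B k (\<phi> x)) \<longlonglongrightarrow> mat 1"
proof -
  define n where "n = real CARD('n)"
  have n: "n \<ge> 1" by (simp add: n_def Suc_leI)
  have L: "0 \<le> L" "norm (\<phi> y - \<phi> z) \<le> L * dist y z" for y z
    using lipschitz_on_nonneg[OF \<phi>] lipschitz_onD[OF \<phi>, of y z] by (auto simp: dist_norm)
  obtain cp \<Lambda> where cp: "cp > 0" "\<Lambda> \<ge> 1" and PI': "\<And>f g x r. in_Lp p M f \<Longrightarrow> upper_gradient f g \<Longrightarrow> r > 0 \<Longrightarrow>
           (\<integral>\<^sup>+y\<in>ball x r. ennreal \<bar>f y - set_average M (ball x r) f\<bar> \<partial>M) / emeasure M (ball x r)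
           \<le> ennreal (cp * r) * ennreal_powr
               ((\<integral>\<^sup>+y\<in>ball x (\<Lambda> * r). ennreal_powr (g y) p \<partial>M) / emeasure M (ball x (\<Lambda> * r))) (1 / p)"
    using PI unfolding poincare_inequality_def by blast
  have Qd: "(Q k has_derivative (*v) (B k z)) (at z)" and Bc: "continuous_on UNIV (B k)" for k z
    using Q[of k] unfolding C1_contraction_def by auto
  have Qc: "continuous_on UNIV (Q k)" for k
    using Qd by (intro continuous_at_imp_continuous_on) (blast intro: has_derivative_continuous)
  have \<phi>c: "continuous_on UNIV \<phi>" by (rule lipschitz_on_continuous_on[OF \<phi>])
  obtain l where l: "(\<lambda>k. B k (\<phi> x)) \<longlonglongrightarrow> l" and kl: "\<And>k. norm (B k (\<phi> x) - l) \<le> 2 * (1/2) ^ k"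
    using geometric_Cauchy[of "\<lambda>k. B k (\<phi> x)"] fast[OF x] by metis
  have tail: "norm (B k (\<phi> y) - B j (\<phi> y)) \<le> 2 * (1/2) ^ k" if "y \<in> T" "k \<le> j" for y k j
    using geometric_Cauchy[of "\<lambda>k. B k (\<phi> y)"] fast[OF that(1)] that(2) by metis
  have "(l - mat 1) $ i = 0" for i
  proof -
    \<comment> \<open>Each row of \<open>l - mat 1\<close> is shown to be a derivative of the zero
      function with respect to \<open>\<phi>\<close>; as 0 is one too, uniqueness makes the row
      vanish.\<close>
    define v where "v = (l - mat 1) $ i"
    define u where "u y = v \<bullet> \<phi> y" for y
    define F where "F k y = (Q k (\<phi> y) - \<phi> y) $ i" for k y
    have Fle: "\<bar>F k y\<bar> \<le> (1/2) ^ k" for k y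
      unfolding F_def using component_le_norm_cart close by (rule order_trans)
    have osc: "\<exists>\<rho>>0. \<forall>r. 0 < r \<and> r < \<rho> \<longrightarrow>
       (\<exists>m. (\<integral>\<^sup>+y\<in>ball x r. ennreal \<bar>u y - m\<bar> \<partial>M) \<le> ennreal (\<kappa> * r) * emeasure M (ball x r))" if \<kappa>: "\<kappa> > 0" for \<kappa>
    proof -
      \<comment> \<open>Collects the final error: \<open>2 * cp * a\<close> from the Poincare
        inequality, \<open>\<delta>\<close> from the displacement of \<open>Q j\<close> and
        \<open>3 * \<delta> * L\<close> from linearisation add up to
        \<open>c0 * \<delta>\<close>.\<close>
      define c0 where "c0 = 4 * cp * (L + 1) + 1 + 3 * L"
      have c0: "c0 > 0" using cp L by (simp add: c0_def add_pos_nonneg)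
      obtain k where k: "(1/2) ^ k < \<kappa> / c0"
        using real_arch_pow_inv[of "\<kappa> / c0" "1/2"] \<kappa> c0 by auto
      define \<delta> where "\<delta> = (1/2 :: real) ^ k"
      have \<delta>: "\<delta> > 0" "\<delta> \<le> 1" "c0 * \<delta> \<le> \<kappa>"
        using k c0 by (auto simp: \<delta>_def power_le_one field_simps)
      obtain r0 where r0: "r0 > 0" "\<And>w. norm (w - \<phi> x) < r0 \<Longrightarrow> norm (Q k w - Q k (\<phi> x) - B k (\<phi> x) *v (w - \<phi> x)) \<le> \<delta> * norm (w - \<phi> x)"
        using Qd[of k "\<phi> x"] \<delta>(1) unfolding has_derivative_at_alt by blast
      define r1 where "r1 = r0 / (L + 1)"
      have r1: "r1 > 0" "(L + 1) * r1 = r0" using r0(1) L by (simp_all add: r1_def)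
      define K where "K = F k x - u x"
      \<comment> \<open>One \<open>\<delta>\<close> is the first-order error of \<open>Q k\<close>
        at \<open>\<phi> x\<close>; two more come from replacing \<open>B k (\<phi> x)\<close> by
        \<open>l\<close>.\<close>
      have err: "\<bar>F k y - u y - K\<bar> \<le> 3 * \<delta> * L * dist y x" if "dist y x < r1" for y
      proof -
        define w where "w = \<phi> y - \<phi> x"
        have nw: "norm w \<le> L * dist y x" unfolding w_def by (rule L(2))
        also have "\<dots> \<le> L * r1" using that L by (intro mult_left_mono) auto
        also have "\<dots> < r0" using r1 by (simp add: algebra_simps)
        finally have "norm w < r0" .
        then have e1: "norm (Q k (\<phi> y) - Q k (\<phi> x) - B k (\<phi> x) *v w) \<le> \<delta> * norm w"
          unfolding w_def by (rule r0(2))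
        have e2: "norm ((B k (\<phi> x) - l) *v w) \<le> 2 * \<delta> * norm w"
          using norm_matrix_vector_le[of "B k (\<phi> x) - l" w] mult_right_mono[OF kl[of k], of "norm w"] by (simp add: \<delta>_def)
        have "v \<bullet> w = ((l - mat 1) *v w) $ i" by (simp add: v_def matrix_vector_mul_component)
        then have vw: "v \<bullet> w = (l *v w) $ i - w $ i" by (simp add: matrix_vector_mult_diff_rdistrib)
        have "F k y - u y - K = (Q k (\<phi> y) - Q k (\<phi> x)) $ i - w $ i - v \<bullet> w"
          by (simp add: F_def K_def u_def w_def inner_diff_right)
        also have "\<dots> = (Q k (\<phi> y) - Q k (\<phi> x) - B k (\<phi> x) *v w) $ i + ((B k (\<phi> x) - l) *v w) $ i"
          by (simp add: vw matrix_vector_mult_diff_rdistrib)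
        finally have "\<bar>F k y - u y - K\<bar> \<le> \<delta> * norm w + 2 * \<delta> * norm w"
          using component_le_norm_cart[of "Q k (\<phi> y) - Q k (\<phi> x) - B k (\<phi> x) *v w" i]
            component_le_norm_cart[of "(B k (\<phi> x) - l) *v w" i] e1 e2 by linarith
        also have "\<dots> = 3 * \<delta> * norm w" by simp
        also have "\<dots> \<le> 3 * \<delta> * (L * dist y x)" using nw \<delta> by (intro mult_left_mono) auto
        finally show ?thesis by (simp add: mult.assoc)
      qed
      define a where "a = 2 * \<delta> * L + 2 * \<delta>"
      \<comment> \<open>The bound valid off \<open>T\<close> as well: two contractions have matrix
        norms at most \<open>n\<close>, and the cutoff term is at most
        \<open>2 * \<delta> \<le> 2\<close>.\<close>
      define b where "b = L * (2 * n) + 2"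
      have ab: "a > 0" "b > 0" using \<delta> L n by (auto simp: a_def b_def add_nonneg_pos)
      obtain \<rho> where \<rho>: "\<rho> > 0" "\<And>r. 0 < r \<Longrightarrow> r < \<rho> \<Longrightarrow> emeasure M (ball x r - T) \<le> ennreal ((a / b) powr p) * emeasure M (ball x r)"
        using density[of "(a / b) powr p"] ab by auto
      show ?thesis
      proof (rule exI[of _ "min 1 (min r1 (\<rho> / \<Lambda>))"], intro conjI allI impI)
        fix r assume r: "0 < r \<and> r < min 1 (min r1 (\<rho> / \<Lambda>))"
        then have r': "0 < r" "r < 1" "r < r1" "\<Lambda> * r < \<rho>" using cp by (auto simp: field_simps)
        \<comment> \<open>Here \<open>j\<close> depends on the radius: the displacement of
          \<open>Q j\<close> must be small compared with \<open>r\<close>, whereas the gradient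
          estimate on \<open>T\<close> is uniform in \<open>j \<ge> k\<close>.\<close>
        obtain j0 where j0: "(1/2) ^ j0 < \<delta> * r"
          using real_arch_pow_inv[of "\<delta> * r" "1/2"] \<delta> r' by auto
        define j where "j = max k j0"
        have j: "k \<le> j" "(1/2) ^ j \<le> \<delta> * r" "(1/2) ^ j \<le> \<delta>"
        proof -
          show "k \<le> j" by (simp add: j_def)
          have "(1/2::real) ^ j \<le> (1/2) ^ j0" by (rule power_decreasing) (auto simp: j_def)
          then show "(1/2) ^ j \<le> \<delta> * r" using j0 by linarith
          show "(1/2) ^ j \<le> \<delta>" unfolding \<delta>_def by (rule power_decreasing) (auto simp: j_def)
        qed
        define R where "R z = Q k z - Q j z" for z
        define D where "D z = B k z - B j z" for z
        define h where "h y = R (\<phi> y) $ i" for y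
        have hF: "h y = F k y - F j y" for y by (simp add: h_def R_def F_def)
        have h2: "\<bar>h y\<bar> \<le> 2 * \<delta>" for y
          using Fle[of k y] Fle[of j y] j(3) unfolding hF \<delta>_def[symmetric] by linarith
        have Rd: "(R has_derivative (*v) (D z)) (at z)" for z
        proof -
          have "(R has_derivative (\<lambda>v. B k z *v v - B j z *v v)) (at z)"
            unfolding R_def by (intro has_derivative_diff Qd)
          moreover have "(*v) (D z) = (\<lambda>v. B k z *v v - B j z *v v)"
            by (rule ext) (simp add: D_def matrix_vector_mult_diff_rdistrib)
          ultimately show ?thesis by (simp only:)
        qed
        have Dc: "continuous_on UNIV D" unfolding D_def by (intro continuous_intros Bc)
        have hc: "continuous_on UNIV h"
        proof -
          have "continuous_on UNIV R" unfolding R_def by (intro continuous_intros Qc)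
          then have "continuous_on UNIV (\<lambda>y. R (\<phi> y))" by (rule continuous_on_compose2[OF _ \<phi>c]) auto
          then show ?thesis unfolding h_def by (intro continuous_intros)
        qed
        define G where "G y = L * norm (D (\<phi> y))" for y
        define g where "g y = G y + \<bar>h y\<bar>" for y
        define f where "f y = cutoff x y * h y" for y
        have G0: "0 \<le> G y" for y using L by (simp add: G_def)
        have gc: "continuous_on UNIV g"
        proof -
          have "continuous_on UNIV (\<lambda>y. D (\<phi> y))" by (rule continuous_on_compose2[OF Dc \<phi>c]) auto
          then show ?thesis unfolding g_def G_def by (intro continuous_intros hc)
        qed
        have g0: "0 \<le> g y" for y using G0[of y] by (simp add: g_def)
        have ug: "upper_gradient f (\<lambda>y. ennreal (g y))"
        proof (rule local_Lipschitz_upper_gradient[OF gc g0])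
          fix z and e :: real assume e: "e > 0"
          show "\<exists>r>0. \<forall>y\<in>ball z r. \<forall>z'\<in>ball z r. \<bar>f y - f z'\<bar> \<le> (g z + e) * dist y z'"
            unfolding f_def g_def
          proof (rule local_Lipschitz_cutoff[OF hc _ e])
            fix e :: real assume "e > 0"
            then show "\<exists>r>0. \<forall>y\<in>ball z r. \<forall>z'\<in>ball z r. \<bar>h y - h z'\<bar> \<le> (G z + e) * dist y z'"
              unfolding h_def G_def by (rule local_Lipschitz_comp[OF Rd Dc L])
          qed
        qed
        have Lp: "in_Lp p M f" unfolding f_def using p by (intro in_Lp_cutoff[OF hc h2]) simp
        define m where "m = set_average M (ball x r) f"
        have main: "(\<integral>\<^sup>+y\<in>ball x r. ennreal \<bar>f y - m\<bar> \<partial>M) \<le> ennreal (2 * cp * a * r) * emeasure M (ball x r)"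
        proof (rule Poincare_small_gradient[OF p _ r'(1) cp(2,1) T g0 _ _ ab])
          show "(\<integral>\<^sup>+y\<in>ball x r. ennreal \<bar>f y - m\<bar> \<partial>M) / emeasure M (ball x r)
           \<le> ennreal (cp * r) * ennreal_powr
               ((\<integral>\<^sup>+y\<in>ball x (\<Lambda> * r). ennreal_powr (ennreal (g y)) p \<partial>M) / emeasure M (ball x (\<Lambda> * r))) (1 / p)"
            unfolding m_def by (rule PI'[OF Lp ug r'(1)])
          show "g y \<le> a" if "y \<in> T" for y
          proof -
            have "norm (D (\<phi> y)) \<le> 2 * \<delta>" unfolding D_def \<delta>_def by (rule tail[OF that j(1)])
            then have "L * norm (D (\<phi> y)) \<le> L * (2 * \<delta>)" using L by (intro mult_left_mono) auto
            then show ?thesis using h2[of y] by (simp add: g_def G_def a_def mult_ac)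
          qed
          show "g y \<le> b" for y
          proof -
            have "norm (D (\<phi> y)) \<le> norm (B k (\<phi> y)) + norm (B j (\<phi> y))" unfolding D_def by (rule norm_triangle_ineq4)
            also have "\<dots> \<le> n + n" unfolding n_def by (intro add_mono C1_contraction_norm_le[OF Q])
            finally have "L * norm (D (\<phi> y)) \<le> L * (2 * n)" using L by (intro mult_left_mono) auto
            then show ?thesis using h2[of y] \<delta> by (simp add: g_def G_def b_def)
          qed
          show "emeasure M (ball x (\<Lambda> * r) - T) \<le> ennreal ((a / b) powr p) * emeasure M (ball x (\<Lambda> * r))"
            using cp r' by (intro \<rho>(2)) auto
        qed
        have fm: "f \<in> borel_measurable M" using Lp by (simp add: in_Lp_def)
        define s where "s = (\<delta> + 3 * \<delta> * L) * r"
        have s: "s \<ge> 0" using \<delta> L r' by (simp add: s_def)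
        have pt: "\<bar>u y - (m - K)\<bar> \<le> \<bar>f y - m\<bar> + s" if y: "y \<in> ball x r" for y
        proof -
          have d: "dist y x < r" using y by (simp add: dist_commute)
          then have "cutoff x y = 1" using r' by (simp add: cutoff_def dist_commute)
          then have fh: "f y = F k y - F j y" by (simp add: f_def hF)
          have "3 * \<delta> * L * dist y x \<le> 3 * \<delta> * L * r" using d \<delta> L by (intro mult_left_mono) auto
          then have "\<bar>F k y - u y - K\<bar> \<le> 3 * \<delta> * L * r" using err[of y] d r' by linarith
          moreover have "\<bar>F j y\<bar> \<le> \<delta> * r" using Fle[of j y] j(2) by linarith
          moreover have "s = \<delta> * r + 3 * \<delta> * L * r" by (simp add: s_def algebra_simps)
          ultimately show ?thesis using fh by linarith
        qed
        have "(\<integral>\<^sup>+y\<in>ball x r. ennreal \<bar>u y - (m - K)\<bar> \<partial>M)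
            \<le> (\<integral>\<^sup>+y. ennreal \<bar>f y - m\<bar> * indicator (ball x r) y + ennreal s * indicator (ball x r) y \<partial>M)"
        proof (rule nn_integral_mono)
          fix y
          show "ennreal \<bar>u y - (m - K)\<bar> * indicator (ball x r) y \<le> ennreal \<bar>f y - m\<bar> * indicator (ball x r) y + ennreal s * indicator (ball x r) y"
          proof (cases "y \<in> ball x r")
            case True
            have "ennreal \<bar>u y - (m - K)\<bar> \<le> ennreal \<bar>f y - m\<bar> + ennreal s"
              using pt[OF True] s by (simp add: ennreal_leI flip: ennreal_plus)
            then show ?thesis using True by simp
          qed simp
        qed
        also have "\<dots> = (\<integral>\<^sup>+y\<in>ball x r. ennreal \<bar>f y - m\<bar> \<partial>M) + ennreal s * emeasure M (ball x r)"
        proof -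
          have "(\<lambda>y. ennreal \<bar>f y - m\<bar>) \<in> borel_measurable M" using fm by measurable
          then show ?thesis
            by (subst nn_integral_add) (simp_all only: nn_integral_cmult_indicator borel_measurable_times_ennreal
              borel_measurable_const borel_measurable_indicator ball_sets)
        qed
        also have "\<dots> \<le> ennreal (2 * cp * a * r) * emeasure M (ball x r) + ennreal s * emeasure M (ball x r)"
          by (rule add_right_mono[OF main])
        also have "\<dots> = ennreal (2 * cp * a * r + s) * emeasure M (ball x r)"
          using cp ab r' s by (simp add: distrib_right)
        also have "2 * cp * a * r + s = c0 * \<delta> * r"
          by (simp add: a_def s_def c0_def algebra_simps)
        also have "ennreal (c0 * \<delta> * r) * emeasure M (ball x r) \<le> ennreal (\<kappa> * r) * emeasure M (ball x r)"
          using \<delta>(3) r' by (intro mult_right_mono ennreal_leI) auto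
        finally show "\<exists>m. (\<integral>\<^sup>+y\<in>ball x r. ennreal \<bar>u y - m\<bar> \<partial>M) \<le> ennreal (\<kappa> * r) * emeasure M (ball x r)"
          by blast
      qed (use r1 \<rho> cp in auto)
    qed
    have uL: "\<bar>u y - u z\<bar> \<le> (norm v * L + 1) * dist y z" for y z
    proof -
      have "\<bar>u y - u z\<bar> \<le> norm v * norm (\<phi> y - \<phi> z)"
        unfolding u_def inner_diff_right[symmetric] by (rule Cauchy_Schwarz_ineq2)
      also have "\<dots> \<le> norm v * (L * dist y z)" by (intro mult_left_mono L(2)) simp
      also have "\<dots> \<le> (norm v * L + 1) * dist y z" by (simp add: algebra_simps)
      finally show ?thesis .
    qed
    have "first_order_approx (\<lambda>_. 0) \<phi> x v"
    proof (rule first_order_approx_zeroI)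
      fix e :: real assume "e > 0"
      have "0 < norm v * L + 1" using L by (simp add: add_nonneg_pos)
      then show "\<exists>\<rho>>0. \<forall>y. dist y x < \<rho> \<longrightarrow> \<bar>v \<bullet> \<phi> y - v \<bullet> \<phi> x\<bar> \<le> e * dist y x"
        using small_oscillation_imp_small_increments[OF _ uL osc \<open>e > 0\<close>] unfolding u_def by blast
    qed
    moreover have "first_order_approx (\<lambda>_. 0) \<phi> x 0"
      by (rule first_order_approx_zeroI) (auto intro: exI[of _ 1])
    ultimately have "v = 0" using diff unfolding differentiable_wrt_def by blast
    then show ?thesis by (simp add: v_def)
  qed
  then have "l - mat 1 = 0" by (simp add: vec_eq_iff)
  then show ?thesis using l by simp
qed

end

section \<open>Images of charts\<close>

lemma chart_null_preimage:
  fixes \<mu> :: "'a::metric_space measure" and \<phi> :: "'a \<Rightarrow> real ^ 'n"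
  assumes mms: "metric_measure_space \<mu>" and vd: "volume_doubling \<mu>" and p: "p > 1" and PI: "poincare_inequality p \<mu>"
    and ch: "chart \<mu> U \<phi>" and N: "N \<in> null_sets lborel"
  shows "emeasure \<mu> (U \<inter> \<phi> -` N) = 0"
proof (rule ccontr)
  assume pos: "emeasure \<mu> (U \<inter> \<phi> -` N) \<noteq> 0"
  obtain C where "doubling_measure \<mu> C"
    using mms vd unfolding volume_doubling_def doubling_measure_def by blast
  then interpret doubling_measure \<mu> C .
  have U: "U \<in> sets \<mu>" using ch by (simp add: chart_def)
  obtain L where L: "L-lipschitz_on UNIV \<phi>" using ch by (auto simp: chart_def lipschitz_map_def)
  have \<phi>c: "continuous_on UNIV \<phi>" by (rule lipschitz_on_continuous_on[OF L])
  have \<phi>b: "\<phi> \<in> borel_measurable borel" by (rule borel_measurable_continuous_onI[OF \<phi>c])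
  have \<phi>m: "\<phi> \<in> borel_measurable \<mu>" by (rule borel_measurable_M[OF \<phi>b])
  have pre: "\<phi> -` A \<in> sets \<mu>" if "A \<in> sets borel" for A
    using measurable_sets[OF \<phi>m that] by simp
  have Nb: "N \<in> sets borel" using N by (auto simp: null_sets_def)
  define w0 where "w0 = (undefined :: 'a)"
  \<comment> \<open>Restricting to a ball makes the measure finite, as needed for inner regularity,
    for L^2 and for the density theorem.\<close>
  obtain r :: nat where r: "emeasure \<mu> (U \<inter> \<phi> -` N \<inter> ball w0 (real r)) \<noteq> 0"
  proof (rule ccontr)
    assume no: "\<not> thesis"
    have "U \<inter> \<phi> -` N \<inter> ball w0 (real r) \<in> null_sets \<mu>" for r
      using no that U pre[OF Nb] by (auto simp: null_sets_def)
    then have "(\<Union>r. U \<inter> \<phi> -` N \<inter> ball w0 (real r)) \<in> null_sets \<mu>" by (rule null_sets_UN)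
    moreover have "(\<Union>r. U \<inter> \<phi> -` N \<inter> ball w0 (real r)) = U \<inter> \<phi> -` N"
      using reals_Archimedean2 by fastforce
    ultimately show False using pos by (simp add: null_sets_def)
  qed
  define U1 where "U1 = U \<inter> ball w0 (real r)"
  have U1: "U1 \<in> sets \<mu>" unfolding U1_def using U by (intro sets.Int ball_sets)
  \<comment> \<open>Covering by finitely many balls needs a compact set. Being a finite Borel
    measure on \<open>real ^ 'n\<close>, \<open>\<nu>\<close> is inner regular, so \<open>N\<close>
    contains a compact \<open>K\<close> whose preimage still has positive measure.\<close>
  define \<nu> where "\<nu> = distr (density \<mu> (indicator U1)) borel \<phi>"
  have em: "emeasure \<nu> A = emeasure \<mu> (U1 \<inter> \<phi> -` A)" if "A \<in> sets borel" for A
    using pre[OF that] U1 \<phi>m that by (simp add: \<nu>_def emeasure_distr emeasure_density indicator_inter_arith[symmetric])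
  have "emeasure \<nu> N = (SUP K\<in>{K. K \<subseteq> N \<and> compact K}. emeasure \<nu> K)"
  proof (rule inner_regular)
    have "emeasure \<nu> (space \<nu>) \<le> emeasure \<mu> (ball w0 (real r))"
      by (subst em) (auto simp: \<nu>_def U1_def intro: emeasure_mono)
    then show "emeasure \<nu> (space \<nu>) \<noteq> \<infinity>" using ball_finite[of w0 "real r"] by (auto simp: top_unique)
  qed (use Nb in \<open>auto simp: \<nu>_def\<close>)
  moreover have "emeasure \<nu> N \<noteq> 0" using r by (subst em[OF Nb]) (simp add: U1_def Int_ac)
  ultimately obtain K where K: "K \<subseteq> N" "compact K" "emeasure \<nu> K \<noteq> 0"
    by (metis (mono_tags, lifting) SUP_bot_conv(1) bot_ennreal mem_Collect_eq)
  have Kb: "K \<in> sets borel" using K(2) by (simp add: borel_compact)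
  have Kn: "negligible K"
    using N K(1) null_sets_completionI[OF N] negligible_iff_null_sets negligible_subset by blast
  define V where "V = U1 \<inter> \<phi> -` K"
  have V: "V \<in> sets \<mu>" "emeasure \<mu> V \<noteq> 0" "emeasure \<mu> V < \<infinity>"
  proof -
    show "V \<in> sets \<mu>" using U1 pre[OF Kb] by (simp add: V_def)
    show "emeasure \<mu> V \<noteq> 0" using K(3) em[OF Kb] by (simp add: V_def)
    have "emeasure \<mu> V \<le> emeasure \<mu> (ball w0 (real r))" by (rule emeasure_mono) (auto simp: V_def U1_def)
    then show "emeasure \<mu> V < \<infinity>" using ball_finite[of w0 "real r"] by (rule le_less_trans)
  qed
  define n where "n = real CARD('n)"
  have n: "n \<ge> 1" by (simp add: n_def Suc_leI)
  define a where "a = sqrt (n - 1 / (2 * n\<^sup>2))"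
  define adm where "adm k Q B \<longleftrightarrow> C1_contraction Q B \<and> (\<forall>z. norm (Q z - z) \<le> (1/2) ^ k) \<and> (\<forall>z\<in>K. norm (B z) \<le> a)"
    for k :: nat and Q :: "real ^ 'n \<Rightarrow> real ^ 'n" and B
  \<comment> \<open>The elements are derivative fields pulled back along \<open>\<phi>\<close>.
    Their conditions pass to midpoints and become stricter with \<open>k\<close>, as the selection
    of a Cauchy sequence requires.\<close>
  define G where "G k = {\<lambda>x. B (\<phi> x) |B. \<exists>Q. adm k Q B}" for k
  let ?M = "restrict_space \<mu> V"
  interpret R: finite_measure ?M
    using V by (intro finite_measureI) (simp add: emeasure_restrict_space space_restrict_space)
  have spaceR: "space ?M = V" by (simp add: space_restrict_space)
  have Gm: "E \<in> borel_measurable ?M" if Ek: "E \<in> G k" for E k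
  proof -
    obtain B Q where B: "E = (\<lambda>x. B (\<phi> x))" "adm k Q B" using Ek by (auto simp: G_def)
    have "continuous_on UNIV (\<lambda>x. B (\<phi> x))"
      by (rule continuous_on_compose2[OF _ \<phi>c]) (use B(2) in \<open>auto simp: adm_def C1_contraction_def\<close>)
    then have "E \<in> borel_measurable \<mu>" unfolding B(1) by (intro borel_measurable_M borel_measurable_continuous_onI)
    then show ?thesis by (rule measurable_restrict_space1)
  qed
  have Gb: "norm (E x) \<le> n" if "E \<in> G k" for E k x
    using that C1_contraction_norm_le by (auto simp: G_def adm_def n_def)
  obtain E where E: "\<And>j. E j \<in> G j" "\<And>j. (\<integral>x. (norm (E j x - E (Suc j) x))\<^sup>2 \<partial>?M) \<le> (1/16) ^ j"
  proof (rule R.Cauchy_selection[of G n])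
    show "G k \<noteq> {}" for k
    proof -
      obtain P B where PB: "C1_contraction P B" "\<And>x. norm (P x - x) \<le> (1/2) ^ k"
          "\<And>x. x \<in> K \<Longrightarrow> (norm (B x))\<^sup>2 \<le> real CARD('n) - 1 / (2 * (real CARD('n))\<^sup>2)"
        by (rule contraction_collapsing_null_set[OF K(2) Kn, of "(1/2) ^ k"]) simp_all
      have "norm (B z) \<le> a" if "z \<in> K" for z
        unfolding a_def n_def using real_le_rsqrt[OF PB(3)[OF that]] .
      then have "adm k P B" using PB by (simp add: adm_def)
      then show ?thesis by (auto simp: G_def)
    qed
    show "G l \<subseteq> G k" if "k \<le> l" for k l
    proof -
      have "(1/2::real) ^ l \<le> (1/2) ^ k" using that by (rule power_decreasing) auto
      then have "adm l Q B \<Longrightarrow> adm k Q B" for Q B unfolding adm_def using order_trans by blast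
      then show ?thesis by (auto simp: G_def)
    qed
    show "(\<lambda>x. (1/2) *\<^sub>R (f x + g x)) \<in> G k" if fg: "f \<in> G k" "g \<in> G k" for f g k
    proof -
      obtain B1 Q1 where 1: "f = (\<lambda>x. B1 (\<phi> x))" "adm k Q1 B1" using fg(1) by (auto simp: G_def)
      obtain B2 Q2 where 2: "g = (\<lambda>x. B2 (\<phi> x))" "adm k Q2 B2" using fg(2) by (auto simp: G_def)
      have half: "norm ((1/2) *\<^sub>R (u + w)) \<le> c" if "norm u \<le> c" "norm w \<le> c" for u w :: "'v::real_normed_vector" and c :: real
        using norm_triangle_ineq[of u w] that by simp
      have mid: "adm k (\<lambda>z. (1/2) *\<^sub>R (Q1 z + Q2 z)) (\<lambda>z. (1/2) *\<^sub>R (B1 z + B2 z))"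
        unfolding adm_def
      proof (intro conjI allI ballI)
        show "C1_contraction (\<lambda>z. (1/2) *\<^sub>R (Q1 z + Q2 z)) (\<lambda>z. (1/2) *\<^sub>R (B1 z + B2 z))"
          using 1 2 by (intro C1_contraction_midpoint) (auto simp: adm_def)
        fix z
        have "(1/2) *\<^sub>R (Q1 z + Q2 z) - z = (1/2) *\<^sub>R ((Q1 z - z) + (Q2 z - z))"
          by (simp add: vec_eq_iff)
        then show "norm ((1/2) *\<^sub>R (Q1 z + Q2 z) - z) \<le> (1/2) ^ k"
          using half[of "Q1 z - z" "(1/2) ^ k" "Q2 z - z"] 1 2 by (simp add: adm_def)
      next
        fix z assume "z \<in> K"
        then show "norm ((1/2) *\<^sub>R (B1 z + B2 z)) \<le> a"
          using half[of "B1 z" a "B2 z"] 1 2 by (simp add: adm_def)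
      qed
      show ?thesis unfolding 1(1) 2(1) G_def mem_Collect_eq
        by (rule exI[of _ "\<lambda>z. (1/2) *\<^sub>R (B1 z + B2 z)"], rule conjI[OF refl], rule exI, rule mid)
    qed
  qed (use Gm Gb in auto)
  have "\<forall>j. \<exists>B Q. E j = (\<lambda>x. B (\<phi> x)) \<and> adm j Q B" using E(1) by (auto simp: G_def)
  then obtain B Q where BQ: "\<And>j. E j = (\<lambda>x. B j (\<phi> x))" "\<And>j. adm j (Q j) (B j)" by metis
  have posR: "emeasure ?M (space ?M) > 0"
  proof -
    have eq: "emeasure ?M (space ?M) = emeasure \<mu> V"
      unfolding spaceR by (rule emeasure_restrict_space) (simp_all add: V(1))
    show ?thesis unfolding eq zero_less_iff_neq_zero by (rule V(2))
  qed
  note m_ex = R.fast_Cauchy_uniform[of E n, OF Gm[OF E(1)] Gb[OF E(1)] E(2) posR]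
  obtain m where m: "{x \<in> space ?M. \<forall>k\<ge>m. norm (E k x - E (Suc k) x) \<le> (1/2) ^ k} \<in> sets ?M"
    "emeasure ?M {x \<in> space ?M. \<forall>k\<ge>m. norm (E k x - E (Suc k) x) \<le> (1/2) ^ k} > 0"
    by (rule m_ex)
  define T where "T = {x \<in> V. \<forall>k\<ge>m. norm (E k x - E (Suc k) x) \<le> (1/2) ^ k}"
  have T: "T \<in> sets \<mu>" "emeasure \<mu> T > 0" "T \<subseteq> V"
  proof -
    have Vs: "V \<inter> space \<mu> \<in> sets \<mu>" using V(1) by simp
    have mT: "T \<in> sets ?M" "emeasure ?M T > 0" unfolding T_def by (rule m(1)[unfolded spaceR], rule m(2)[unfolded spaceR])
    show TV: "T \<subseteq> V" unfolding T_def by blast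
    show "T \<in> sets \<mu>" using mT(1) sets_restrict_space_iff[OF Vs] by blast
    show "emeasure \<mu> T > 0" using mT(2) unfolding emeasure_restrict_space[OF Vs TV] .
  qed
  have Tfin: "emeasure \<mu> T < \<infinity>" using emeasure_mono[OF T(3) V(1)] V(3) by (rule le_less_trans)
  \<comment> \<open>The chart condition is applied to the zero function: its differentiability says
    precisely that 0 is its only derivative.\<close>
  have "lipschitz_map (\<lambda>_::'a. 0::real)" unfolding lipschitz_map_def by (auto intro: lipschitz_on_constant)
  then have dif: "AE x in \<mu>. x \<in> U \<longrightarrow> differentiable_wrt (\<lambda>_. 0) \<phi> x"
    using ch unfolding chart_def by (auto elim!: eventually_mono)
  obtain x where x: "x \<in> T" "differentiable_wrt (\<lambda>_. 0) \<phi> x"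
    "\<And>c. c > 0 \<Longrightarrow> \<exists>\<rho>>0. \<forall>r. 0 < r \<and> r < \<rho> \<longrightarrow> emeasure \<mu> (ball x r - T) \<le> ennreal c * emeasure \<mu> (ball x r)"
  proof (rule ccontr)
    assume no: "\<not> thesis"
    have "AE x in \<mu>. x \<notin> T"
      using dif AE_density_point[OF T(1) Tfin]
    proof eventually_elim
      fix x assume "x \<in> U \<longrightarrow> differentiable_wrt (\<lambda>_. 0) \<phi> x"
        "x \<in> T \<longrightarrow> (\<forall>c>0. \<exists>\<rho>>0. \<forall>r. 0 < r \<and> r < \<rho> \<longrightarrow> emeasure \<mu> (ball x r - T) \<le> ennreal c * emeasure \<mu> (ball x r))"
      then show "x \<notin> T" using no that T(3) unfolding V_def U1_def by blast
    qed
    then have "T \<in> null_sets \<mu>" using T(1) by (simp add: AE_iff_null_sets)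
    then show False using T(2) by (simp add: null_sets_def)
  qed
  \<comment> \<open>The estimates on \<open>T\<close> start at index \<open>m\<close>; after the
    shift they hold from index 0 with the same bounds \<open>(1/2) ^ k\<close>.\<close>
  have "(\<lambda>k. B (k + m) (\<phi> x)) \<longlonglongrightarrow> mat 1"
  proof (rule limit_derivative_identity[OF p PI L, of "\<lambda>k. Q (k + m)" "\<lambda>k. B (k + m)" T])
    fix k
    show "C1_contraction (Q (k + m)) (B (k + m))" using BQ(2)[of "k + m"] by (simp add: adm_def)
    have le: "(1/2::real) ^ (k + m) \<le> (1/2) ^ k" by (rule power_decreasing) auto
    show "norm (Q (k + m) z - z) \<le> (1/2) ^ k" for z
      using BQ(2)[of "k + m"] le unfolding adm_def by (meson order_trans)
    show "norm (B (k + m) (\<phi> y) - B (Suc k + m) (\<phi> y)) \<le> (1/2) ^ k" if "y \<in> T" for y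
    proof -
      have "norm (E (k + m) y - E (Suc (k + m)) y) \<le> (1/2) ^ (k + m)" using that unfolding T_def by simp
      then have "norm (B (k + m) (\<phi> y) - B (Suc k + m) (\<phi> y)) \<le> (1/2) ^ (k + m)" by (simp add: BQ(1))
      then show ?thesis using le by (rule order_trans)
    qed
  qed (use T x in auto)
  moreover have "norm (B (k + m) (\<phi> x)) \<le> a" for k
    using BQ(2)[of "k + m"] x(1) T(3) by (auto simp: adm_def V_def)
  ultimately have "norm (mat 1 :: real ^ 'n ^ 'n) \<le> a"
    by (intro LIMSEQ_le_const2[OF tendsto_norm]) auto
  moreover have "norm (mat 1 :: real ^ 'n ^ 'n) = sqrt n"
  proof -
    have "(norm (mat 1 :: real ^ 'n ^ 'n))\<^sup>2 = n"
      by (simp add: norm_matrix_power2 mat_def n_def if_distrib[of "\<lambda>x. x\<^sup>2"] cong: if_cong)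
    then show ?thesis by (metis norm_ge_zero real_sqrt_unique)
  qed
  ultimately show False using n by (simp add: a_def)
qed

text \<open>A set of diameter \<open>\<delta>\<close> lies in a closed ball of radius
  \<open>\<delta>\<close> about any of its points. This costs a factor \<open>2 ^ CARD('n)\<close>
  over the ball of the same diameter, irrelevant for null sets, so the premeasure at scale 1 is
  enough.\<close>

lemma hausdorff_null_imp_lebesgue_null:
  fixes A :: "(real ^ 'n) set"
  assumes "hausdorff_measure CARD('n) A = 0"
  obtains N where "N \<in> null_sets lborel" "A \<subseteq> N"
proof -
  let ?n = "CARD('n)"
  have "hausdorff_premeasure ?n 1 A \<le> hausdorff_measure ?n A"
    unfolding hausdorff_measure_def by (rule SUP_upper) simp
  then have pre: "hausdorff_premeasure ?n 1 A = 0" using assms by simp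
  have "\<exists>W. W \<in> sets borel \<and> A \<subseteq> W \<and> emeasure lborel W \<le> ennreal (1 / Suc k)" for k
  proof -
    \<comment> \<open>The power of two offsets the doubling of the radius, leaving Lebesgue measure
      at most \<open>1 / Suc k\<close>.\<close>
    define e where "e = 1 / (2 ^ ?n * real (Suc k))"
    have e: "e > 0" by (simp add: e_def)
    have "hausdorff_premeasure ?n 1 A < ennreal e" using pre e by simp
    then obtain E :: "nat \<Rightarrow> (real ^ 'n) set" where E: "A \<subseteq> (\<Union>i. E i)" "\<And>i. bounded (E i)"
      "(\<Sum>i. if E i = {} then 0 else ennreal (unit_ball_vol (real ?n) * (diameter (E i) / 2) ^ ?n)) < ennreal e"
      unfolding hausdorff_premeasure_def INF_less_iff by auto
    define x where "x i = (SOME y. y \<in> E i)" for i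
    define W where "W i = (if E i = {} then {} else cball (x i) (diameter (E i)))" for i
    have EW: "E i \<subseteq> W i" for i
    proof (cases "E i = {}")
      case False
      then have "x i \<in> E i" unfolding x_def by (simp add: some_in_eq)
      then have "dist (x i) y \<le> diameter (E i)" if "y \<in> E i" for y
        using diameter_bounded_bound[OF E(2)] that by blast
      then show ?thesis using False by (auto simp: W_def)
    qed (simp add: W_def)
    have Wb: "range W \<subseteq> sets lborel" by (auto simp: W_def)
    have Wi: "emeasure lborel (W i) = ennreal (2 ^ ?n) * (if E i = {} then 0 else ennreal (unit_ball_vol (real ?n) * (diameter (E i) / 2) ^ ?n))" for i
      using diameter_ge_0[OF E(2)[of i]]
      by (auto simp: W_def emeasure_cball power_divide simp flip: ennreal_mult)
    have "emeasure lborel (\<Union>i. W i) \<le> (\<Sum>i. emeasure lborel (W i))"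
      by (rule emeasure_subadditive_countably[OF Wb])
    also have "\<dots> = ennreal (2 ^ ?n) * (\<Sum>i. if E i = {} then 0 else ennreal (unit_ball_vol (real ?n) * (diameter (E i) / 2) ^ ?n))"
      unfolding Wi by simp
    also have "\<dots> \<le> ennreal (2 ^ ?n) * ennreal e" by (intro mult_left_mono less_imp_le[OF E(3)]) simp
    also have "\<dots> = ennreal (1 / Suc k)" by (simp add: e_def flip: ennreal_mult)
    finally have "emeasure lborel (\<Union>i. W i) \<le> ennreal (1 / Suc k)" .
    moreover have "(\<Union>i. W i) \<in> sets borel" using Wb by auto
    moreover have "A \<subseteq> (\<Union>i. W i)" using E(1) EW by blast
    ultimately show ?thesis by blast
  qed
  then obtain W where W: "\<And>k. W k \<in> sets borel" "\<And>k. A \<subseteq> W k" "\<And>k. emeasure lborel (W k) \<le> ennreal (1 / Suc k)"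
    by metis
  have "emeasure lborel (\<Inter>k. W k) \<le> 0 + ennreal e" if "e > 0" for e
  proof -
    obtain k where "1 / Suc k < e" using nat_approx_posE[OF \<open>e > 0\<close>] by (metis of_nat_Suc)
    then have "ennreal (1 / Suc k) \<le> ennreal e" by (intro ennreal_leI) simp
    moreover have "emeasure lborel (\<Inter>k. W k) \<le> emeasure lborel (W k)" using W(1) by (intro emeasure_mono) auto
    ultimately show ?thesis unfolding add_0 using W(3)[of k] by (meson order_trans)
  qed
  then have "emeasure lborel (\<Inter>k. W k) \<le> 0" by (rule ennreal_le_epsilon)
  moreover have "(\<Inter>k. W k) \<in> sets borel" using W(1) by (intro sets.countable_INT) auto
  ultimately have "(\<Inter>k. W k) \<in> null_sets lborel" by (simp add: null_sets_def)
  moreover have "A \<subseteq> (\<Inter>k. W k)" using W(2) by blast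
  ultimately show ?thesis using that by blast
qed

theorem proposition5p18:
  fixes \<mu> :: "'a::complete_space measure"
    and p :: real
    and U :: "'a set"
    and \<phi> :: "'a \<Rightarrow> real ^ 'n"
  assumes "metric_measure_space \<mu>"
    and "volume_doubling \<mu>"
    and "1 < p" and "poincare_inequality p \<mu>"
    and "chart \<mu> U \<phi>"
  shows "absolutely_continuous lborel (distr (density \<mu> (indicator U)) borel \<phi>) \<and>
         hausdorff_measure CARD('n) (\<phi> ` U) > 0"
proof
  note null = chart_null_preimage[OF assms]
  obtain L where "L-lipschitz_on UNIV \<phi>" using assms(5) by (auto simp: chart_def lipschitz_map_def)
  then have "\<phi> \<in> borel_measurable borel"
    by (intro borel_measurable_continuous_onI lipschitz_on_continuous_on)
  moreover have "space \<mu> = UNIV" "sets borel \<subseteq> sets \<mu>"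
    using assms(1) by (auto simp: metric_measure_space_def radon_measure_def)
  ultimately have \<phi>: "\<phi> \<in> borel_measurable \<mu>"
    by (intro measurableI) (auto dest: measurable_sets_borel)
  have U: "U \<in> sets \<mu>" "emeasure \<mu> U > 0" using assms(5) by (auto simp: chart_def)
  show "absolutely_continuous lborel (distr (density \<mu> (indicator U)) borel \<phi>)"
    unfolding absolutely_continuous_def
  proof
    fix N :: "(real ^ 'n) set" assume N: "N \<in> null_sets lborel"
    then have Nb: "N \<in> sets borel" by (auto simp: null_sets_def)
    have pre: "\<phi> -` N \<in> sets \<mu>" using measurable_sets[OF \<phi> Nb] \<open>space \<mu> = UNIV\<close> by simp
    have "emeasure (distr (density \<mu> (indicator U)) borel \<phi>) N = emeasure \<mu> (U \<inter> \<phi> -` N)"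
      using pre U \<phi> Nb \<open>space \<mu> = UNIV\<close>
      by (simp add: emeasure_distr emeasure_density indicator_inter_arith[symmetric])
    then show "N \<in> null_sets (distr (density \<mu> (indicator U)) borel \<phi>)"
      using null[OF N] Nb by (simp add: null_sets_def)
  qed
  show "hausdorff_measure CARD('n) (\<phi> ` U) > 0"
  proof (rule ccontr)
    assume "\<not> ?thesis"
    then have "hausdorff_measure CARD('n) (\<phi> ` U) = 0" by simp
    then obtain N where N: "N \<in> null_sets lborel" "\<phi> ` U \<subseteq> N" by (rule hausdorff_null_imp_lebesgue_null)
    then have "U \<inter> \<phi> -` N = U" by blast
    then show False using null[OF N(1)] U(2) by simp
  qed
qed

end
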